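(* Let $0<\theta<1$ and $1\le r\le\infty$. Let $(X,\mathcal A,\nu)$ be a measure space and let $H$ be a reproducing kernel Hilbert space on $X$ with measurable kernel $k$ such that $H$ is compactly embedded into $L^2(\nu)$. Then $$[H]_\sim^{(\theta,r)} = [L^2(\nu),[H]_\sim]_{\theta,r},$$ and the norms on these two spaces are equivalent.
   Context: All vector spaces are real. For a measurable $f:X\to\mathbb R$, $[f]_\sim$ denotes its $\nu$-almost-everywhere equivalence class; for a set $E$ of measurable functions, $[E]_\sim=\{[f]_\sim: f\in E\}$. $H$ being compactly embedded into $L^2(\nu)$ means that $I_k:H\to L^2(\nu)$, $f\mapsto [f]_\sim$, is a well-defined compact operator. Put $T_k:=I_kI_k^*:L^2(\nu)\to L^2(\nu)$ (self-adjoint, positive, compact). Its non-zero eigenvalues (with multiplicity) in non-increasing order are $(\mu_i)_{i\in I}$, with $I=\{1,\dots,n\}$ or $I=\mathbb N$; so $\mu_i>0$. There are functions $e_i\in H$ such that $([e_i]_\sim)_{i\in I}$ is an orthonormal system in $L^2(\nu)$ with $T_k[e_i]_\sim=\mu_i[e_i]_\sim$ and $(\sqrt{\mu_i}\,e_i)_{i\in I}$ is an orthonormal system in $H$; such functions are fixed. The space $[H]_\sim$ (the range of $I_k$) is a Hilbert space with the quotient norm $\|[f]_\sim\|_{[H]_\sim}:=\inf\{\|g\|_H : g\in H,\ I_kg=[f]_\sim\}$. Real interpolation: for Banach spaces $E_2\hookrightarrow E_1$ (continuous inclusion), $x\in E_1$, $t>0$, let $K(x,t,E_1,E_2):=\inf_{y\in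 E_2}(\|x-y\|_{E_1}+t\|y\|_{E_2})$. For $0<\theta<1$ let $\|x\|_{[E_1,E_2]_{\theta,r}}:=\left(\int_0^\infty t^{-\theta r-1}K(x,t,E_1,E_2)^r\,dt\right)^{1/r}$ if $1\le r<\infty$ and $\|x\|_{[E_1,E_2]_{\theta,\infty}}:=\sup_{t>0}t^{-\theta}K(x,t,E_1,E_2)$. The space $[E_1,E_2]_{\theta,r}$ consists of all $x\in E_1$ for which this norm is finite. Power spaces: for $j\in\mathbb Z$ let $M_j:=\{i\in I: 2^j<\mu_i\le 2^{j+1}\}$. For a real sequence $b=(b_i)_{i\in I}$ put $c_j(b):=\left(\sum_{i\in M_j}b_i^2\mu_i^{-\theta}\right)^{1/2}$ and $\|b\|_{(\mu,\theta,r)}:=\|(c_j(b))_{j\in\mathbb Z}\|_{\ell^r(\mathbb Z)}$, and let $\ell^{(\mu,\theta,r)}:=\{b:\|b\|_{(\mu,\theta,r)}<\infty\}$. Then $[H]_\sim^{(\theta,r)}:=\{f\in L^2(\nu):\exists b\in\ell^{(\mu,\theta,r)}\text{ with } f=\sum_{i\in I}b_i[e_i]_\sim\}$ (series convergent in $L^2(\nu)$), with norm $\left\|\sum_{i\in I}b_i[e_i]_\sim\right\|_{[H]_\sim^{(\theta,r)}}:=\|b\|_{(\mu,\theta,r)}$. *)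

theory Defs
  imports "HOL-Analysis.Analysis"
begin

section \<open>Real normed and inner product spaces with an explicit carrier\<close>

text \<open>
  The space \<open>L\<^sup>2(\<nu>)\<close> depends on the measure \<open>\<nu>\<close>, so it cannot be an instance of a type class;
  all spaces below are records with a carrier set. Nothing is assumed about the operations
  outside the carrier.
\<close>

record 'v nspace =
  vcarrier :: "'v set"
  vzero :: 'v
  vadd :: "'v \<Rightarrow> 'v \<Rightarrow> 'v"
  vscale :: "real \<Rightarrow> 'v \<Rightarrow> 'v"
  vnorm :: "'v \<Rightarrow> real"

record 'v hspace = "'v nspace" +
  vinner :: "'v \<Rightarrow> 'v \<Rightarrow> real"

definition vsub :: "('v, 'm) nspace_scheme \<Rightarrow> 'v \<Rightarrow> 'v \<Rightarrow> 'v" where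
  "vsub V x y = vadd V x (vscale V (-1) y)"

text \<open>The case distinction only makes the distance nonnegative and symmetric on the whole type,
  as the locale \<open>Metric_space\<close> requires.\<close>

definition vdist :: "('v, 'm) nspace_scheme \<Rightarrow> 'v \<Rightarrow> 'v \<Rightarrow> real" where
  "vdist V x y = (if x \<in> vcarrier V \<and> y \<in> vcarrier V then vnorm V (vsub V x y) else 0)"

primrec vpsum :: "('v, 'm) nspace_scheme \<Rightarrow> (nat \<Rightarrow> 'v) \<Rightarrow> nat \<Rightarrow> 'v" where
  "vpsum V u 0 = vzero V"
| "vpsum V u (Suc n) = vadd V (vpsum V u n) (u n)"

definition vsums :: "('v, 'm) nspace_scheme \<Rightarrow> (nat \<Rightarrow> 'v) \<Rightarrow> 'v \<Rightarrow> bool" where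
  "vsums V u x \<longleftrightarrow> (\<lambda>n. vnorm V (vsub V (vpsum V u n) x)) \<longlonglongrightarrow> 0"

locale hilbert_space =
  fixes V :: "'v hspace"
  assumes zero_closed: "vzero V \<in> vcarrier V"
    and add_closed: "\<lbrakk>x \<in> vcarrier V; y \<in> vcarrier V\<rbrakk> \<Longrightarrow> vadd V x y \<in> vcarrier V"
    and scale_closed: "x \<in> vcarrier V \<Longrightarrow> vscale V c x \<in> vcarrier V"
    and add_assoc: "\<lbrakk>x \<in> vcarrier V; y \<in> vcarrier V; z \<in> vcarrier V\<rbrakk>
      \<Longrightarrow> vadd V (vadd V x y) z = vadd V x (vadd V y z)"
    and add_commute: "\<lbrakk>x \<in> vcarrier V; y \<in> vcarrier V\<rbrakk> \<Longrightarrow> vadd V x y = vadd V y x"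
    and add_zero: "x \<in> vcarrier V \<Longrightarrow> vadd V x (vzero V) = x"
    and add_inverse: "x \<in> vcarrier V \<Longrightarrow> vadd V x (vscale V (-1) x) = vzero V"
    and scale_add: "\<lbrakk>x \<in> vcarrier V; y \<in> vcarrier V\<rbrakk>
      \<Longrightarrow> vscale V c (vadd V x y) = vadd V (vscale V c x) (vscale V c y)"
    and add_scale: "x \<in> vcarrier V \<Longrightarrow> vscale V (c + d) x = vadd V (vscale V c x) (vscale V d x)"
    and scale_scale: "x \<in> vcarrier V \<Longrightarrow> vscale V c (vscale V d x) = vscale V (c * d) x"
    and scale_one: "x \<in> vcarrier V \<Longrightarrow> vscale V 1 x = x"
    and inner_commute: "\<lbrakk>x \<in> vcarrier V; y \<in> vcarrier V\<rbrakk> \<Longrightarrow> vinner V x y = vinner V y x"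
    and inner_add: "\<lbrakk>x \<in> vcarrier V; y \<in> vcarrier V; z \<in> vcarrier V\<rbrakk>
      \<Longrightarrow> vinner V (vadd V x y) z = vinner V x z + vinner V y z"
    and inner_scale: "\<lbrakk>x \<in> vcarrier V; y \<in> vcarrier V\<rbrakk>
      \<Longrightarrow> vinner V (vscale V c x) y = c * vinner V x y"
    and inner_nonneg: "x \<in> vcarrier V \<Longrightarrow> 0 \<le> vinner V x x"
    and inner_definite: "\<lbrakk>x \<in> vcarrier V; vinner V x x = 0\<rbrakk> \<Longrightarrow> x = vzero V"
    and norm_inner: "x \<in> vcarrier V \<Longrightarrow> vnorm V x = sqrt (vinner V x x)"
    and complete: "Metric_space.mcomplete (vcarrier V) (vdist V)"

definition orthonormal_system :: "'v hspace \<Rightarrow> 'i set \<Rightarrow> ('i \<Rightarrow> 'v) \<Rightarrow> bool" where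
  "orthonormal_system V I u \<longleftrightarrow>
     (\<forall>i\<in>I. u i \<in> vcarrier V) \<and>
     (\<forall>i\<in>I. \<forall>j\<in>I. vinner V (u i) (u j) = (if i = j then 1 else 0))"

text \<open>A subspace \<open>S\<close> has dimension \<open>n\<close> iff the coordinate map \<open>\<real>\<^sup>n \<rightarrow> S\<close> of some basis
  \<open>b\<^sub>0, \<dots>, b\<^bsub>n-1\<^esub>\<close> is a bijection; \<open>\<real>\<^sup>n\<close> is the set of sequences that vanish from \<open>n\<close> on.\<close>

definition has_dimension :: "('v, 'm) nspace_scheme \<Rightarrow> 'v set \<Rightarrow> nat \<Rightarrow> bool" where
  "has_dimension V S n \<longleftrightarrow>
     (\<exists>b. (\<forall>i<n. b i \<in> S) \<and>
          bij_betw (\<lambda>c. vpsum V (\<lambda>i. vscale V (c i) (b i)) n)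
            {c :: nat \<Rightarrow> real. \<forall>i\<ge>n. c i = 0} S)"


section \<open>Operators\<close>

definition linear_operator ::
    "('v, 'm) nspace_scheme \<Rightarrow> ('w, 'n) nspace_scheme \<Rightarrow> ('v \<Rightarrow> 'w) \<Rightarrow> bool" where
  "linear_operator V W T \<longleftrightarrow>
     (\<forall>x\<in>vcarrier V. T x \<in> vcarrier W) \<and>
     (\<forall>x\<in>vcarrier V. \<forall>y\<in>vcarrier V. T (vadd V x y) = vadd W (T x) (T y)) \<and>
     (\<forall>c. \<forall>x\<in>vcarrier V. T (vscale V c x) = vscale W c (T x))"

definition compact_operator ::
    "('v, 'm) nspace_scheme \<Rightarrow> ('w, 'n) nspace_scheme \<Rightarrow> ('v \<Rightarrow> 'w) \<Rightarrow> bool" where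
  "compact_operator V W T \<longleftrightarrow>
     linear_operator V W T \<and>
     (let \<tau> = Metric_space.mtopology (vcarrier W) (vdist W)
      in compactin \<tau> (\<tau> closure_of (T ` {x \<in> vcarrier V. vnorm V x \<le> 1})))"

definition adjoint_operator :: "'v hspace \<Rightarrow> 'w hspace \<Rightarrow> ('v \<Rightarrow> 'w) \<Rightarrow> 'w \<Rightarrow> 'v" where
  "adjoint_operator V W T w =
     (THE v. v \<in> vcarrier V \<and> (\<forall>u\<in>vcarrier V. vinner W (T u) w = vinner V u v))"

definition eigenspace :: "('v, 'm) nspace_scheme \<Rightarrow> ('v \<Rightarrow> 'v) \<Rightarrow> real \<Rightarrow> 'v set" where
  "eigenspace V T l = {v \<in> vcarrier V. T v = vscale V l v}"

text \<open>\<open>(\<mu>\<^sub>i)\<^bsub>i\<in>I\<^esub>\<close> lists the non-zero eigenvalues of \<open>T\<close> in non-increasing order, each one as often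
  as its multiplicity, i.e. the dimension of its eigenspace. A non-zero number that is not an
  eigenvalue has eigenspace \<open>{0}\<close>, of dimension \<open>0\<close>, so it is not listed.
  Indices start at \<open>1\<close>; \<open>n = 0\<close> covers \<open>T = 0\<close>.\<close>

definition eigenvalue_enumeration ::
    "('v, 'm) nspace_scheme \<Rightarrow> ('v \<Rightarrow> 'v) \<Rightarrow> nat set \<Rightarrow> (nat \<Rightarrow> real) \<Rightarrow> bool" where
  "eigenvalue_enumeration V T I \<mu> \<longleftrightarrow>
     ((\<exists>n. I = {1..n}) \<or> I = {1..}) \<and>
     (\<forall>i\<in>I. \<mu> i \<noteq> 0) \<and>
     (\<forall>i\<in>I. \<forall>j\<in>I. i \<le> j \<longrightarrow> \<mu> j \<le> \<mu> i) \<and>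
     (\<forall>l. l \<noteq> 0 \<longrightarrow>
        finite {i \<in> I. \<mu> i = l} \<and> has_dimension V (eigenspace V T l) (card {i \<in> I. \<mu> i = l}))"


section \<open>The space of square integrable functions modulo null functions\<close>

definition ae_rel :: "'a measure \<Rightarrow> (('a \<Rightarrow> real) \<times> ('a \<Rightarrow> real)) set" where
  "ae_rel M = {(f, g). f \<in> borel_measurable M \<and> g \<in> borel_measurable M \<and> (AE x in M. f x = g x)}"

definition ae_class :: "'a measure \<Rightarrow> ('a \<Rightarrow> real) \<Rightarrow> ('a \<Rightarrow> real) set" where
  "ae_class M f = ae_rel M `` {f}"

definition ae_rep :: "('a \<Rightarrow> real) set \<Rightarrow> 'a \<Rightarrow> real" where
  "ae_rep F = (SOME f. f \<in> F)"

definition square_integrable :: "'a measure \<Rightarrow> ('a \<Rightarrow> real) set" where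
  "square_integrable M = {f \<in> borel_measurable M. integrable M (\<lambda>x. (f x)\<^sup>2)}"

definition L2 :: "'a measure \<Rightarrow> ('a \<Rightarrow> real) set hspace" where
  "L2 M = \<lparr>
     vcarrier = square_integrable M // ae_rel M,
     vzero = ae_class M (\<lambda>x. 0),
     vadd = (\<lambda>F G. ae_class M (\<lambda>x. ae_rep F x + ae_rep G x)),
     vscale = (\<lambda>c F. ae_class M (\<lambda>x. c * ae_rep F x)),
     vnorm = (\<lambda>F. sqrt (\<integral>x. (ae_rep F x)\<^sup>2 \<partial>M)),
     vinner = (\<lambda>F G. \<integral>x. ae_rep F x * ae_rep G x \<partial>M)\<rparr>"


section \<open>Reproducing kernel Hilbert spaces\<close>

text \<open>A function \<open>X \<rightarrow> \<real>\<close> is an element of \<open>extensional X\<close>, i.e. it is \<open>undefined\<close> outside \<open>X\<close>.\<close>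

locale rkhs = hilbert_space H
  for X :: "'a set" and H :: "('a \<Rightarrow> real) hspace" and k :: "'a \<Rightarrow> 'a \<Rightarrow> real" +
  assumes carrier_functions: "vcarrier H \<subseteq> extensional X"
    and zero_pointwise: "x \<in> X \<Longrightarrow> vzero H x = 0"
    and add_pointwise: "\<lbrakk>f \<in> vcarrier H; g \<in> vcarrier H; x \<in> X\<rbrakk> \<Longrightarrow> vadd H f g x = f x + g x"
    and scale_pointwise: "\<lbrakk>f \<in> vcarrier H; x \<in> X\<rbrakk> \<Longrightarrow> vscale H c f x = c * f x"
    and kernel_in: "x \<in> X \<Longrightarrow> (\<lambda>y\<in>X. k y x) \<in> vcarrier H"
    and reproducing: "\<lbrakk>f \<in> vcarrier H; x \<in> X\<rbrakk> \<Longrightarrow> vinner H f (\<lambda>y\<in>X. k y x) = f x"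

definition compactly_embedded :: "'a measure \<Rightarrow> ('a \<Rightarrow> real) hspace \<Rightarrow> bool" where
  "compactly_embedded M H \<longleftrightarrow>
     vcarrier H \<subseteq> square_integrable M \<and> compact_operator H (L2 M) (ae_class M)"

definition T_op :: "'a measure \<Rightarrow> ('a \<Rightarrow> real) hspace \<Rightarrow> ('a \<Rightarrow> real) set \<Rightarrow> ('a \<Rightarrow> real) set" where
  "T_op M H F = ae_class M (adjoint_operator H (L2 M) (ae_class M) F)"

definition quotient_space ::
    "'a measure \<Rightarrow> ('a \<Rightarrow> real) hspace \<Rightarrow> ('a \<Rightarrow> real) set nspace" where
  "quotient_space M H = \<lparr>
     vcarrier = ae_class M ` vcarrier H,
     vzero = vzero (L2 M),
     vadd = vadd (L2 M),
     vscale = vscale (L2 M),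
     vnorm = (\<lambda>F. INF g\<in>{g \<in> vcarrier H. ae_class M g = F}. vnorm H g)\<rparr>"


section \<open>Real interpolation\<close>

definition ennreal_powr :: "ennreal \<Rightarrow> real \<Rightarrow> ennreal" where
  "ennreal_powr x a = (if x = top then top else ennreal (enn2real x powr a))"

definition K_functional ::
    "'v \<Rightarrow> real \<Rightarrow> ('v, 'm) nspace_scheme \<Rightarrow> ('v, 'n) nspace_scheme \<Rightarrow> real" where
  "K_functional x t E1 E2 = (INF y\<in>vcarrier E2. vnorm E1 (vsub E1 x y) + t * vnorm E2 y)"

definition interp_norm ::
    "('v, 'm) nspace_scheme \<Rightarrow> ('v, 'n) nspace_scheme \<Rightarrow> real \<Rightarrow> ennreal \<Rightarrow> 'v \<Rightarrow> ennreal" where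
  "interp_norm E1 E2 \<theta> r x =
     (if r = top then (SUP t\<in>{0<..}. ennreal (t powr (-\<theta>) * K_functional x t E1 E2))
      else ennreal_powr
        (\<integral>\<^sup>+t\<in>{0<..}. ennreal (t powr (-\<theta> * enn2real r - 1) * K_functional x t E1 E2 powr enn2real r)
           \<partial>lborel)
        (1 / enn2real r))"

definition interp_space ::
    "('v, 'm) nspace_scheme \<Rightarrow> ('v, 'n) nspace_scheme \<Rightarrow> real \<Rightarrow> ennreal \<Rightarrow> 'v nspace" where
  "interp_space E1 E2 \<theta> r = \<lparr>
     vcarrier = {x \<in> vcarrier E1. interp_norm E1 E2 \<theta> r x < top},
     vzero = vzero E1,
     vadd = vadd E1,
     vscale = vscale E1,
     vnorm = (\<lambda>x. enn2real (interp_norm E1 E2 \<theta> r x))\<rparr>"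


section \<open>Power spaces\<close>

definition dyadic_block :: "nat set \<Rightarrow> (nat \<Rightarrow> real) \<Rightarrow> int \<Rightarrow> nat set" where
  "dyadic_block I \<mu> j = {i \<in> I. 2 powi j < \<mu> i \<and> \<mu> i \<le> 2 powi (j + 1)}"

text \<open>The blocks are finite when \<open>\<mu>\<close> enumerates the non-zero eigenvalues of a compact positive
  operator, as \<open>0\<close> is then the only possible accumulation point of \<open>\<mu>\<close>.\<close>

definition block_coeff :: "nat set \<Rightarrow> (nat \<Rightarrow> real) \<Rightarrow> real \<Rightarrow> (nat \<Rightarrow> real) \<Rightarrow> int \<Rightarrow> real" where
  "block_coeff I \<mu> \<theta> b j = sqrt (\<Sum>i\<in>dyadic_block I \<mu> j. (b i)\<^sup>2 * \<mu> i powr (-\<theta>))"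

definition power_seq_norm ::
    "nat set \<Rightarrow> (nat \<Rightarrow> real) \<Rightarrow> real \<Rightarrow> ennreal \<Rightarrow> (nat \<Rightarrow> real) \<Rightarrow> ennreal" where
  "power_seq_norm I \<mu> \<theta> r b =
     (if r = top then (SUP j. ennreal (block_coeff I \<mu> \<theta> b j))
      else ennreal_powr
        (\<integral>\<^sup>+j. ennreal (block_coeff I \<mu> \<theta> b j powr enn2real r) \<partial>count_space UNIV)
        (1 / enn2real r))"

definition expansion ::
    "'a measure \<Rightarrow> nat set \<Rightarrow> (nat \<Rightarrow> 'a \<Rightarrow> real) \<Rightarrow> (nat \<Rightarrow> real) \<Rightarrow> ('a \<Rightarrow> real) set \<Rightarrow> bool" where
  "expansion M I e b F \<longleftrightarrow>
     vsums (L2 M) (\<lambda>i. if i \<in> I then vscale (L2 M) (b i) (ae_class M (e i)) else vzero (L2 M)) F"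

text \<open>Only the values \<open>b i\<close> with \<open>i \<in> I\<close> matter, and as the \<open>[e\<^sub>i]\<close> are orthonormal these are
  determined by \<open>F\<close>; so the description in the norm is unique.\<close>

definition power_space ::
    "'a measure \<Rightarrow> nat set \<Rightarrow> (nat \<Rightarrow> real) \<Rightarrow> (nat \<Rightarrow> 'a \<Rightarrow> real) \<Rightarrow> real \<Rightarrow> ennreal
      \<Rightarrow> ('a \<Rightarrow> real) set nspace" where
  "power_space M I \<mu> e \<theta> r = \<lparr>
     vcarrier = {F \<in> vcarrier (L2 M).
       \<exists>b. power_seq_norm I \<mu> \<theta> r b < top \<and> expansion M I e b F},
     vzero = vzero (L2 M),
     vadd = vadd (L2 M),
     vscale = vscale (L2 M),
     vnorm = (\<lambda>F. enn2real (THE s. \<exists>b. power_seq_norm I \<mu> \<theta> r b < top \<and> expansion M I e b F \<and>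
       s = power_seq_norm I \<mu> \<theta> r b))\<rparr>"

definition equivalent_norms :: "'v set \<Rightarrow> ('v \<Rightarrow> real) \<Rightarrow> ('v \<Rightarrow> real) \<Rightarrow> bool" where
  "equivalent_norms S p q \<longleftrightarrow>
     (\<exists>c>0. \<exists>C>0. \<forall>x\<in>S. c * p x \<le> q x \<and> q x \<le> C * p x)"

end

theory Submission
  imports Defs
begin

text \<open>
  Write \<open>b\<^sub>i\<close> for the coefficient of \<open>F \<in> L\<^sup>2(\<nu>)\<close> at \<open>[e\<^sub>i]\<close>. In the coordinates \<open>b\<^sub>i\<close> the norm of
  \<open>L\<^sup>2(\<nu>)\<close> is the \<open>\<ell>\<^sup>2\<close> norm and that of \<open>[H]\<close> the \<open>\<ell>\<^sup>2\<close> norm with weights \<open>1 / \<mu>\<^sub>i\<close>, so the square of the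
  K-functional of \<open>F\<close> at \<open>t\<close> is comparable to \<open>\<Sum>\<^sub>i b\<^sub>i\<^sup>2 min 1 (t\<^sup>2 / \<mu>\<^sub>i)\<close>: the optimal approximation keeps the
  terms with \<open>\<mu>\<^sub>i > t\<^sup>2\<close>. Let \<open>c\<^sub>j\<close> be the block norms of \<open>b\<close>, and let \<open>2\<^sup>j \<le> t\<^sup>2 < 2\<^bsup>j+1\<^esup>\<close>. The \<open>j\<close>-th block
  alone shows that \<open>c\<^sub>j\<close> is at most a constant times \<open>t\<^bsup>-\<theta>\<^esup> K(F,t)\<close> (\<open>block_coeff_le_K\<close>). Conversely the
  \<open>l\<close>-th block contributes to \<open>t\<^bsup>-\<theta>\<^esup> K(F,t)\<close> at most \<open>c\<^sub>l\<close> times a factor that decays geometrically in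
  \<open>\<bar>l - j\<bar>\<close> (\<open>K_le_block_coeff\<close>). As \<open>dt / t\<close> gives all dyadic intervals the same mass, the interpolation
  norm is up to constants the \<open>\<ell>\<^sup>r\<close> norm of \<open>t\<^bsup>-\<theta>\<^esup> K(F,t)\<close> over \<open>j\<close>, and the geometric factors only
  cost another constant (\<open>seq_norm_le_weighted_norm\<close>, \<open>weighted_norm_le_seq_norm\<close>).

  It remains to see that every \<open>F\<close> in the interpolation space is the sum of its expansion. A finite
  interpolation norm puts \<open>F\<close> into the closure of \<open>[H]\<close> in \<open>L\<^sup>2(\<nu>)\<close>, and the functions in \<open>[H]\<close> are sums of their
  expansions by the spectral theorem for the compact operator \<open>T\<^sub>k\<close>. Its content here is the
  estimate \<open>norm_J_orthogonal\<close>: if \<open>f \<in> H\<close> is orthogonal to all \<open>e\<^sub>i\<close> with \<open>\<mu>\<^sub>i > \<epsilon>\<close>, then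
  \<open>\<parallel>[f]\<parallel>\<^sup>2 \<le> \<epsilon> \<parallel>f\<parallel>\<^sup>2\<close>. A violation would produce, from a maximising sequence, an eigenvector that the
  enumeration of the eigenvalues with multiplicities has no room for.
\<close>

section \<open>Inner product spaces with an explicit carrier\<close>

text \<open>All arguments about \<open>H\<close> and \<open>L\<^sup>2(\<nu>)\<close> run through inner products: two vectors are equal as
  soon as their difference has norm \<open>0\<close>, and vector identities are replaced by identities between
  inner products.\<close>

locale inner_space =
  fixes V :: "'v hspace"
  assumes zero_mem: "vzero V \<in> vcarrier V"
    and add_mem: "\<lbrakk>x \<in> vcarrier V; y \<in> vcarrier V\<rbrakk> \<Longrightarrow> vadd V x y \<in> vcarrier V"
    and scale_mem: "x \<in> vcarrier V \<Longrightarrow> vscale V c x \<in> vcarrier V"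
    and inner_zero_left: "x \<in> vcarrier V \<Longrightarrow> vinner V (vzero V) x = 0"
    and inner_sym: "\<lbrakk>x \<in> vcarrier V; y \<in> vcarrier V\<rbrakk> \<Longrightarrow> vinner V x y = vinner V y x"
    and inner_add_left: "\<lbrakk>x \<in> vcarrier V; y \<in> vcarrier V; z \<in> vcarrier V\<rbrakk>
      \<Longrightarrow> vinner V (vadd V x y) z = vinner V x z + vinner V y z"
    and inner_scale_left: "\<lbrakk>x \<in> vcarrier V; y \<in> vcarrier V\<rbrakk>
      \<Longrightarrow> vinner V (vscale V c x) y = c * vinner V x y"
    and inner_ge_0: "x \<in> vcarrier V \<Longrightarrow> 0 \<le> vinner V x x"
    and norm_sqrt: "x \<in> vcarrier V \<Longrightarrow> vnorm V x = sqrt (vinner V x x)"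
    and eq_if_dist_0: "\<lbrakk>x \<in> vcarrier V; y \<in> vcarrier V; vnorm V (vsub V x y) = 0\<rbrakk> \<Longrightarrow> x = y"
begin

lemma sub_mem: "\<lbrakk>x \<in> vcarrier V; y \<in> vcarrier V\<rbrakk> \<Longrightarrow> vsub V x y \<in> vcarrier V"
  by (simp add: vsub_def add_mem scale_mem)

lemmas mem = zero_mem add_mem scale_mem sub_mem

lemma inner_zero_right: "x \<in> vcarrier V \<Longrightarrow> vinner V x (vzero V) = 0"
  using inner_zero_left inner_sym zero_mem by metis

lemma inner_add_right: "\<lbrakk>x \<in> vcarrier V; y \<in> vcarrier V; z \<in> vcarrier V\<rbrakk>
      \<Longrightarrow> vinner V z (vadd V x y) = vinner V z x + vinner V z y"
  using inner_add_left inner_sym add_mem by metis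

lemma inner_scale_right: "\<lbrakk>x \<in> vcarrier V; y \<in> vcarrier V\<rbrakk>
      \<Longrightarrow> vinner V y (vscale V c x) = c * vinner V y x"
  using inner_scale_left inner_sym scale_mem by metis

lemma inner_sub_left: "\<lbrakk>x \<in> vcarrier V; y \<in> vcarrier V; z \<in> vcarrier V\<rbrakk>
      \<Longrightarrow> vinner V (vsub V x y) z = vinner V x z - vinner V y z"
  by (simp add: vsub_def inner_add_left inner_scale_left mem)

lemma inner_sub_right: "\<lbrakk>x \<in> vcarrier V; y \<in> vcarrier V; z \<in> vcarrier V\<rbrakk>
      \<Longrightarrow> vinner V z (vsub V x y) = vinner V z x - vinner V z y"
  by (simp add: vsub_def inner_add_right inner_scale_right mem)

lemmas inner_expand = inner_zero_left inner_zero_right inner_add_left inner_add_right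
  inner_scale_left inner_scale_right inner_sub_left inner_sub_right

lemma norm_sq: "x \<in> vcarrier V \<Longrightarrow> (vnorm V x)\<^sup>2 = vinner V x x"
  by (simp add: norm_sqrt inner_ge_0)

lemma norm_ge_0: "x \<in> vcarrier V \<Longrightarrow> 0 \<le> vnorm V x"
  by (simp add: norm_sqrt inner_ge_0)

lemma norm_scale: "x \<in> vcarrier V \<Longrightarrow> vnorm V (vscale V c x) = \<bar>c\<bar> * vnorm V x"
  by (simp add: norm_sqrt mem inner_expand real_sqrt_mult flip: mult.assoc)

lemma Cauchy_Schwarz_sq:
  assumes x: "x \<in> vcarrier V" and y: "y \<in> vcarrier V"
  shows "(vinner V x y)\<^sup>2 \<le> vinner V x x * vinner V y y"
proof -
  have quad: "0 \<le> vinner V x x - 2 * s * vinner V x y + s\<^sup>2 * vinner V y y" for s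
  proof -
    have "0 \<le> vinner V (vsub V x (vscale V s y)) (vsub V x (vscale V s y))"
      using x y by (intro inner_ge_0 mem)
    also have "\<dots> = vinner V x x - 2 * s * vinner V x y + s\<^sup>2 * vinner V y y"
      using x y inner_sym[OF x y] by (simp add: inner_expand mem power2_eq_square algebra_simps)
    finally show ?thesis .
  qed
  show ?thesis
  proof (cases "vinner V y y = 0")
    case True
    have "vinner V x y = 0"
    proof (rule ccontr)
      assume n: "vinner V x y \<noteq> 0"
      have "vinner V x x - 2 * ((vinner V x x + 1) / (2 * vinner V x y)) * vinner V x y = -1"
        using n by (simp add: field_simps)
      with quad[of "(vinner V x x + 1) / (2 * vinner V x y)"] True show False by simp
    qed
    then show ?thesis using True by simp
  next
    case False
    then have pos: "vinner V y y > 0" using inner_ge_0[OF y] by simp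
    have "0 \<le> vinner V x x - (vinner V x y)\<^sup>2 / vinner V y y"
      using quad[of "vinner V x y / vinner V y y"] pos
      by (simp add: field_simps power2_eq_square)
    then show ?thesis using pos by (simp add: field_simps)
  qed
qed

lemma Cauchy_Schwarz:
  assumes "x \<in> vcarrier V" "y \<in> vcarrier V"
  shows "\<bar>vinner V x y\<bar> \<le> vnorm V x * vnorm V y"
proof (rule power2_le_imp_le)
  show "\<bar>vinner V x y\<bar>\<^sup>2 \<le> (vnorm V x * vnorm V y)\<^sup>2"
    using Cauchy_Schwarz_sq[OF assms] assms by (simp add: power_mult_distrib norm_sq)
qed (simp add: assms norm_ge_0)

lemma norm_add_le:
  assumes "x \<in> vcarrier V" "y \<in> vcarrier V"
  shows "vnorm V (vadd V x y) \<le> vnorm V x + vnorm V y"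
proof (rule power2_le_imp_le)
  have "(vnorm V (vadd V x y))\<^sup>2 = (vnorm V x)\<^sup>2 + 2 * vinner V x y + (vnorm V y)\<^sup>2"
    using assms inner_sym[OF assms] by (simp add: norm_sq mem inner_expand)
  also have "\<dots> \<le> (vnorm V x)\<^sup>2 + 2 * (vnorm V x * vnorm V y) + (vnorm V y)\<^sup>2"
    using Cauchy_Schwarz[OF assms] by simp
  finally show "(vnorm V (vadd V x y))\<^sup>2 \<le> (vnorm V x + vnorm V y)\<^sup>2"
    by (simp add: power2_sum algebra_simps)
qed (simp add: assms norm_ge_0)

text \<open>Used in place of rewriting \<open>x\<close> to \<open>y\<close>: expanding both inner products bilinearly is left to the
  simplifier.\<close>

lemma norm_cong:
  assumes "x \<in> vcarrier V" "y \<in> vcarrier V" "vinner V x x = vinner V y y"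
  shows "vnorm V x = vnorm V y"
  using assms by (simp add: norm_sqrt)

lemma norm_sub_commute:
  assumes "x \<in> vcarrier V" "y \<in> vcarrier V"
  shows "vnorm V (vsub V x y) = vnorm V (vsub V y x)"
  using assms by (intro norm_cong) (simp_all add: mem inner_expand)

lemma norm_triangle:
  assumes "x \<in> vcarrier V" "y \<in> vcarrier V" "z \<in> vcarrier V"
  shows "vnorm V (vsub V x z) \<le> vnorm V (vsub V x y) + vnorm V (vsub V y z)"
proof -
  have "vnorm V (vsub V x z) = vnorm V (vadd V (vsub V x y) (vsub V y z))"
    using assms by (intro norm_cong) (simp_all add: mem inner_expand)
  also have "\<dots> \<le> vnorm V (vsub V x y) + vnorm V (vsub V y z)"
    using assms by (intro norm_add_le mem)
  finally show ?thesis .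
qed

lemma norm_diff_le:
  assumes "x \<in> vcarrier V" "y \<in> vcarrier V"
  shows "\<bar>vnorm V x - vnorm V y\<bar> \<le> vnorm V (vsub V x y)"
proof -
  have z: "vnorm V (vsub V u (vzero V)) = vnorm V u" if "u \<in> vcarrier V" for u
    using that by (intro norm_cong) (simp_all add: mem inner_expand)
  show ?thesis
    using norm_triangle[OF assms zero_mem] norm_triangle[OF assms(2,1) zero_mem]
      norm_sub_commute[OF assms] assms by (simp add: z)
qed

lemma norm_scale_sub:
  assumes "x \<in> vcarrier V" "y \<in> vcarrier V"
  shows "vnorm V (vsub V (vscale V c x) (vscale V c y)) = \<bar>c\<bar> * vnorm V (vsub V x y)"
proof -
  have "vnorm V (vsub V (vscale V c x) (vscale V c y)) = vnorm V (vscale V c (vsub V x y))"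
    using assms by (intro norm_cong) (simp_all add: mem inner_expand algebra_simps)
  then show ?thesis using assms by (simp add: norm_scale mem)
qed

lemma Metric_space: "Metric_space (vcarrier V) (vdist V)"
proof
  fix x y z
  show "0 \<le> vdist V x y" by (simp add: vdist_def norm_ge_0 mem)
  show "vdist V x y = vdist V y x" by (simp add: vdist_def norm_sub_commute)
  show "vdist V x y = 0 \<longleftrightarrow> x = y" if "x \<in> vcarrier V" "y \<in> vcarrier V"
  proof
    assume "x = y"
    then have "vinner V (vsub V x y) (vsub V x y) = 0" using that by (simp add: inner_expand mem)
    then show "vdist V x y = 0" using that by (simp add: vdist_def norm_sqrt mem)
  qed (use that eq_if_dist_0 in \<open>simp add: vdist_def\<close>)
  show "vdist V x z \<le> vdist V x y + vdist V y z"
    if "x \<in> vcarrier V" "y \<in> vcarrier V" "z \<in> vcarrier V"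
    using that by (simp add: vdist_def norm_triangle)
qed

subsection \<open>Convergence\<close>

definition converges :: "(nat \<Rightarrow> 'v) \<Rightarrow> 'v \<Rightarrow> bool" where
  "converges u x \<longleftrightarrow> (\<lambda>n. vnorm V (vsub V (u n) x)) \<longlonglongrightarrow> 0"

lemma converges_iff_limitin:
  assumes "\<And>n. u n \<in> vcarrier V" "x \<in> vcarrier V"
  shows "limitin (Metric_space.mtopology (vcarrier V) (vdist V)) u x sequentially \<longleftrightarrow> converges u x"
proof -
  interpret M: Metric_space "vcarrier V" "vdist V" by (rule Metric_space)
  have "\<bar>vnorm V (vsub V (u n) x)\<bar> = vnorm V (vsub V (u n) x)" for n
    using assms by (simp add: norm_ge_0 mem)
  then show ?thesis
    using assms by (simp add: M.limit_metric_sequentially converges_def LIMSEQ_iff vdist_def)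
qed

lemma converges_inner:
  assumes u: "\<And>n. u n \<in> vcarrier V" and x: "x \<in> vcarrier V" and y: "y \<in> vcarrier V"
    and lim: "converges u x"
  shows "(\<lambda>n. vinner V (u n) y) \<longlonglongrightarrow> vinner V x y"
proof (rule LIM_zero_cancel, rule Lim_null_comparison)
  show "\<forall>\<^sub>F n in sequentially. norm (vinner V (u n) y - vinner V x y) \<le> vnorm V (vsub V (u n) x) * vnorm V y"
  proof (rule always_eventually, rule allI)
    fix n
    show "norm (vinner V (u n) y - vinner V x y) \<le> vnorm V (vsub V (u n) x) * vnorm V y"
      using Cauchy_Schwarz[of "vsub V (u n) x" y] u x y by (simp add: mem inner_sub_left)
  qed
  show "(\<lambda>n. vnorm V (vsub V (u n) x) * vnorm V y) \<longlonglongrightarrow> 0"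
    using lim unfolding converges_def by (rule tendsto_mult_left_zero)
qed

lemma converges_norm:
  assumes u: "\<And>n. u n \<in> vcarrier V" and x: "x \<in> vcarrier V" and lim: "converges u x"
  shows "(\<lambda>n. vnorm V (u n)) \<longlonglongrightarrow> vnorm V x"
proof (rule LIM_zero_cancel, rule Lim_null_comparison)
  show "\<forall>\<^sub>F n in sequentially. norm (vnorm V (u n) - vnorm V x) \<le> vnorm V (vsub V (u n) x)"
    using norm_diff_le[OF u x] by simp
qed (use lim in \<open>simp add: converges_def\<close>)

subsection \<open>Finite sums and orthonormal systems\<close>

lemma vpsum_mem: "(\<And>i. i < n \<Longrightarrow> u i \<in> vcarrier V) \<Longrightarrow> vpsum V u n \<in> vcarrier V"
  by (induction n) (simp_all add: mem)

lemma inner_vpsum: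
  assumes "\<And>i. i < n \<Longrightarrow> u i \<in> vcarrier V" "y \<in> vcarrier V"
  shows "vinner V (vpsum V u n) y = (\<Sum>i<n. vinner V (u i) y)"
  using assms(1) by (induction n) (simp_all add: inner_expand mem vpsum_mem assms(2))

text \<open>The sum runs over \<open>A \<inter> {..<n}\<close>. It is padded with zero vectors so that the partial sums in the
  definition of \<open>expansion\<close> are literally of this form.\<close>

definition lincomb :: "nat set \<Rightarrow> (nat \<Rightarrow> real) \<Rightarrow> (nat \<Rightarrow> 'v) \<Rightarrow> nat \<Rightarrow> 'v" where
  "lincomb A c u = vpsum V (\<lambda>i. if i \<in> A then vscale V (c i) (u i) else vzero V)"

lemma lincomb_mem: "(\<And>i. i \<in> A \<Longrightarrow> u i \<in> vcarrier V) \<Longrightarrow> lincomb A c u n \<in> vcarrier V"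
  unfolding lincomb_def by (intro vpsum_mem) (simp add: mem)

lemma inner_lincomb_left:
  assumes "\<And>i. i \<in> A \<Longrightarrow> u i \<in> vcarrier V" "y \<in> vcarrier V"
  shows "vinner V (lincomb A c u n) y = (\<Sum>i\<in>A \<inter> {..<n}. c i * vinner V (u i) y)"
proof -
  have "vinner V (lincomb A c u n) y
      = (\<Sum>i<n. vinner V (if i \<in> A then vscale V (c i) (u i) else vzero V) y)"
    unfolding lincomb_def using assms by (intro inner_vpsum) (simp_all add: mem)
  also have "\<dots> = (\<Sum>i<n. if i \<in> A then c i * vinner V (u i) y else 0)"
    using assms by (intro sum.cong) (simp_all add: inner_expand)
  also have "\<dots> = (\<Sum>i\<in>A \<inter> {..<n}. c i * vinner V (u i) y)"
    using sum.inter_restrict[of "{..<n}" "\<lambda>i. c i * vinner V (u i) y" A] by (simp add: Int_commute)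
  finally show ?thesis .
qed

lemma inner_lincomb_right:
  assumes "\<And>i. i \<in> A \<Longrightarrow> u i \<in> vcarrier V" "y \<in> vcarrier V"
  shows "vinner V y (lincomb A c u n) = (\<Sum>i\<in>A \<inter> {..<n}. c i * vinner V y (u i))"
proof -
  have "vinner V y (lincomb A c u n) = (\<Sum>i\<in>A \<inter> {..<n}. c i * vinner V (u i) y)"
    using inner_lincomb_left[OF assms] inner_sym[of y "lincomb A c u n"] lincomb_mem assms by simp
  also have "\<dots> = (\<Sum>i\<in>A \<inter> {..<n}. c i * vinner V y (u i))"
    using assms by (intro sum.cong) (simp_all add: inner_sym)
  finally show ?thesis .
qed

lemma inner_lincomb_lincomb:
  assumes u: "\<And>i. i \<in> A \<Longrightarrow> u i \<in> vcarrier V"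
    and orth: "\<And>i j. i \<in> A \<Longrightarrow> j \<in> A \<Longrightarrow> vinner V (u i) (u j) = (if i = j then d i else 0)"
  shows "vinner V (lincomb A c u n) (lincomb A c u n) = (\<Sum>i\<in>A \<inter> {..<n}. (c i)\<^sup>2 * d i)"
proof -
  have "vinner V (lincomb A c u n) (lincomb A c u n)
      = (\<Sum>i\<in>A \<inter> {..<n}. c i * (\<Sum>j\<in>A \<inter> {..<n}. c j * vinner V (u i) (u j)))"
    using u by (subst inner_lincomb_left) (simp_all add: inner_lincomb_right lincomb_mem)
  also have "\<dots> = (\<Sum>i\<in>A \<inter> {..<n}. c i * (\<Sum>j\<in>A \<inter> {..<n}. if i = j then c j * d j else 0))"
    by (intro sum.cong arg_cong2[where f="(*)"] refl) (auto simp: orth)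
  also have "\<dots> = (\<Sum>i\<in>A \<inter> {..<n}. (c i)\<^sup>2 * d i)"
    by (intro sum.cong) (simp_all add: power2_eq_square)
  finally show ?thesis .
qed

text \<open>Completing the square: the Fourier coefficients give the best approximation. Bessel's inequality
  and the convergence of expansions are read off from this identity.\<close>

lemma norm_sub_lincomb:
  fixes u :: "nat \<Rightarrow> 'v"
  assumes u: "orthonormal_system V A u" and x: "x \<in> vcarrier V"
  shows "(vnorm V (vsub V x (lincomb A c u n)))\<^sup>2
    = (vnorm V x)\<^sup>2 - (\<Sum>i\<in>A \<inter> {..<n}. (vinner V x (u i))\<^sup>2)
      + (\<Sum>i\<in>A \<inter> {..<n}. (vinner V x (u i) - c i)\<^sup>2)"
proof -
  have u1: "u i \<in> vcarrier V" if "i \<in> A" for i using u that by (simp add: orthonormal_system_def)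
  have 1: "vinner V (lincomb A c u n) (lincomb A c u n) = (\<Sum>i\<in>A \<inter> {..<n}. (c i)\<^sup>2 * 1)"
    using u by (intro inner_lincomb_lincomb) (auto simp: orthonormal_system_def)
  have sym: "vinner V (lincomb A c u n) x = vinner V x (lincomb A c u n)"
    by (intro inner_sym lincomb_mem u1 x)
  have "(vnorm V (vsub V x (lincomb A c u n)))\<^sup>2
      = (vnorm V x)\<^sup>2 - 2 * (\<Sum>i\<in>A \<inter> {..<n}. c i * vinner V x (u i)) + (\<Sum>i\<in>A \<inter> {..<n}. (c i)\<^sup>2)"
    using 1 sym inner_lincomb_right[of A u x c n] x lincomb_mem[of A u c n] u1
    by (simp add: norm_sq mem inner_sub_left inner_sub_right)
  then show ?thesis
    by (simp add: power2_diff sum.distrib sum_subtractf sum_distrib_left algebra_simps)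
qed

lemma Bessel:
  fixes u :: "nat \<Rightarrow> 'v"
  assumes u: "orthonormal_system V A u" and x: "x \<in> vcarrier V" and fin: "finite B" "B \<subseteq> A"
  shows "(\<Sum>i\<in>B. (vinner V x (u i))\<^sup>2) \<le> (vnorm V x)\<^sup>2"
proof -
  obtain n where n: "B \<subseteq> {..<n}"
    using fin(1) finite_nat_bounded by blast
  then have B: "B \<inter> {..<n} = B" by blast
  have "orthonormal_system V B u"
    using u fin(2) unfolding orthonormal_system_def by (meson subsetD)
  from norm_sub_lincomb[OF this x, of "\<lambda>i. vinner V x (u i)" n] B
  have "(vnorm V x)\<^sup>2 - (\<Sum>i\<in>B. (vinner V x (u i))\<^sup>2) \<ge> 0"
    by (metis (no_types, lifting) add.right_neutral diff_self power_zero_numeral sum.neutral zero_le_power2)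
  then show ?thesis by simp
qed

end

text \<open>Gaussian elimination on the number \<open>n\<close> of equations: an unknown \<open>p\<close> that occurs in the last
  equation is solved for and substituted into the others.\<close>

lemma homogeneous_system_nontrivial:
  fixes a :: "'i \<Rightarrow> nat \<Rightarrow> real"
  assumes "finite B" "n < card B"
  shows "\<exists>d. (\<exists>m\<in>B. d m \<noteq> 0) \<and> (\<forall>i<n. (\<Sum>m\<in>B. d m * a m i) = 0)"
  using assms
proof (induction n arbitrary: a B)
  case 0
  then obtain m where "m \<in> B" by fastforce
  then show ?case by (intro exI[of _ "\<lambda>_. 1"]) auto
next
  case (Suc n)
  show ?case
  proof (cases "\<forall>m\<in>B. a m n = 0")
    case True
    obtain d where d: "\<exists>m\<in>B. d m \<noteq> 0" "\<forall>i<n. (\<Sum>m\<in>B. d m * a m i) = 0"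
      using Suc.IH[of B a] Suc.prems by auto
    then show ?thesis using True by (intro exI[of _ d]) (auto simp: less_Suc_eq)
  next
    case False
    then obtain p where p: "p \<in> B" "a p n \<noteq> 0" by blast
    define B' where "B' = B - {p}"
    have B': "finite B'" "n < card B'" "B = insert p B'" "p \<notin> B'"
      using Suc.prems p by (auto simp: B'_def card_Diff_singleton)
    obtain d where d: "\<exists>m\<in>B'. d m \<noteq> 0"
        "\<And>i. i < n \<Longrightarrow> (\<Sum>m\<in>B'. d m * (a m i - a m n / a p n * a p i)) = 0"
      using Suc.IH[OF B'(1,2), of "\<lambda>m i. a m i - a m n / a p n * a p i"] by blast
    define s where "s = (\<Sum>m\<in>B'. d m * a m n) / a p n"
    define d' where "d' = d(p := - s)"
    have sum: "(\<Sum>m\<in>B. d' m * a m i) = (\<Sum>m\<in>B'. d m * a m i) - s * a p i" for i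
    proof -
      have "(\<Sum>m\<in>B'. d' m * a m i) = (\<Sum>m\<in>B'. d m * a m i)"
        using B' by (intro sum.cong) (auto simp: d'_def)
      then show ?thesis using B' by (simp add: d'_def)
    qed
    have "(\<Sum>m\<in>B. d' m * a m i) = 0" if "i < Suc n" for i
    proof (cases "i = n")
      case True
      then show ?thesis unfolding sum using p by (simp add: s_def)
    next
      case False
      then have "0 = (\<Sum>m\<in>B'. d m * (a m i - a m n / a p n * a p i))" using that d(2) by simp
      also have "\<dots> = (\<Sum>m\<in>B'. d m * a m i) - (\<Sum>m\<in>B'. d m * a m n / a p n * a p i)"
        by (simp add: sum_subtractf algebra_simps)
      also have "(\<Sum>m\<in>B'. d m * a m n / a p n * a p i) = s * a p i"
        by (simp add: s_def sum_divide_distrib sum_distrib_right)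
      finally show ?thesis unfolding sum by simp
    qed
    moreover have "\<exists>m\<in>B. d' m \<noteq> 0" using d(1) B' by (auto simp: d'_def)
    ultimately show ?thesis by blast
  qed
qed

context inner_space
begin

text \<open>The Gram matrix of more than \<open>dim S\<close> vectors of \<open>S\<close> is singular. For the \<open>u\<^sub>i\<close> together with \<open>w\<close>
  it is diagonal, with entries \<open>1\<close> and \<open>\<langle>w, w\<rangle>\<close>.\<close>

lemma orthonormal_maximal:
  assumes dim: "has_dimension V S (card A)" and SV: "S \<subseteq> vcarrier V"
    and A: "finite A" and u: "orthonormal_system V A u" and uS: "\<And>i. i \<in> A \<Longrightarrow> u i \<in> S"
    and w: "w \<in> S" and wu: "\<And>i. i \<in> A \<Longrightarrow> vinner V w (u i) = 0"
  shows "vinner V w w = 0"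
proof -
  define n where "n = card A"
  obtain b where b: "\<And>i. i < n \<Longrightarrow> b i \<in> S"
    and bij: "bij_betw (\<lambda>c. vpsum V (\<lambda>i. vscale V (c i) (b i)) n) {c. \<forall>i\<ge>n. c i = 0} S"
    using dim unfolding has_dimension_def n_def by blast
  \<comment> \<open>\<open>None\<close> is the additional index, that of \<open>w\<close>.\<close>
  define u' where "u' m = (case m of None \<Rightarrow> w | Some i \<Rightarrow> u i)" for m
  define B where "B = insert None (Some ` A)"
  have B: "finite B" "n < card B" using A by (auto simp: B_def n_def card_image)
  have u'S: "u' m \<in> S" if "m \<in> B" for m using that uS w by (auto simp: B_def u'_def)
  have ex: "\<forall>m\<in>B. \<exists>c. u' m = vpsum V (\<lambda>i. vscale V (c i) (b i)) n"
  proof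
    fix m assume "m \<in> B"
    then have "u' m \<in> (\<lambda>c. vpsum V (\<lambda>i. vscale V (c i) (b i)) n) ` {c. \<forall>i\<ge>n. c i = 0}"
      using u'S bij by (simp add: bij_betw_def)
    then show "\<exists>c. u' m = vpsum V (\<lambda>i. vscale V (c i) (b i)) n" by blast
  qed
  obtain a where a: "\<And>m. m \<in> B \<Longrightarrow> u' m = vpsum V (\<lambda>i. vscale V (a m i) (b i)) n"
    using bchoice[OF ex] by blast
  obtain d where d: "\<exists>m\<in>B. d m \<noteq> 0" "\<And>i. i < n \<Longrightarrow> (\<Sum>m\<in>B. d m * a m i) = 0"
    using homogeneous_system_nontrivial[OF B, of a] by blast
  have gram: "vinner V (u' m) y = (\<Sum>i<n. a m i * vinner V (b i) y)" if "m \<in> B" "y \<in> vcarrier V" for m y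
  proof -
    have bV: "b i \<in> vcarrier V" if "i < n" for i using b[OF that] SV by blast
    have "vinner V (u' m) y = (\<Sum>i<n. vinner V (vscale V (a m i) (b i)) y)"
      unfolding a[OF that(1)] using bV that(2) by (intro inner_vpsum) (simp_all add: mem)
    also have "\<dots> = (\<Sum>i<n. a m i * vinner V (b i) y)"
      using bV that(2) by (intro sum.cong) (simp_all add: inner_scale_left)
    finally show ?thesis .
  qed
  have orth: "vinner V (u' m) (u' p) = 0" if "m \<in> B" "p \<in> B" "m \<noteq> p" for m p
  proof -
    have "vinner V (u i) w = 0" if "i \<in> A" for i
      using wu[OF that] inner_sym[of "u i" w] uS[OF that] w SV by auto
    moreover have "vinner V (u i) (u j) = 0" if "i \<in> A" "j \<in> A" "i \<noteq> j" for i j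
      using u that unfolding orthonormal_system_def by presburger
    ultimately show ?thesis using that wu unfolding B_def u'_def by fastforce
  qed
  have zero: "d p * vinner V (u' p) (u' p) = 0" if p: "p \<in> B" for p
  proof -
    have pV: "u' p \<in> vcarrier V" using u'S[OF p] SV by blast
    have "d p * vinner V (u' p) (u' p) = (\<Sum>m\<in>B. if m = p then d m * vinner V (u' p) (u' p) else 0)"
      using B p by (simp add: sum.delta)
    also have "\<dots> = (\<Sum>m\<in>B. d m * vinner V (u' m) (u' p))"
    proof (intro sum.cong refl)
      fix m assume "m \<in> B"
      with orth p show "(if m = p then d m * vinner V (u' p) (u' p) else 0) = d m * vinner V (u' m) (u' p)"
        by (cases "m = p") simp_all
    qed
    also have "\<dots> = (\<Sum>m\<in>B. \<Sum>i<n. d m * a m i * vinner V (b i) (u' p))"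
      using pV by (intro sum.cong) (simp_all add: gram sum_distrib_left mult.assoc)
    also have "\<dots> = (\<Sum>i<n. (\<Sum>m\<in>B. d m * a m i) * vinner V (b i) (u' p))"
      by (subst sum.swap) (simp add: sum_distrib_right)
    also have "\<dots> = 0" using d(2) by simp
    finally show ?thesis .
  qed
  have "d (Some i) = 0" if "i \<in> A" for i
    using zero[of "Some i"] that u by (simp add: B_def u'_def orthonormal_system_def)
  then have "d None \<noteq> 0" using d(1) by (auto simp: B_def)
  then show ?thesis using zero[of None] by (simp add: B_def u'_def)
qed

end

section \<open>The Riesz representation theorem\<close>

sublocale hilbert_space \<subseteq> inner_space V
proof
  fix x y z c
  show "vzero V \<in> vcarrier V" by (rule zero_closed)
  show "x \<in> vcarrier V \<Longrightarrow> vscale V c x \<in> vcarrier V" by (rule scale_closed)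
  show zl: "vinner V (vzero V) x = 0" if "x \<in> vcarrier V" for x
    using that inner_add[of "vzero V" "vzero V" x] add_zero[OF zero_closed] zero_closed by simp
  show "x = y" if xy: "x \<in> vcarrier V" "y \<in> vcarrier V" and 0: "vnorm V (vsub V x y) = 0"
  proof -
    let ?m = "vscale V (-1) y"
    have m: "?m \<in> vcarrier V" using xy scale_closed by blast
    have "vsub V x y = vzero V"
      using 0 xy m add_closed inner_definite norm_inner unfolding vsub_def by force
    then have "vadd V (vadd V x ?m) y = vadd V (vzero V) y" by (simp add: vsub_def)
    moreover have "vadd V (vadd V x ?m) y = x"
      using add_assoc[OF xy(1) m xy(2)] add_commute[OF m xy(2)] add_inverse[OF xy(2)] add_zero[OF xy(1)]
      by simp
    moreover have "vadd V (vzero V) y = y"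
      using add_commute[OF zero_closed xy(2)] add_zero[OF xy(2)] by simp
    ultimately show ?thesis by simp
  qed
qed (fact add_closed inner_commute inner_add inner_scale inner_nonneg norm_inner)+

context hilbert_space
begin

lemma converges_if_Cauchy:
  assumes u: "\<And>n. u n \<in> vcarrier V"
    and Cauchy: "\<And>\<epsilon>. \<epsilon> > 0 \<Longrightarrow> \<exists>N. \<forall>m\<ge>N. \<forall>n\<ge>N. vnorm V (vsub V (u m) (u n)) < \<epsilon>"
  obtains x where "x \<in> vcarrier V" "converges u x"
proof -
  interpret M: Metric_space "vcarrier V" "vdist V" by (rule Metric_space)
  have "M.MCauchy u"
    unfolding M.MCauchy_def
  proof (intro conjI allI impI)
    show "range u \<subseteq> vcarrier V" using u by blast
    fix \<epsilon> :: real assume "\<epsilon> > 0"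
    from Cauchy[OF this] show "\<exists>N. \<forall>n n'. N \<le> n \<longrightarrow> N \<le> n' \<longrightarrow> vdist V (u n) (u n') < \<epsilon>"
      using u by (simp add: vdist_def)
  qed
  then obtain x where "limitin M.mtopology u x sequentially"
    using complete unfolding M.mcomplete_def by blast
  moreover from this have "x \<in> vcarrier V" by (rule M.limitin_mspace)
  ultimately show thesis using that[of x] converges_iff_limitin[of u x] u by simp
qed

text \<open>The representing vector is the minimiser of \<open>\<parallel>v\<parallel>\<^sup>2 - 2 \<phi> v\<close>: by the parallelogram law
  every minimising sequence is Cauchy.\<close>

lemma Riesz_representation:
  assumes add: "\<And>x y. x \<in> vcarrier V \<Longrightarrow> y \<in> vcarrier V \<Longrightarrow> \<phi> (vadd V x y) = \<phi> x + \<phi> y"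
    and scale: "\<And>c x. x \<in> vcarrier V \<Longrightarrow> \<phi> (vscale V c x) = c * \<phi> x"
    and bound: "\<And>x. x \<in> vcarrier V \<Longrightarrow> \<bar>\<phi> x\<bar> \<le> C * vnorm V x"
  obtains v where "v \<in> vcarrier V" "\<And>u. u \<in> vcarrier V \<Longrightarrow> \<phi> u = vinner V u v"
proof -
  define Q where "Q v = vinner V v v - 2 * \<phi> v" for v
  have lower: "- C\<^sup>2 \<le> Q v" if "v \<in> vcarrier V" for v
  proof -
    have "0 \<le> (vnorm V v - C)\<^sup>2" by simp
    then have "2 * (C * vnorm V v) \<le> vinner V v v + C\<^sup>2"
      using that by (simp add: power2_diff norm_sq algebra_simps)
    then show ?thesis using bound[OF that] by (simp add: Q_def abs_le_iff)
  qed
  define m where "m = (INF v\<in>vcarrier V. Q v)"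
  have bdd: "bdd_below (Q ` vcarrier V)" by (rule bdd_belowI2[of _ "- C\<^sup>2"]) (rule lower)
  have m_le: "m \<le> Q v" if "v \<in> vcarrier V" for v
    unfolding m_def using bdd that by (rule cINF_lower)
  have "\<exists>v. v \<in> vcarrier V \<and> Q v < m + \<epsilon>" if "\<epsilon> > 0" for \<epsilon>
    using cINF_less_iff[OF _ bdd, of "m + \<epsilon>"] that zero_closed by (auto simp: m_def)
  then have "\<forall>n. \<exists>v. v \<in> vcarrier V \<and> Q v < m + 1 / real (Suc n)" by simp
  then obtain v where v: "\<And>n. v n \<in> vcarrier V" and Qv: "\<And>n. Q (v n) < m + 1 / real (Suc n)"
    by metis
  have par: "(vnorm V (vsub V x y))\<^sup>2 \<le> 2 * (Q x - m) + 2 * (Q y - m)"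
    if x: "x \<in> vcarrier V" and y: "y \<in> vcarrier V" for x y
  proof -
    let ?h = "vscale V (1/2) (vadd V x y)"
    have "4 * Q ?h = vinner V x x + 2 * vinner V x y + vinner V y y - 4 * \<phi> x - 4 * \<phi> y"
      using x y inner_sym[OF x y] by (simp add: Q_def add scale mem inner_expand field_simps)
    moreover have "(vnorm V (vsub V x y))\<^sup>2 = vinner V x x - 2 * vinner V x y + vinner V y y"
      using x y inner_sym[OF x y] by (simp add: norm_sq mem inner_expand)
    ultimately have "(vnorm V (vsub V x y))\<^sup>2 = 2 * Q x + 2 * Q y - 4 * Q ?h"
      by (simp add: Q_def)
    then show ?thesis using m_le[of ?h] x y by (simp add: mem)
  qed
  obtain x where x: "x \<in> vcarrier V" and lim: "converges v x"
  proof (rule converges_if_Cauchy[OF v])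
    fix \<epsilon> :: real assume \<epsilon>: "\<epsilon> > 0"
    then obtain N where N: "1 / real (Suc N) < \<epsilon>\<^sup>2 / 4" using nat_approx_posE[of "\<epsilon>\<^sup>2 / 4"] by auto
    have "vnorm V (vsub V (v p) (v q)) < \<epsilon>" if "p \<ge> N" "q \<ge> N" for p q
    proof -
      have le: "1 / real (Suc p) \<le> 1 / real (Suc N)" "1 / real (Suc q) \<le> 1 / real (Suc N)"
        using that by (simp_all add: frac_le)
      have "(vnorm V (vsub V (v p) (v q)))\<^sup>2 \<le> 2 * (Q (v p) - m) + 2 * (Q (v q) - m)"
        by (rule par[OF v v])
      also have "\<dots> < 4 * (1 / real (Suc N))"
        using less_le_trans[OF Qv add_left_mono[OF le(1)]] less_le_trans[OF Qv add_left_mono[OF le(2)]]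
        by argo
      also have "\<dots> < \<epsilon>\<^sup>2" using N by argo
      finally have "(vnorm V (vsub V (v p) (v q)))\<^sup>2 < \<epsilon>\<^sup>2" .
      then show ?thesis using \<epsilon> by (intro power2_less_imp_less[of _ \<epsilon>]) simp_all
    qed
    then show "\<exists>N. \<forall>p\<ge>N. \<forall>q\<ge>N. vnorm V (vsub V (v p) (v q)) < \<epsilon>" by blast
  qed (use that in blast)
  have inv: "(\<lambda>n. 1 / real (Suc n)) \<longlonglongrightarrow> 0"
    using LIMSEQ_inverse_real_of_nat by (simp add: inverse_eq_divide)
  have Q_lim: "(\<lambda>n. Q (v n)) \<longlonglongrightarrow> m"
  proof (rule tendsto_sandwich[OF _ _ tendsto_const])
    show "(\<lambda>n. m + 1 / real (Suc n)) \<longlonglongrightarrow> m" using tendsto_add[OF tendsto_const inv, of m] by simp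
    show "\<forall>\<^sub>F n in sequentially. m \<le> Q (v n)" using m_le v by simp
    show "\<forall>\<^sub>F n in sequentially. Q (v n) \<le> m + 1 / real (Suc n)"
      using Qv by (intro always_eventually allI less_imp_le)
  qed
  have \<phi>_sub: "\<phi> (vsub V a b) = \<phi> a - \<phi> b" if "a \<in> vcarrier V" "b \<in> vcarrier V" for a b
    using that by (simp add: vsub_def add scale mem)
  have "(\<lambda>n. \<phi> (v n)) \<longlonglongrightarrow> \<phi> x"
  proof (rule LIM_zero_cancel, rule Lim_null_comparison)
    show "\<forall>\<^sub>F n in sequentially. norm (\<phi> (v n) - \<phi> x) \<le> C * vnorm V (vsub V (v n) x)"
    proof (rule always_eventually, rule allI)
      fix n show "norm (\<phi> (v n) - \<phi> x) \<le> C * vnorm V (vsub V (v n) x)"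
        using bound[of "vsub V (v n) x"] v x by (simp add: mem \<phi>_sub)
    qed
    show "(\<lambda>n. C * vnorm V (vsub V (v n) x)) \<longlonglongrightarrow> 0"
      using lim unfolding converges_def by (rule tendsto_mult_right_zero)
  qed
  moreover have "(\<lambda>n. vinner V (v n) (v n)) \<longlonglongrightarrow> vinner V x x"
    using tendsto_power[OF converges_norm[OF v x lim], of 2] v x by (simp add: norm_sq)
  ultimately have "(\<lambda>n. Q (v n)) \<longlonglongrightarrow> Q x"
    unfolding Q_def by (intro tendsto_intros)
  then have Qx: "Q x = m" using Q_lim LIMSEQ_unique by blast
  have "\<phi> u = vinner V u x" if u: "u \<in> vcarrier V" for u
  proof (rule ccontr)
    assume neq: "\<phi> u \<noteq> vinner V u x"
    define \<delta> where "\<delta> = \<phi> u - vinner V u x"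
    define s where "s = \<delta> / (1 + vinner V u u)"
    have pos: "1 + vinner V u u > 0" using inner_ge_0[OF u] by simp
    have "Q (vadd V x (vscale V s u)) = Q x + 2 * s * vinner V u x + s\<^sup>2 * vinner V u u - 2 * s * \<phi> u"
      using u x inner_sym[OF u x] by (simp add: Q_def mem add scale inner_expand power2_eq_square algebra_simps)
    then have "0 \<le> s\<^sup>2 * vinner V u u - 2 * s * \<delta>"
      using m_le[of "vadd V x (vscale V s u)"] u x Qx by (simp add: mem \<delta>_def algebra_simps)
    also have "\<dots> \<le> s\<^sup>2 * (1 + vinner V u u) - 2 * s * \<delta>"
      using mult_left_mono[of "vinner V u u" "1 + vinner V u u" "s\<^sup>2"] by simp
    also have "\<dots> = s * (s * (1 + vinner V u u)) - 2 * s * \<delta>"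
      by (simp only: power2_eq_square mult.assoc)
    also have "\<dots> = - (s * \<delta>)" using pos by (simp add: s_def)
    also have "\<dots> = - (\<delta>\<^sup>2 / (1 + vinner V u u))" by (simp add: s_def power2_eq_square)
    also have "\<dots> < 0" using pos neq by (simp add: \<delta>_def)
    finally show False by simp
  qed
  then show thesis using that x by blast
qed

end

section \<open>Square integrable functions\<close>

lemma ae_class_self: "f \<in> borel_measurable M \<Longrightarrow> f \<in> ae_class M f"
  by (simp add: ae_class_def ae_rel_def)

lemma ae_rep_ae_class:
  assumes "f \<in> borel_measurable M"
  shows "ae_rep (ae_class M f) \<in> borel_measurable M" "AE x in M. ae_rep (ae_class M f) x = f x"
proof -
  have "ae_rep (ae_class M f) \<in> ae_class M f"
    unfolding ae_rep_def by (rule someI[of "\<lambda>g. g \<in> ae_class M f"]) (rule ae_class_self[OF assms])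
  then show "ae_rep (ae_class M f) \<in> borel_measurable M" "AE x in M. ae_rep (ae_class M f) x = f x"
    by (auto simp: ae_class_def ae_rel_def)
qed

lemma ae_class_eqI:
  assumes "f \<in> borel_measurable M" "g \<in> borel_measurable M" "AE x in M. f x = g x"
  shows "ae_class M f = ae_class M g"
proof -
  have "h \<in> ae_class M f \<longleftrightarrow> h \<in> ae_class M g" for h
  proof (cases "h \<in> borel_measurable M")
    case True
    have "(AE x in M. f x = h x) \<longleftrightarrow> (AE x in M. g x = h x)"
    proof
      assume "AE x in M. f x = h x" with assms(3) show "AE x in M. g x = h x" by eventually_elim simp
    next
      assume "AE x in M. g x = h x" with assms(3) show "AE x in M. f x = h x" by eventually_elim simp
    qed
    then show ?thesis using True assms by (simp add: ae_class_def ae_rel_def)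
  qed (simp add: ae_class_def ae_rel_def)
  then show ?thesis by blast
qed

lemma square_integrable_mult:
  assumes "f \<in> square_integrable M" "g \<in> square_integrable M"
  shows "integrable M (\<lambda>x. f x * g x)"
proof (rule Bochner_Integration.integrable_bound)
  show "integrable M (\<lambda>x. (f x)\<^sup>2 + (g x)\<^sup>2)"
    using assms by (auto simp: square_integrable_def)
  have *: "\<bar>a * b\<bar> \<le> a\<^sup>2 + b\<^sup>2" for a b :: real
  proof -
    have "0 \<le> \<bar>a * b\<bar>" by simp
    moreover have "2 * \<bar>a * b\<bar> \<le> a\<^sup>2 + b\<^sup>2"
      using sum_squares_bound[of "\<bar>a\<bar>" "\<bar>b\<bar>"] by (simp add: abs_mult mult.assoc)
    ultimately show ?thesis by linarith
  qed
  show "AE x in M. norm (f x * g x) \<le> norm ((f x)\<^sup>2 + (g x)\<^sup>2)"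
    using * by simp
qed (use assms in \<open>auto simp: square_integrable_def\<close>)

lemma square_integrable_add:
  assumes "f \<in> square_integrable M" "g \<in> square_integrable M"
  shows "(\<lambda>x. f x + g x) \<in> square_integrable M"
proof -
  have "integrable M (\<lambda>x. (f x)\<^sup>2 + (g x)\<^sup>2 + 2 * (f x * g x))"
    using assms square_integrable_mult[OF assms] by (auto simp: square_integrable_def)
  then show ?thesis
    using assms by (auto simp: square_integrable_def power2_sum mult.assoc)
qed

lemma square_integrable_scale: "f \<in> square_integrable M \<Longrightarrow> (\<lambda>x. c * f x) \<in> square_integrable M"
  by (auto simp: square_integrable_def power_mult_distrib)

lemma square_integrable_measurable: "f \<in> square_integrable M \<Longrightarrow> f \<in> borel_measurable M"
  by (simp add: square_integrable_def)

lemma ae_class_in_L2: "f \<in> square_integrable M \<Longrightarrow> ae_class M f \<in> vcarrier (L2 M)"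
  by (auto simp: L2_def quotient_def ae_class_def)

lemma L2_ae_rep:
  assumes "F \<in> vcarrier (L2 M)"
  shows "ae_rep F \<in> square_integrable M" "ae_class M (ae_rep F) = F"
proof -
  obtain f where f: "f \<in> square_integrable M" "F = ae_class M f"
    using assms by (auto simp: L2_def quotient_def ae_class_def)
  note m = square_integrable_measurable[OF f(1)]
  note rep = ae_rep_ae_class[OF m, folded f(2)]
  have "integrable M (\<lambda>x. (ae_rep F x)\<^sup>2) \<longleftrightarrow> integrable M (\<lambda>x. (f x)\<^sup>2)"
    using rep m by (intro integrable_cong_AE) auto
  then show "ae_rep F \<in> square_integrable M" using f(1) rep(1) by (simp add: square_integrable_def)
  show "ae_class M (ae_rep F) = F"
    unfolding f(2) using rep m by (intro ae_class_eqI) (simp_all add: f(2))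
qed

lemma L2_inner_ae_class:
  assumes "f \<in> borel_measurable M" "G \<in> vcarrier (L2 M)"
  shows "vinner (L2 M) (ae_class M f) G = (\<integral>x. f x * ae_rep G x \<partial>M)"
proof -
  have "(\<integral>x. ae_rep (ae_class M f) x * ae_rep G x \<partial>M) = (\<integral>x. f x * ae_rep G x \<partial>M)"
    using ae_rep_ae_class[OF assms(1)] assms(1) L2_ae_rep(1)[OF assms(2), THEN square_integrable_measurable]
    by (intro integral_cong_AE) auto
  then show ?thesis by (simp add: L2_def)
qed

lemma inner_space_L2: "inner_space (L2 M)"
proof
  fix F G K c
  show "vzero (L2 M) \<in> vcarrier (L2 M)"
    using ae_class_in_L2[of "\<lambda>x. 0" M] by (simp add: L2_def square_integrable_def)
  show "vadd (L2 M) F G \<in> vcarrier (L2 M)" if "F \<in> vcarrier (L2 M)" "G \<in> vcarrier (L2 M)"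
    using ae_class_in_L2[OF square_integrable_add[OF that[THEN L2_ae_rep(1)]]] by (simp add: L2_def)
  show "vscale (L2 M) c F \<in> vcarrier (L2 M)" if "F \<in> vcarrier (L2 M)"
    using ae_class_in_L2[OF square_integrable_scale[OF that[THEN L2_ae_rep(1)]]] by (simp add: L2_def)
  show "vinner (L2 M) (vzero (L2 M)) F = 0" if "F \<in> vcarrier (L2 M)"
    using L2_inner_ae_class[of "\<lambda>x. 0" M F] that by (simp add: L2_def)
  show "vinner (L2 M) F G = vinner (L2 M) G F"
    by (simp add: L2_def mult.commute)
  show "vinner (L2 M) (vadd (L2 M) F G) K = vinner (L2 M) F K + vinner (L2 M) G K"
    if FGK: "F \<in> vcarrier (L2 M)" "G \<in> vcarrier (L2 M)" "K \<in> vcarrier (L2 M)"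
  proof -
    note s = FGK[THEN L2_ae_rep(1)]
    have "vinner (L2 M) (vadd (L2 M) F G) K = (\<integral>x. (ae_rep F x + ae_rep G x) * ae_rep K x \<partial>M)"
      using L2_inner_ae_class[OF square_integrable_measurable[OF square_integrable_add[OF s(1,2)]] FGK(3)]
      by (simp add: L2_def)
    also have "\<dots> = (\<integral>x. ae_rep F x * ae_rep K x \<partial>M) + (\<integral>x. ae_rep G x * ae_rep K x \<partial>M)"
      using square_integrable_mult[OF s(1,3)] square_integrable_mult[OF s(2,3)]
      by (simp add: distrib_right)
    finally show ?thesis by (simp add: L2_def)
  qed
  show "vinner (L2 M) (vscale (L2 M) c F) G = c * vinner (L2 M) F G"
    if FG: "F \<in> vcarrier (L2 M)" "G \<in> vcarrier (L2 M)"
  proof -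
    have "vinner (L2 M) (vscale (L2 M) c F) G = (\<integral>x. c * ae_rep F x * ae_rep G x \<partial>M)"
      using L2_inner_ae_class[OF square_integrable_measurable[OF square_integrable_scale[OF L2_ae_rep(1)[OF FG(1)]]] FG(2)]
      by (simp add: L2_def)
    then show ?thesis by (simp add: L2_def mult.assoc)
  qed
  show "0 \<le> vinner (L2 M) F F"
    by (simp add: L2_def)
  show "vnorm (L2 M) F = sqrt (vinner (L2 M) F F)"
    by (simp add: L2_def power2_eq_square)
  show "F = G" if FG: "F \<in> vcarrier (L2 M)" "G \<in> vcarrier (L2 M)"
    and 0: "vnorm (L2 M) (vsub (L2 M) F G) = 0"
  proof -
    note s = FG[THEN L2_ae_rep(1)]
    define h where "h = (\<lambda>x. ae_rep F x + ae_rep (ae_class M (\<lambda>x. - ae_rep G x)) x)"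
    have mG: "(\<lambda>x. - ae_rep G x) \<in> square_integrable M"
      using square_integrable_scale[OF s(2), of "-1"] by simp
    note rG = ae_rep_ae_class[OF square_integrable_measurable[OF mG]]
    have h: "h \<in> square_integrable M"
      unfolding h_def using square_integrable_add[OF s(1) L2_ae_rep(1)[OF ae_class_in_L2[OF mG]]] .
    note hm = square_integrable_measurable[OF h]
    have "(\<integral>x. (ae_rep (ae_class M h) x)\<^sup>2 \<partial>M) = 0"
      using 0 by (simp add: L2_def vsub_def h_def)
    moreover have "(\<integral>x. (ae_rep (ae_class M h) x)\<^sup>2 \<partial>M) = (\<integral>x. (h x)\<^sup>2 \<partial>M)"
      using ae_rep_ae_class[OF hm] hm by (intro integral_cong_AE) auto
    ultimately have "(\<integral>x. (h x)\<^sup>2 \<partial>M) = 0" by simp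
    then have "AE x in M. (h x)\<^sup>2 = 0"
      using h by (subst (asm) integral_nonneg_eq_0_iff_AE) (auto simp: square_integrable_def)
    then have "AE x in M. ae_rep F x = ae_rep G x"
      using rG(2) by eventually_elim (simp add: h_def)
    then have "ae_class M (ae_rep F) = ae_class M (ae_rep G)"
      using s by (intro ae_class_eqI square_integrable_measurable)
    then show ?thesis using FG by (simp add: L2_ae_rep(2))
  qed
qed

section \<open>Compact operators and their singular systems\<close>

text \<open>The reproducing kernel enters only through the operator \<open>I\<^sub>k\<close>. In its place stands a compact map
  \<open>J\<close> from a Hilbert space into an inner product space.\<close>

locale compact_linear_map = H: hilbert_space H + L: inner_space L
  for H :: "'h hspace" and L :: "'l hspace" +
  fixes J :: "'h \<Rightarrow> 'l"
  assumes compact: "compact_operator H L J"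
begin

lemma J_mem: "f \<in> vcarrier H \<Longrightarrow> J f \<in> vcarrier L"
  and J_add: "f \<in> vcarrier H \<Longrightarrow> g \<in> vcarrier H \<Longrightarrow> J (vadd H f g) = vadd L (J f) (J g)"
  and J_scale: "f \<in> vcarrier H \<Longrightarrow> J (vscale H c f) = vscale L c (J f)"
  using compact by (auto simp: compact_operator_def linear_operator_def)

lemma J_sub: "f \<in> vcarrier H \<Longrightarrow> g \<in> vcarrier H \<Longrightarrow> J (vsub H f g) = vsub L (J f) (J g)"
  by (simp add: vsub_def J_add J_scale H.mem)

lemma compact_closure:
  obtains K where "compactin (Metric_space.mtopology (vcarrier L) (vdist L)) K"
    "\<And>f. f \<in> vcarrier H \<Longrightarrow> vnorm H f \<le> 1 \<Longrightarrow> J f \<in> K"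
proof -
  interpret M: Metric_space "vcarrier L" "vdist L" by (rule L.Metric_space)
  let ?B = "J ` {f \<in> vcarrier H. vnorm H f \<le> 1}"
  have "?B \<subseteq> M.mtopology closure_of ?B"
    by (intro closure_of_subset) (auto simp: J_mem)
  then show thesis
    using compact that[of "M.mtopology closure_of ?B"] unfolding compact_operator_def Let_def by blast
qed

lemma subsequence_converges:
  assumes f: "\<And>n. f n \<in> vcarrier H" "\<And>n. vnorm H (f n) \<le> 1"
  obtains w \<sigma> where "w \<in> vcarrier L" "strict_mono (\<sigma> :: nat \<Rightarrow> nat)" "L.converges (\<lambda>n. J (f (\<sigma> n))) w"
proof -
  interpret M: Metric_space "vcarrier L" "vdist L" by (rule L.Metric_space)
  obtain K where K: "compactin M.mtopology K" "\<And>f. f \<in> vcarrier H \<Longrightarrow> vnorm H f \<le> 1 \<Longrightarrow> J f \<in> K"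
    using compact_closure by blast
  have "range (\<lambda>n. J (f n)) \<subseteq> K" using f K(2) by blast
  then obtain w \<sigma> where "strict_mono (\<sigma> :: nat \<Rightarrow> nat)"
      "limitin M.mtopology ((\<lambda>n. J (f n)) \<circ> \<sigma>) w sequentially"
    using K(1) unfolding M.compactin_sequentially by blast
  then show thesis
    using that L.converges_iff_limitin[of "(\<lambda>n. J (f n)) \<circ> \<sigma>" w] J_mem f(1) M.limitin_mspace
    by (simp add: o_def) blast
qed

lemma bounded:
  obtains C where "C \<ge> 0" "\<And>f. f \<in> vcarrier H \<Longrightarrow> vnorm L (J f) \<le> C * vnorm H f"
proof -
  interpret M: Metric_space "vcarrier L" "vdist L" by (rule L.Metric_space)
  obtain K where K: "compactin M.mtopology K" "\<And>f. f \<in> vcarrier H \<Longrightarrow> vnorm H f \<le> 1 \<Longrightarrow> J f \<in> K"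
    using compact_closure by blast
  obtain c B where B: "K \<subseteq> M.mcball c B"
    using M.compactin_imp_mbounded[OF K(1)] unfolding M.mbounded_def by blast
  obtain D where D: "\<And>f. f \<in> vcarrier H \<Longrightarrow> vnorm H f \<le> 1 \<Longrightarrow> vnorm L (J f) \<le> D"
  proof
    fix f assume f: "f \<in> vcarrier H" "vnorm H f \<le> 1"
    then have "J f \<in> M.mcball c B" using K(2) B by blast
    then have c: "c \<in> vcarrier L" and d: "vnorm L (vsub L c (J f)) \<le> B"
      using J_mem[OF f(1)] by (auto simp: vdist_def M.in_mcball)
    show "vnorm L (J f) \<le> vnorm L c + B"
      using L.norm_diff_le[OF c J_mem[OF f(1)]] d by simp
  qed
  show thesis
  proof
    show "max D 0 \<ge> 0" by simp
    fix f assume f: "f \<in> vcarrier H"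
    show "vnorm L (J f) \<le> max D 0 * vnorm H f"
    proof (cases "vnorm H f = 0")
      case True
      \<comment> \<open>All multiples of a null vector lie in the unit ball.\<close>
      have "vnorm L (J f) \<le> 0"
      proof (rule ccontr)
        assume "\<not> vnorm L (J f) \<le> 0"
        then have pos: "vnorm L (J f) > 0" by simp
        define c where "c = (\<bar>D\<bar> + 1) / vnorm L (J f)"
        have "vnorm L (J (vscale H c f)) \<le> D"
          using True f by (intro D) (simp_all add: H.mem H.norm_scale)
        moreover have "vnorm L (J (vscale H c f)) = \<bar>D\<bar> + 1"
          using f pos by (simp add: J_scale L.norm_scale J_mem c_def)
        ultimately show False by simp
      qed
      then show ?thesis using True by simp
    next
      case False
      then have pos: "vnorm H f > 0" using H.norm_ge_0[OF f] by simp
      have "vnorm L (J (vscale H (1 / vnorm H f) f)) \<le> D"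
        using pos f by (intro D) (simp_all add: H.mem H.norm_scale)
      then have "vnorm L (J f) \<le> D * vnorm H f"
        using f pos by (simp add: J_scale L.norm_scale J_mem field_simps)
      also have "\<dots> \<le> max D 0 * vnorm H f" using pos by (intro mult_right_mono) auto
      finally show ?thesis .
    qed
  qed
qed

abbreviation adj :: "'l \<Rightarrow> 'h" where "adj \<equiv> adjoint_operator H L J"

text \<open>The description that defines the adjoint has a unique solution by the Riesz theorem, as a compact
  map is bounded.\<close>

lemma adjoint:
  assumes w: "w \<in> vcarrier L"
  shows adj_mem: "adj w \<in> vcarrier H"
    and inner_adj: "\<And>f. f \<in> vcarrier H \<Longrightarrow> vinner H f (adj w) = vinner L (J f) w"
proof -
  obtain C where C: "\<And>f. f \<in> vcarrier H \<Longrightarrow> vnorm L (J f) \<le> C * vnorm H f" using bounded by blast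
  obtain v where v: "v \<in> vcarrier H" "\<And>u. u \<in> vcarrier H \<Longrightarrow> vinner L (J u) w = vinner H u v"
  proof (rule H.Riesz_representation[of "\<lambda>u. vinner L (J u) w" "C * vnorm L w"])
    fix u assume u: "u \<in> vcarrier H"
    have "\<bar>vinner L (J u) w\<bar> \<le> vnorm L (J u) * vnorm L w" using u w by (simp add: L.Cauchy_Schwarz J_mem)
    also have "\<dots> \<le> C * vnorm H u * vnorm L w" using C[OF u] w by (simp add: mult_right_mono L.norm_ge_0)
    finally show "\<bar>vinner L (J u) w\<bar> \<le> C * vnorm L w * vnorm H u" by (simp add: mult_ac)
  qed (use w in \<open>simp_all add: J_add J_scale J_mem L.inner_expand\<close>)
  have "adj w = v"
    unfolding adjoint_operator_def
  proof (rule the_equality)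
    fix v' assume v': "v' \<in> vcarrier H \<and> (\<forall>u\<in>vcarrier H. vinner L (J u) w = vinner H u v')"
    have "vinner H (vsub H v' v) (vsub H v' v) = 0"
      using v v' by (simp add: H.inner_sub_right H.mem)
    then show "v' = v" using v v' by (intro H.eq_if_dist_0) (simp_all add: H.norm_sqrt H.mem)
  qed (use v in auto)
  then show "adj w \<in> vcarrier H" "\<And>f. f \<in> vcarrier H \<Longrightarrow> vinner H f (adj w) = vinner L (J f) w"
    using v by simp_all
qed

end

text \<open>The singular values of \<open>J\<close> are the \<open>\<surd>\<mu>\<^sub>i\<close>, with right and left singular vectors \<open>\<surd>\<mu>\<^sub>i e\<^sub>i\<close> and
  \<open>J e\<^sub>i\<close>.\<close>

locale singular_system = compact_linear_map H L J
  for H :: "'h hspace" and L :: "'l hspace" and J :: "'h \<Rightarrow> 'l" +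
  fixes I :: "nat set" and \<mu> :: "nat \<Rightarrow> real" and e :: "nat \<Rightarrow> 'h"
  assumes enum: "eigenvalue_enumeration L (\<lambda>w. J (adj w)) I \<mu>"
    and e_mem: "i \<in> I \<Longrightarrow> e i \<in> vcarrier H"
    and orth_L: "orthonormal_system L I (\<lambda>i. J (e i))"
    and eigen: "i \<in> I \<Longrightarrow> J (adj (J (e i))) = vscale L (\<mu> i) (J (e i))"
    and orth_H: "orthonormal_system H I (\<lambda>i. vscale H (sqrt (\<mu> i)) (e i))"
begin

lemma Je_mem: "i \<in> I \<Longrightarrow> J (e i) \<in> vcarrier L"
  by (simp add: e_mem J_mem)

lemma inner_Je: "i \<in> I \<Longrightarrow> j \<in> I \<Longrightarrow> vinner L (J (e i)) (J (e j)) = (if i = j then 1 else 0)"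
  using orth_L by (simp add: orthonormal_system_def)

lemma \<mu>_pos:
  assumes i: "i \<in> I"
  shows "\<mu> i > 0"
proof -
  let ?g = "adj (J (e i))"
  have g: "?g \<in> vcarrier H" by (rule adj_mem[OF Je_mem[OF i]])
  have "0 \<le> vinner H ?g ?g" using g by (rule H.inner_ge_0)
  also have "\<dots> = vinner L (J ?g) (J (e i))" using g Je_mem[OF i] by (intro inner_adj)
  also have "\<dots> = \<mu> i" using i by (simp add: eigen L.inner_scale_left Je_mem inner_Je)
  finally have "0 \<le> \<mu> i" .
  moreover have "\<mu> i \<noteq> 0" using enum i by (simp add: eigenvalue_enumeration_def)
  ultimately show ?thesis by simp
qed

lemma inner_ee:
  assumes "i \<in> I" "j \<in> I"
  shows "vinner H (e i) (e j) = (if i = j then 1 / \<mu> i else 0)"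
proof -
  have "sqrt (\<mu> i) * sqrt (\<mu> j) * vinner H (e i) (e j) = (if i = j then 1 else 0)"
    using orth_H[unfolded orthonormal_system_def, THEN conjunct2, rule_format, OF assms] assms
    by (simp add: H.inner_expand H.mem e_mem mult_ac)
  then show ?thesis using \<mu>_pos[OF assms(1)] \<mu>_pos[OF assms(2)]
    by (cases "i = j") (auto simp: field_simps)
qed

text \<open>The eigenvector equation only gives \<open>J (J\<^sup>* J e\<^sub>i) = \<mu>\<^sub>i J e\<^sub>i\<close>, i.e. \<open>J\<^sup>* J e\<^sub>i = \<mu>\<^sub>i e\<^sub>i\<close> up to the
  kernel of \<open>J\<close>. The two sides agree since their distance, computed from the known norms, is \<open>0\<close>.\<close>

lemma inner_e:
  assumes f: "f \<in> vcarrier H" and i: "i \<in> I"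
  shows "vinner H f (e i) = vinner L (J f) (J (e i)) / \<mu> i"
proof -
  let ?g = "adj (J (e i))"
  have g: "?g \<in> vcarrier H" and e: "e i \<in> vcarrier H" using adj_mem[OF Je_mem[OF i]] e_mem[OF i] by auto
  have gg: "vinner H ?g ?g = \<mu> i"
    using i g by (subst inner_adj) (simp_all add: Je_mem eigen L.inner_scale_left inner_Je)
  have eg: "vinner H (e i) ?g = 1"
    using i e by (simp add: inner_adj Je_mem inner_Je)
  have ge: "vinner H ?g (e i) = 1" using eg H.inner_sym[OF e g] by simp
  have ee: "vinner H (e i) (e i) = 1 / \<mu> i" using inner_ee[OF i i] by simp
  let ?d = "vsub H ?g (vscale H (\<mu> i) (e i))"
  have "vinner H ?d ?d = 0"
    using g e gg eg ge ee \<mu>_pos[OF i] by (simp add: H.mem H.inner_expand)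
  then have "?g = vscale H (\<mu> i) (e i)"
    using g e by (intro H.eq_if_dist_0) (simp_all add: H.norm_sqrt H.mem)
  then have "\<mu> i * vinner H f (e i) = vinner H f ?g"
    using f e by (simp add: H.inner_expand)
  also have "\<dots> = vinner L (J f) (J (e i))" using f i by (simp add: inner_adj Je_mem)
  finally show ?thesis using \<mu>_pos[OF i] by (simp add: field_simps)
qed

text \<open>Otherwise infinitely many \<open>e\<^sub>i\<close> would have norm at most \<open>1 / \<surd>\<epsilon>\<close>, whereas their
  orthonormal images have no convergent subsequence.\<close>

lemma finite_large_eigenvalues:
  assumes \<epsilon>: "\<epsilon> > 0"
  shows "finite {i \<in> I. \<mu> i > \<epsilon>}"
proof (rule ccontr)
  assume inf: "infinite {i \<in> I. \<mu> i > \<epsilon>}"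
  define p where "p = enumerate {i \<in> I. \<mu> i > \<epsilon>}"
  have p: "p n \<in> I" "\<mu> (p n) > \<epsilon>" for n
    using enumerate_in_set[OF inf, of n] by (auto simp: p_def)
  have p_inj: "p m = p n \<longleftrightarrow> m = n" for m n
    using strict_mono_enumerate[OF inf] by (simp add: p_def strict_mono_eq)
  define f where "f n = vscale H (sqrt \<epsilon>) (e (p n))" for n
  have f: "f n \<in> vcarrier H" for n by (simp add: f_def p e_mem H.mem)
  have f1: "vnorm H (f n) \<le> 1" for n
  proof -
    have "vinner H (f n) (f n) = \<epsilon> / \<mu> (p n)"
      using \<epsilon> p by (simp add: f_def H.inner_expand H.mem e_mem inner_ee flip: mult.assoc)
    also have "\<dots> \<le> 1" using p[of n] \<epsilon> by simp
    finally show ?thesis using f by (simp add: H.norm_sqrt)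
  qed
  obtain w \<sigma> where w: "w \<in> vcarrier L" and \<sigma>: "strict_mono (\<sigma> :: nat \<Rightarrow> nat)"
      and lim: "L.converges (\<lambda>n. J (f (\<sigma> n))) w"
    by (rule subsequence_converges[of f, OF f f1]) (rule that)
  obtain N where N: "\<And>n. n \<ge> N \<Longrightarrow> vnorm L (vsub L (J (f (\<sigma> n))) w) < sqrt \<epsilon> / 2"
    using order_tendstoD(2)[OF lim[unfolded L.converges_def], of "sqrt \<epsilon> / 2"] \<epsilon>
    unfolding eventually_sequentially by auto
  let ?a = "J (f (\<sigma> N))" and ?b = "J (f (\<sigma> (Suc N)))"
  have ab: "?a \<in> vcarrier L" "?b \<in> vcarrier L" using f J_mem by auto
  have neq: "\<sigma> N \<noteq> \<sigma> (Suc N)" using \<sigma> by (metis n_not_Suc_n strict_mono_eq)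
  have Jf: "vinner L (J (f m)) (J (f n)) = (if m = n then \<epsilon> else 0)" for m n
    using \<epsilon> p by (simp add: f_def J_scale e_mem L.inner_expand L.mem Je_mem inner_Je p_inj flip: mult.assoc)
  have "(vnorm L (vsub L ?a ?b))\<^sup>2 = 2 * \<epsilon>"
    using ab neq by (simp add: L.norm_sq L.mem L.inner_expand Jf)
  moreover have "vnorm L (vsub L ?a ?b) < sqrt \<epsilon>"
    using L.norm_triangle[OF ab(1) w ab(2)] N[of N] N[of "Suc N"] L.norm_sub_commute[OF ab(2) w] by simp
  then have "(vnorm L (vsub L ?a ?b))\<^sup>2 < (sqrt \<epsilon>)\<^sup>2"
    using ab by (intro power_strict_mono) (simp_all add: L.norm_ge_0 L.mem)
  ultimately show False using \<epsilon> by simp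
qed

text \<open>This is the spectral theorem in the form in which it is needed: the enumerated eigenvalues
  exhaust the operator. On the orthogonal complement of the \<open>e\<^sub>i\<close> with \<open>\<mu>\<^sub>i > \<epsilon>\<close> let \<open>s\<close> be the norm of
  \<open>J\<close>. If \<open>s\<^sup>2 > \<epsilon>\<close>, then the images of a maximising sequence subconverge to an eigenvector \<open>w\<close> of
  \<open>J J\<^sup>*\<close> for \<open>s\<^sup>2\<close>, and \<open>w\<close> is orthogonal to all listed eigenvectors of that eigenvalue,
  although they already fill its eigenspace.\<close>

lemma norm_J_orthogonal:
  assumes f: "f \<in> vcarrier H" and \<epsilon>: "\<epsilon> \<ge> 0"
    and orth: "\<And>i. i \<in> I \<Longrightarrow> \<mu> i > \<epsilon> \<Longrightarrow> vinner H f (e i) = 0"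
  shows "(vnorm L (J f))\<^sup>2 \<le> \<epsilon> * (vnorm H f)\<^sup>2"
proof (rule ccontr)
  assume contra: "\<not> (vnorm L (J f))\<^sup>2 \<le> \<epsilon> * (vnorm H f)\<^sup>2"
  define H0 where "H0 = {g \<in> vcarrier H. \<forall>i\<in>I. \<mu> i > \<epsilon> \<longrightarrow> vinner H g (e i) = 0}"
  have H0: "g \<in> vcarrier H" if "g \<in> H0" for g using that by (simp add: H0_def)
  have H0_scale: "vscale H c g \<in> H0" if "g \<in> H0" for c g
    using that e_mem by (simp add: H0_def H.mem H.inner_expand)
  have H0_sub: "vsub H g h \<in> H0" if "g \<in> H0" "h \<in> H0" for g h
    using that e_mem by (simp add: H0_def H.mem H.inner_expand)
  have fH0: "f \<in> H0" using f orth by (simp add: H0_def)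
  obtain C where C: "C \<ge> 0" "\<And>g. g \<in> vcarrier H \<Longrightarrow> vnorm L (J g) \<le> C * vnorm H g"
    using bounded by blast
  define U where "U = {g \<in> H0. vnorm H g \<le> 1}"
  define s where "s = (SUP g\<in>U. vnorm L (J g))"
  have bdd: "bdd_above ((\<lambda>g. vnorm L (J g)) ` U)"
  proof (rule bdd_aboveI2)
    fix g assume "g \<in> U"
    then show "vnorm L (J g) \<le> C * 1"
      using C(2)[of g] C(1) mult_left_mono[of "vnorm H g" 1 C] H0[of g] by (auto simp: U_def)
  qed
  have s_upper: "vnorm L (J g) \<le> s" if "g \<in> U" for g
    unfolding s_def using bdd that by (intro cSUP_upper)
  have fpos: "vnorm H f > 0"
  proof (rule ccontr)
    assume "\<not> vnorm H f > 0"
    then have "vnorm H f = 0" using H.norm_ge_0[OF f] by simp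
    then show False using contra C(2)[OF f] L.norm_ge_0[OF J_mem[OF f]] by simp
  qed
  have s2: "s\<^sup>2 > \<epsilon>" and spos: "s > 0"
  proof -
    let ?g = "vscale H (1 / vnorm H f) f"
    have "?g \<in> U" using fH0 H0_scale fpos f by (simp add: U_def H.norm_scale)
    then have le: "vnorm L (J f) / vnorm H f \<le> s"
      using s_upper[of ?g] f fpos by (simp add: J_scale L.norm_scale J_mem)
    have nn: "0 \<le> vnorm L (J f) / vnorm H f" using fpos L.norm_ge_0[OF J_mem[OF f]] by simp
    have "\<epsilon> < (vnorm L (J f) / vnorm H f)\<^sup>2"
      using contra fpos by (simp add: power_divide field_simps)
    also have "\<dots> \<le> s\<^sup>2" using le nn by (intro power_mono)
    finally show "s\<^sup>2 > \<epsilon>" .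
    then have "s\<^sup>2 > 0" using \<epsilon> by linarith
    then show "s > 0" using le nn by (cases "s = 0") auto
  qed
  have J_le: "vnorm L (J g) \<le> s * vnorm H g" if g: "g \<in> H0" for g
  proof (cases "vnorm H g = 0")
    case True
    then show ?thesis using C(2)[OF H0[OF g]] by simp
  next
    case False
    then have pos: "vnorm H g > 0" using H.norm_ge_0[OF H0[OF g]] by simp
    then have "vscale H (1 / vnorm H g) g \<in> U" using g H0_scale H0 by (simp add: U_def H.norm_scale)
    from s_upper[OF this] show ?thesis
      using pos H0[OF g] by (simp add: J_scale L.norm_scale J_mem field_simps)
  qed
  have "\<exists>g. g \<in> U \<and> s - 1 / real (Suc n) < vnorm L (J g)" for n
  proof -
    have "U \<noteq> {}" using fpos fH0 H0_scale f by (auto simp: U_def H.norm_scale intro!: exI[of _ "vscale H (1 / vnorm H f) f"])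
    then show ?thesis using less_cSUP_iff[OF _ bdd, of "s - 1 / real (Suc n)"] by (auto simp: s_def)
  qed
  then obtain g where gU: "\<And>n. g n \<in> U" and gs: "\<And>n. s - 1 / real (Suc n) < vnorm L (J (g n))"
    by metis
  have gH: "g n \<in> vcarrier H" and g1: "vnorm H (g n) \<le> 1" and gH0: "g n \<in> H0" for n
    using gU[of n] H0 by (auto simp: U_def)
  obtain w \<sigma> where w: "w \<in> vcarrier L" and \<sigma>: "strict_mono (\<sigma> :: nat \<Rightarrow> nat)"
      and lim: "L.converges (\<lambda>n. J (g (\<sigma> n))) w"
    by (rule subsequence_converges[of g, OF gH g1]) (rule that)
  define h where "h n = g (\<sigma> n)" for n
  have hH: "h n \<in> vcarrier H" and hH0: "h n \<in> H0" and h1: "vnorm H (h n) \<le> 1" for n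
    using gH gH0 g1 by (auto simp: h_def)
  have JhL: "J (h n) \<in> vcarrier L" for n using hH J_mem by blast
  have lim: "L.converges (\<lambda>n. J (h n)) w" using lim by (simp add: h_def)
  have inv: "(\<lambda>n. 1 / real (Suc n)) \<longlonglongrightarrow> 0"
    using LIMSEQ_inverse_real_of_nat by (simp add: inverse_eq_divide)
  have "(\<lambda>n. vnorm L (J (g n))) \<longlonglongrightarrow> s"
  proof (rule tendsto_sandwich[OF _ _ _ tendsto_const])
    show "(\<lambda>n. s - 1 / real (Suc n)) \<longlonglongrightarrow> s" using tendsto_diff[OF tendsto_const inv, of s] by simp
    show "\<forall>\<^sub>F n in sequentially. s - 1 / real (Suc n) \<le> vnorm L (J (g n))"
      using gs by (intro always_eventually allI less_imp_le)
    show "\<forall>\<^sub>F n in sequentially. vnorm L (J (g n)) \<le> s" using s_upper gU by simp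
  qed
  then have "(\<lambda>n. vnorm L (J (h n))) \<longlonglongrightarrow> s"
    unfolding h_def using LIMSEQ_subseq_LIMSEQ[OF _ \<sigma>] by (simp add: o_def)
  then have norm_w: "vnorm L w = s"
    using L.converges_norm[OF JhL w lim] LIMSEQ_unique by blast
  have inner_lim: "(\<lambda>n. vinner L (J (h n)) w) \<longlonglongrightarrow> s\<^sup>2"
    using L.converges_inner[OF JhL w w lim] norm_w w by (simp flip: L.norm_sq)
  have w_orth: "vinner L w (J (e i)) = 0" if i: "i \<in> I" "\<mu> i > \<epsilon>" for i
  proof -
    have "vinner L (J (h n)) (J (e i)) = 0" for n
      using inner_e[OF hH[of n] i(1)] hH0[of n] i \<mu>_pos[OF i(1)] by (simp add: H0_def)
    then show ?thesis
      using L.converges_inner[OF JhL w Je_mem[OF i(1)] lim] by (simp add: LIMSEQ_const_iff)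
  qed
  define a where "a = adj w"
  have aH: "a \<in> vcarrier H" using adj_mem[OF w] by (simp add: a_def)
  have inner_a: "vinner H u a = vinner L (J u) w" if "u \<in> vcarrier H" for u
    unfolding a_def using inner_adj[OF w that] .
  have aH0: "a \<in> H0"
  proof -
    have "vinner H a (e i) = 0" if i: "i \<in> I" "\<mu> i > \<epsilon>" for i
      using H.inner_sym[OF aH e_mem[OF i(1)]] inner_a[OF e_mem[OF i(1)]]
        L.inner_sym[OF w Je_mem[OF i(1)]] w_orth[OF i] by simp
    then show ?thesis using aH by (simp add: H0_def)
  qed
  have norm_a: "vnorm H a \<le> s\<^sup>2"
  proof (cases "vnorm H a = 0")
    case False
    then have pos: "vnorm H a > 0" using H.norm_ge_0[OF aH] by simp
    have "(vnorm H a)\<^sup>2 = vinner L (J a) w" using inner_a[OF aH] aH by (simp add: H.norm_sq)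
    also have "\<dots> \<le> vnorm L (J a) * s"
      using L.Cauchy_Schwarz[OF J_mem[OF aH] w] norm_w by simp
    also have "\<dots> \<le> s * vnorm H a * s" using J_le[OF aH0] spos by (intro mult_right_mono) auto
    finally show ?thesis using pos by (simp add: power2_eq_square)
  qed simp
  \<comment> \<open>\<open>s\<^sup>2 h\<^sub>n - a\<close> tends to \<open>0\<close> in norm, because \<open>\<langle>h\<^sub>n, a\<rangle>\<close> tends to the largest possible value.\<close>
  have dist: "(vnorm L (vsub L (vscale L (s\<^sup>2) (J (h n))) (J a)))\<^sup>2 \<le> s\<^sup>2 * (2 * s^4 - 2 * s\<^sup>2 * vinner L (J (h n)) w)" for n
  proof -
    let ?d = "vsub H (vscale H (s\<^sup>2) (h n)) a"
    have dH0: "?d \<in> H0" by (intro H0_sub H0_scale hH0 aH0)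
    have "vnorm L (vsub L (vscale L (s\<^sup>2) (J (h n))) (J a)) = vnorm L (J ?d)"
      using hH aH by (simp add: J_sub J_scale H.mem)
    also have "\<dots> \<le> s * vnorm H ?d" by (rule J_le[OF dH0])
    finally have "(vnorm L (vsub L (vscale L (s\<^sup>2) (J (h n))) (J a)))\<^sup>2 \<le> (s * vnorm H ?d)\<^sup>2"
      using hH aH J_mem by (intro power_mono) (simp_all add: L.norm_ge_0 L.mem)
    also have "\<dots> = s\<^sup>2 * (s^4 * (vnorm H (h n))\<^sup>2 - 2 * s\<^sup>2 * vinner L (J (h n)) w + (vnorm H a)\<^sup>2)"
    proof -
      have "(vnorm H ?d)\<^sup>2 = s^4 * (vnorm H (h n))\<^sup>2 - 2 * s\<^sup>2 * vinner H (h n) a + (vnorm H a)\<^sup>2"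
      proof -
        have "vinner H ?d ?d = s^4 * vinner H (h n) (h n) - 2 * s\<^sup>2 * vinner H (h n) a + vinner H a a"
          using hH aH H.inner_sym[OF hH aH, of n]
          by (simp add: H.mem H.inner_expand power2_eq_square power4_eq_xxxx algebra_simps)
        then show ?thesis using hH aH by (simp add: H.norm_sq H.mem)
      qed
      then show ?thesis using inner_a[OF hH] by (simp add: power_mult_distrib)
    qed
    also have "\<dots> \<le> s\<^sup>2 * (2 * s^4 - 2 * s\<^sup>2 * vinner L (J (h n)) w)"
    proof -
      have "(vnorm H (h n))\<^sup>2 \<le> 1" using h1[of n] H.norm_ge_0[OF hH] by (simp add: power_le_one)
      then have "s^4 * (vnorm H (h n))\<^sup>2 \<le> s^4 * 1" by (intro mult_left_mono) auto
      moreover have "(vnorm H a)\<^sup>2 \<le> (s\<^sup>2)\<^sup>2" using norm_a H.norm_ge_0[OF aH] by (intro power_mono)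
      ultimately show ?thesis by (intro mult_left_mono) auto
    qed
    finally show ?thesis .
  qed
  have "(\<lambda>n. (vnorm L (vsub L (vscale L (s\<^sup>2) (J (h n))) (J a)))\<^sup>2) \<longlonglongrightarrow> 0"
  proof (rule tendsto_sandwich[OF _ _ tendsto_const])
    have "(\<lambda>n. s\<^sup>2 * (2 * s^4 - 2 * s\<^sup>2 * vinner L (J (h n)) w)) \<longlonglongrightarrow> s\<^sup>2 * (2 * s^4 - 2 * s\<^sup>2 * s\<^sup>2)"
      by (intro tendsto_intros inner_lim)
    then show "(\<lambda>n. s\<^sup>2 * (2 * s^4 - 2 * s\<^sup>2 * vinner L (J (h n)) w)) \<longlonglongrightarrow> 0"
      by (simp add: power2_eq_square power4_eq_xxxx)
  qed (use dist in auto)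
  then have "(\<lambda>n. sqrt ((vnorm L (vsub L (vscale L (s\<^sup>2) (J (h n))) (J a)))\<^sup>2)) \<longlonglongrightarrow> sqrt 0"
    by (rule tendsto_real_sqrt)
  then have lim1: "(\<lambda>n. vnorm L (vsub L (vscale L (s\<^sup>2) (J (h n))) (J a))) \<longlonglongrightarrow> 0"
    using JhL aH J_mem by (simp add: L.norm_ge_0 L.mem)
  have lim2: "(\<lambda>n. vnorm L (vsub L (vscale L (s\<^sup>2) w) (vscale L (s\<^sup>2) (J (h n))))) \<longlonglongrightarrow> 0"
  proof -
    have "vnorm L (vsub L (vscale L (s\<^sup>2) w) (vscale L (s\<^sup>2) (J (h n)))) = s\<^sup>2 * vnorm L (vsub L (J (h n)) w)" for n
      using L.norm_scale_sub[OF w JhL, of "s\<^sup>2" n] L.norm_sub_commute[OF w JhL] by simp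
    then show ?thesis using lim tendsto_mult_right_zero unfolding L.converges_def by simp
  qed
  have "vnorm L (vsub L (vscale L (s\<^sup>2) w) (J a)) \<le> 0"
  proof (rule LIMSEQ_le_const)
    show "(\<lambda>n. vnorm L (vsub L (vscale L (s\<^sup>2) w) (vscale L (s\<^sup>2) (J (h n))))
        + vnorm L (vsub L (vscale L (s\<^sup>2) (J (h n))) (J a))) \<longlonglongrightarrow> 0"
      using tendsto_add[OF lim2 lim1] by simp
    show "\<exists>N. \<forall>n\<ge>N. vnorm L (vsub L (vscale L (s\<^sup>2) w) (J a))
        \<le> vnorm L (vsub L (vscale L (s\<^sup>2) w) (vscale L (s\<^sup>2) (J (h n))))
        + vnorm L (vsub L (vscale L (s\<^sup>2) (J (h n))) (J a))"
      using w JhL J_mem[OF aH] by (intro exI[of _ 0] allI impI L.norm_triangle L.mem)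
  qed
  then have Ja: "J a = vscale L (s\<^sup>2) w"
    using L.eq_if_dist_0[of "vscale L (s\<^sup>2) w" "J a"] L.norm_ge_0[of "vsub L (vscale L (s\<^sup>2) w) (J a)"]
      w J_mem[OF aH] by (simp add: L.mem)
  define A where "A = {i \<in> I. \<mu> i = s\<^sup>2}"
  have "s\<^sup>2 \<noteq> 0" using spos by simp
  then have A: "finite A" and dim: "has_dimension L (eigenspace L (\<lambda>w. J (adj w)) (s\<^sup>2)) (card A)"
    using enum unfolding eigenvalue_enumeration_def A_def by blast+
  have "vinner L w w = 0"
  proof (rule L.orthonormal_maximal[OF dim _ A])
    show "eigenspace L (\<lambda>w. J (adj w)) (s\<^sup>2) \<subseteq> vcarrier L" by (auto simp: eigenspace_def)
    show "orthonormal_system L A (\<lambda>i. J (e i))"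
      using orth_L by (simp add: orthonormal_system_def A_def)
    show "J (e i) \<in> eigenspace L (\<lambda>w. J (adj w)) (s\<^sup>2)" if "i \<in> A" for i
      using that eigen Je_mem by (auto simp: eigenspace_def A_def)
    show "w \<in> eigenspace L (\<lambda>w. J (adj w)) (s\<^sup>2)" using w Ja by (simp add: eigenspace_def a_def)
    show "vinner L w (J (e i)) = 0" if "i \<in> A" for i
      using that w_orth s2 by (simp add: A_def)
  qed
  then show False using norm_w spos w by (simp add: L.norm_sqrt)
qed

end

section \<open>Dyadic discretisation of the interpolation norm\<close>

text \<open>The K-functional at \<open>t\<close> separates the eigenvalues at \<open>t\<^sup>2\<close>. So the interval of \<open>t\<close> that belongs to
  the \<open>j\<close>-th block of eigenvalues is given by \<open>2\<^sup>j \<le> t\<^sup>2 < 2\<^bsup>j+1\<^esup>\<close>.\<close>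

definition dyadic_index :: "real \<Rightarrow> int" where
  "dyadic_index t = \<lfloor>2 * log 2 t\<rfloor>"

lemma dyadic_index_eq_iff:
  assumes "t > 0"
  shows "dyadic_index t = j \<longleftrightarrow> 2 powr (j / 2) \<le> t \<and> t < 2 powr ((j + 1) / 2)"
proof -
  have "2 powr (j / 2) \<le> t \<longleftrightarrow> real_of_int j \<le> 2 * log 2 t"
    using assms by (simp add: le_log_iff[symmetric] powr_le_iff field_simps)
  moreover have "t < 2 powr ((j + 1) / 2) \<longleftrightarrow> 2 * log 2 t < real_of_int j + 1"
    using assms by (simp add: log_less_iff[symmetric] field_simps)
  ultimately show ?thesis
    by (simp add: dyadic_index_def floor_eq_iff)
qed

lemma dyadic_index_square:
  assumes "t > 0"
  shows "2 powr dyadic_index t \<le> t\<^sup>2" "t\<^sup>2 < 2 powr (dyadic_index t + 1)"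
proof -
  have b: "2 powr (dyadic_index t / 2) \<le> t" "t < 2 powr ((dyadic_index t + 1) / 2)"
    using dyadic_index_eq_iff[OF assms, of "dyadic_index t"] by simp_all
  have sq: "(2 powr (x / 2))\<^sup>2 = 2 powr x" for x :: real
    by (simp add: power2_eq_square flip: powr_add)
  show "2 powr dyadic_index t \<le> t\<^sup>2"
    using power_mono[OF b(1), of 2] by (simp add: sq)
  show "t\<^sup>2 < 2 powr (dyadic_index t + 1)"
    using power_strict_mono[OF b(2), of 2] assms by (simp add: sq)
qed

lemma dyadic_index_powr: "dyadic_index (2 powr (real_of_int j / 2)) = j"
  by (simp add: dyadic_index_def log_powr)

lemma nn_integral_dyadic_interval:
  fixes a b :: real
  assumes "0 < a" "a \<le> b"
  shows "(\<integral>\<^sup>+t. ennreal (1 / t) * indicator {a..<b} t \<partial>lborel) = ennreal (ln b - ln a)"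
proof -
  have "(\<integral>\<^sup>+t. ennreal (1 / t) * indicator {a..<b} t \<partial>lborel)
      = (\<integral>\<^sup>+t. ennreal (1 / t) * indicator {a..b} t \<partial>lborel)"
    using AE_lborel_singleton[of b]
    by (intro nn_integral_cong_AE, eventually_elim) (auto simp: indicator_def)
  also have "\<dots> = ennreal (ln b - ln a)"
    using assms by (intro nn_integral_FTC_Icc)
      (auto intro!: derivative_eq_intros simp: inverse_eq_divide has_real_derivative_iff_has_vector_derivative[symmetric])
  finally show ?thesis .
qed

text \<open>The measure \<open>dt / t\<close> is invariant under dilations and gives every dyadic interval the mass
  \<open>ln 2 / 2\<close>.\<close>

lemma nn_integral_dyadic:
  fixes h :: "int \<Rightarrow> ennreal"
  shows "(\<integral>\<^sup>+t\<in>{0<..}. h (dyadic_index t) * ennreal (1 / t) \<partial>lborel)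
    = ennreal (ln 2 / 2) * (\<integral>\<^sup>+j. h j \<partial>count_space UNIV)"
proof -
  let ?D = "\<lambda>j. {2 powr (real_of_int j / 2)..<2 powr (real_of_int (j + 1) / 2)}"
  have D: "0 < t \<and> j = dyadic_index t \<longleftrightarrow> t \<in> ?D j" for t j
  proof (cases "t > 0")
    case True
    then show ?thesis using dyadic_index_eq_iff[OF True, of j] by auto
  next
    case False
    then have "t \<notin> ?D j" using powr_gt_zero[of 2 "real_of_int j / 2"] by (auto simp del: powr_gt_zero)
    then show ?thesis using False by simp
  qed
  have "(\<integral>\<^sup>+t\<in>{0<..}. h (dyadic_index t) * ennreal (1 / t) \<partial>lborel)
      = (\<integral>\<^sup>+t. \<integral>\<^sup>+j. h j * (ennreal (1 / t) * indicator (?D j) t) \<partial>count_space UNIV \<partial>lborel)"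
  proof (rule nn_integral_cong)
    fix t :: real
    have "(\<integral>\<^sup>+j. h j * (ennreal (1 / t) * indicator (?D j) t) \<partial>count_space UNIV)
        = (\<integral>\<^sup>+j. (h j * ennreal (1 / t) * indicator {0<..} t) * indicator {dyadic_index t} j \<partial>count_space UNIV)"
      by (intro nn_integral_cong) (use D[of t] in \<open>auto simp: indicator_def\<close>)
    also have "\<dots> = h (dyadic_index t) * ennreal (1 / t) * indicator {0<..} t"
      by (subst nn_integral_indicator_singleton) (simp_all add: one_ennreal_def[symmetric])
    finally show "h (dyadic_index t) * ennreal (1 / t) * indicator {0<..} t
      = (\<integral>\<^sup>+j. h j * (ennreal (1 / t) * indicator (?D j) t) \<partial>count_space UNIV)" by simp
  qed
  also have "\<dots> = (\<integral>\<^sup>+j. \<integral>\<^sup>+t. h j * (ennreal (1 / t) * indicator (?D j) t) \<partial>lborel \<partial>count_space UNIV)"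
    by (intro nn_integral_count_space_nn_integral) auto
  also have "\<dots> = (\<integral>\<^sup>+j. h j * ennreal (ln 2 / 2) \<partial>count_space UNIV)"
  proof (rule nn_integral_cong)
    fix j
    have "(\<integral>\<^sup>+t. h j * (ennreal (1 / t) * indicator (?D j) t) \<partial>lborel)
        = h j * (\<integral>\<^sup>+t. ennreal (1 / t) * indicator (?D j) t \<partial>lborel)"
      by (intro nn_integral_cmult) auto
    also have "(\<integral>\<^sup>+t. ennreal (1 / t) * indicator (?D j) t \<partial>lborel) = ennreal (ln 2 / 2)"
      by (subst nn_integral_dyadic_interval) (auto simp: ln_powr field_simps)
    finally show "(\<integral>\<^sup>+t. h j * (ennreal (1 / t) * indicator (?D j) t) \<partial>lborel) = h j * ennreal (ln 2 / 2)" .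
  qed
  also have "\<dots> = ennreal (ln 2 / 2) * (\<integral>\<^sup>+j. h j \<partial>count_space UNIV)"
    by (subst nn_integral_multc) (simp_all add: mult.commute)
  finally show ?thesis .
qed

lemma sum_geometric_int_le:
  fixes L :: "int set" and q :: real
  assumes q: "0 \<le> q" "q < 1" and L: "finite L"
  shows "(\<Sum>l\<in>L. q ^ nat \<bar>l - j\<bar>) \<le> 2 / (1 - q)"
proof -
  have nat_sum: "sum (\<lambda>n. q ^ n) N \<le> 1 / (1 - q)" if "finite N" for N
    using sum_le_suminf[of "\<lambda>n. q ^ n" N] q that summable_geometric[of q] suminf_geometric[of q] by simp
  have part: "(\<Sum>l\<in>K. q ^ nat \<bar>l - j\<bar>) \<le> 1 / (1 - q)"
    if K: "finite K" "inj_on (\<lambda>l. nat \<bar>l - j\<bar>) K" for K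
    using sum.reindex[OF K(2), of "\<lambda>n. q ^ n"] nat_sum[of "(\<lambda>l. nat \<bar>l - j\<bar>) ` K"] K(1) by simp
  have "(\<Sum>l\<in>L. q ^ nat \<bar>l - j\<bar>)
      = (\<Sum>l\<in>L \<inter> {j..}. q ^ nat \<bar>l - j\<bar>) + (\<Sum>l\<in>L - {j..}. q ^ nat \<bar>l - j\<bar>)"
    using L by (rule sum.Int_Diff)
  also have "\<dots> \<le> 1 / (1 - q) + 1 / (1 - q)"
    using L by (intro add_mono part) (auto simp: inj_on_def)
  finally show ?thesis by simp
qed

lemma nn_integral_geometric_int_le:
  fixes q :: real
  assumes q: "0 \<le> q" "q < 1"
  shows "(\<integral>\<^sup>+l. ennreal (q ^ nat \<bar>l - j\<bar>) \<partial>count_space UNIV) \<le> ennreal (2 / (1 - q))"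
proof -
  have "(\<integral>\<^sup>+l. ennreal (q ^ nat \<bar>l - j\<bar>) \<partial>count_space UNIV)
      = (\<integral>\<^sup>+n. ennreal (q ^ nat \<bar>int_decode n - j\<bar>) \<partial>count_space UNIV)"
    by (intro nn_integral_bij_count_space[symmetric] bij_int_decode)
  also have "\<dots> = (\<Sum>n. ennreal (q ^ nat \<bar>int_decode n - j\<bar>))"
    by (rule nn_integral_count_space_nat)
  also have "\<dots> \<le> ennreal (2 / (1 - q))"
  proof (rule suminf_le_const)
    fix n
    have "(\<Sum>i<n. ennreal (q ^ nat \<bar>int_decode i - j\<bar>)) = ennreal (\<Sum>i<n. q ^ nat \<bar>int_decode i - j\<bar>)"
      using q by (intro sum_ennreal) simp
    also have "(\<Sum>i<n. q ^ nat \<bar>int_decode i - j\<bar>) = (\<Sum>l\<in>int_decode ` {..<n}. q ^ nat \<bar>l - j\<bar>)"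
      by (subst sum.reindex) (auto intro: inj_int_decode)
    also have "\<dots> \<le> 2 / (1 - q)" using q by (intro sum_geometric_int_le) auto
    finally show "(\<Sum>i<n. ennreal (q ^ nat \<bar>int_decode i - j\<bar>)) \<le> ennreal (2 / (1 - q))"
      by (simp add: ennreal_leI)
  qed simp
  finally show ?thesis .
qed

lemma ennreal_powr_mono: "x \<le> y \<Longrightarrow> 0 \<le> a \<Longrightarrow> ennreal_powr x a \<le> ennreal_powr y a"
  unfolding ennreal_powr_def
  by (auto simp: top_unique intro!: ennreal_leI powr_mono2 enn2real_mono simp: less_top[symmetric])

lemma ennreal_powr_mult:
  assumes "C > 0"
  shows "ennreal_powr (ennreal C * y) a = ennreal (C powr a) * ennreal_powr y a"
proof (cases y)
  case (real x)
  then show ?thesis using assms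
    by (simp add: ennreal_powr_def ennreal_mult'[symmetric] powr_mult)
next
  case top
  then show ?thesis using assms by (simp add: ennreal_powr_def ennreal_mult_top)
qed

text \<open>The norm of the power space and the interpolation norm, as functions of the sequence of block
  norms and of the K-functional alone.\<close>

definition seq_norm :: "ennreal \<Rightarrow> (int \<Rightarrow> real) \<Rightarrow> ennreal" where
  "seq_norm r c =
     (if r = top then (SUP j. ennreal (c j))
      else ennreal_powr (\<integral>\<^sup>+j. ennreal (c j powr enn2real r) \<partial>count_space UNIV) (1 / enn2real r))"

definition weighted_norm :: "real \<Rightarrow> ennreal \<Rightarrow> (real \<Rightarrow> real) \<Rightarrow> ennreal" where
  "weighted_norm \<theta> r \<kappa> =
     (if r = top then (SUP t\<in>{0<..}. ennreal (t powr (-\<theta>) * \<kappa> t))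
      else ennreal_powr
        (\<integral>\<^sup>+t\<in>{0<..}. ennreal (t powr (-\<theta> * enn2real r - 1) * \<kappa> t powr enn2real r) \<partial>lborel)
        (1 / enn2real r))"

lemma power_seq_norm_eq: "power_seq_norm I \<mu> \<theta> r b = seq_norm r (block_coeff I \<mu> \<theta> b)"
  by (simp add: power_seq_norm_def seq_norm_def)

lemma interp_norm_eq: "interp_norm E1 E2 \<theta> r x = weighted_norm \<theta> r (\<lambda>t. K_functional x t E1 E2)"
  by (simp add: interp_norm_def weighted_norm_def)

lemma weighted_integrand:
  fixes t x \<theta> \<rho> :: real
  assumes "t > 0" "0 \<le> x"
  shows "t powr (-\<theta> * \<rho> - 1) * x powr \<rho> = (t powr (-\<theta>) * x) powr \<rho> * (1 / t)"
proof -
  have "t powr (-\<theta> * \<rho> - 1) = (t powr (-\<theta>)) powr \<rho> * (1 / t)"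
    using assms(1) by (simp add: powr_diff powr_powr)
  then show ?thesis using assms by (simp add: powr_mult)
qed

text \<open>The integrand is compared pointwise with a step function on the dyadic intervals, whose integral
  is the series. The constant \<open>A\<close> is moved into the step function, which is measurable, while \<open>\<kappa>\<close>
  is arbitrary.\<close>

lemma seq_norm_le_weighted_norm:
  fixes A \<theta> :: real
  assumes r: "1 \<le> r" and A: "A > 0"
  obtains C where "C > 0" "\<And>c \<kappa>. \<lbrakk>\<And>j. 0 \<le> c j; \<And>t. t > 0 \<Longrightarrow> 0 \<le> \<kappa> t;
      \<And>t. t > 0 \<Longrightarrow> c (dyadic_index t) \<le> A * (t powr (-\<theta>) * \<kappa> t)\<rbrakk>
    \<Longrightarrow> seq_norm r c \<le> ennreal C * weighted_norm \<theta> r \<kappa>"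
proof (cases "r = top")
  case True
  show thesis
  proof (rule that[OF A])
    fix c \<kappa> assume *: "\<And>j. 0 \<le> c j" "\<And>t. t > 0 \<Longrightarrow> 0 \<le> \<kappa> t"
      "\<And>t. t > 0 \<Longrightarrow> c (dyadic_index t) \<le> A * (t powr (-\<theta>) * \<kappa> t)"
    show "seq_norm r c \<le> ennreal A * weighted_norm \<theta> r \<kappa>"
      unfolding seq_norm_def weighted_norm_def using True
    proof (simp, intro SUP_least)
      fix j
      let ?t = "2 powr (real_of_int j / 2)"
      have "ennreal (c j) \<le> ennreal (A * (?t powr (-\<theta>) * \<kappa> ?t))"
        using *(3)[of ?t] by (intro ennreal_leI) (simp add: dyadic_index_powr)
      also have "\<dots> = ennreal A * ennreal (?t powr (-\<theta>) * \<kappa> ?t)"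
        using A by (simp add: ennreal_mult')
      also have "\<dots> \<le> ennreal A * (SUP t\<in>{0<..}. ennreal (t powr - \<theta> * \<kappa> t))"
        by (intro mult_left_mono SUP_upper) auto
      finally show "ennreal (c j) \<le> ennreal A * (SUP t\<in>{0<..}. ennreal (t powr - \<theta> * \<kappa> t))" .
    qed
  qed
next
  case False
  define \<rho> where "\<rho> = enn2real r"
  have \<rho>: "\<rho> \<ge> 1" using r False enn2real_mono[of 1 r] by (simp add: \<rho>_def less_top)
  define B where "B = A powr \<rho> * (2 / ln 2)"
  have B: "B > 0" using A by (simp add: B_def)
  show thesis
  proof (rule that[of "B powr (1 / \<rho>)"])
    fix c \<kappa> assume *: "\<And>j. 0 \<le> c j" "\<And>t. t > 0 \<Longrightarrow> 0 \<le> \<kappa> t"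
      "\<And>t. t > 0 \<Longrightarrow> c (dyadic_index t) \<le> A * (t powr (-\<theta>) * \<kappa> t)"
    let ?X = "\<integral>\<^sup>+j. ennreal (c j powr \<rho>) \<partial>count_space UNIV"
    let ?Y = "\<integral>\<^sup>+t\<in>{0<..}. ennreal (t powr (-\<theta> * \<rho> - 1) * \<kappa> t powr \<rho>) \<partial>lborel"
    have "?X = (\<integral>\<^sup>+j. ennreal (A powr \<rho>) * ennreal ((c j / A) powr \<rho>) \<partial>count_space UNIV)"
      using A *(1) by (intro nn_integral_cong) (simp add: powr_divide flip: ennreal_mult')
    also have "\<dots> = ennreal (A powr \<rho>) * (\<integral>\<^sup>+j. ennreal ((c j / A) powr \<rho>) \<partial>count_space UNIV)"
      by (intro nn_integral_cmult) simp
    also have "\<dots> = ennreal B * (ennreal (ln 2 / 2) * (\<integral>\<^sup>+j. ennreal ((c j / A) powr \<rho>) \<partial>count_space UNIV))"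
      by (simp add: B_def mult.assoc[symmetric] flip: ennreal_mult')
    also have "\<dots> = ennreal B * (\<integral>\<^sup>+t\<in>{0<..}. ennreal ((c (dyadic_index t) / A) powr \<rho>) * ennreal (1 / t) \<partial>lborel)"
      by (subst nn_integral_dyadic) simp
    also have "\<dots> \<le> ennreal B * ?Y"
    proof (intro mult_left_mono nn_integral_mono)
      fix t :: real
      show "ennreal ((c (dyadic_index t) / A) powr \<rho>) * ennreal (1 / t) * indicator {0<..} t
        \<le> ennreal (t powr (-\<theta> * \<rho> - 1) * \<kappa> t powr \<rho>) * indicator {0<..} t"
      proof (cases "t > 0")
        case True
        have "c (dyadic_index t) / A \<le> t powr (-\<theta>) * \<kappa> t"
          using *(3)[OF True] A by (simp add: field_simps)
        then have "(c (dyadic_index t) / A) powr \<rho> * (1 / t) \<le> (t powr (-\<theta>) * \<kappa> t) powr \<rho> * (1 / t)"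
          using *(1) A \<rho> True by (intro mult_right_mono powr_mono2) auto
        then show ?thesis using True weighted_integrand[OF True *(2)[OF True], of \<theta> \<rho>]
          by (simp add: ennreal_leI flip: ennreal_mult')
      qed simp
    qed simp
    finally have "ennreal_powr ?X (1 / \<rho>) \<le> ennreal_powr (ennreal B * ?Y) (1 / \<rho>)"
      using \<rho> by (intro ennreal_powr_mono) auto
    then show "seq_norm r c \<le> ennreal (B powr (1 / \<rho>)) * weighted_norm \<theta> r \<kappa>"
      using False by (simp add: seq_norm_def weighted_norm_def ennreal_powr_mult[OF B] \<rho>_def)
  qed (use B in simp)
qed

text \<open>A discrete Hardy inequality. The hypothesis is used with \<open>S\<^sub>j = (\<Sum>\<^sub>l 2\<^bsup>-\<alpha>r\<bar>l-j\<bar>\<^esup> c\<^sub>l\<^sup>r)\<^bsup>1/r\<^esup>\<close>, which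
  dominates each single term \<open>2\<^bsup>-\<alpha>\<bar>l-j\<bar>\<^esup> c\<^sub>l\<close>; exchanging the order of summation,
  \<open>\<Sum>\<^sub>j S\<^sub>j\<^sup>r\<close> is at most a geometric series times \<open>\<Sum>\<^sub>l c\<^sub>l\<^sup>r\<close>. For \<open>r = \<infinity>\<close>, \<open>S\<close> is the supremum of \<open>c\<close>.\<close>

lemma weighted_norm_le_seq_norm:
  fixes A \<alpha> \<theta> :: real
  assumes r: "1 \<le> r" and A: "A > 0" and \<alpha>: "\<alpha> > 0"
  obtains C where "C > 0" "\<And>c \<kappa>. \<lbrakk>\<And>j. 0 \<le> c j; \<And>t. t > 0 \<Longrightarrow> 0 \<le> \<kappa> t; seq_norm r c < top;
      \<And>t S. \<lbrakk>t > 0; S \<ge> 0; \<And>l. c l \<le> 2 powr (\<alpha> * \<bar>l - dyadic_index t\<bar>) * S\<rbrakk>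
        \<Longrightarrow> t powr (-\<theta>) * \<kappa> t \<le> A * S\<rbrakk>
    \<Longrightarrow> weighted_norm \<theta> r \<kappa> \<le> ennreal C * seq_norm r c"
proof (cases "r = top")
  case True
  show thesis
  proof (rule that[OF A])
    fix c \<kappa> assume *: "\<And>j. 0 \<le> c j" "\<And>t. t > 0 \<Longrightarrow> 0 \<le> \<kappa> t" "seq_norm r c < top"
      "\<And>t S. \<lbrakk>t > 0; S \<ge> 0; \<And>l. c l \<le> 2 powr (\<alpha> * \<bar>l - dyadic_index t\<bar>) * S\<rbrakk>
        \<Longrightarrow> t powr (-\<theta>) * \<kappa> t \<le> A * S"
    define S where "S = enn2real (seq_norm r c)"
    have S: "S \<ge> 0" "seq_norm r c = ennreal S" using *(3) by (simp_all add: S_def)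
    have cS: "c l \<le> S" for l
    proof -
      have "ennreal (c l) \<le> seq_norm r c" using True by (auto simp: seq_norm_def intro: SUP_upper)
      then show ?thesis using S by simp
    qed
    have "t powr (-\<theta>) * \<kappa> t \<le> A * S" if "t > 0" for t
    proof (rule *(4)[OF that S(1)])
      fix l
      have "1 \<le> 2 powr (\<alpha> * \<bar>l - dyadic_index t\<bar>)" using \<alpha> by (intro ge_one_powr_ge_zero) auto
      then show "c l \<le> 2 powr (\<alpha> * \<bar>l - dyadic_index t\<bar>) * S"
        using cS[of l] S(1) mult_right_mono[of 1 _ S] by fastforce
    qed
    then show "weighted_norm \<theta> r \<kappa> \<le> ennreal A * seq_norm r c"
      using True A S by (auto simp: weighted_norm_def ennreal_leI simp flip: ennreal_mult' intro!: SUP_least)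
  qed
next
  case False
  define \<rho> where "\<rho> = enn2real r"
  have \<rho>: "\<rho> \<ge> 1" using r False enn2real_mono[of 1 r] by (simp add: \<rho>_def less_top)
  define q where "q = 2 powr (- (\<alpha> * \<rho>))"
  have q: "0 < q" "q < 1" using \<alpha> \<rho> by (auto simp: q_def powr_less_one)
  define B where "B = ln 2 / 2 * A powr \<rho> * (2 / (1 - q))"
  have B: "B > 0" using A q by (simp add: B_def)
  show thesis
  proof (rule that[of "B powr (1 / \<rho>)"])
    fix c \<kappa> assume *: "\<And>j. 0 \<le> c j" "\<And>t. t > 0 \<Longrightarrow> 0 \<le> \<kappa> t" "seq_norm r c < top"
      "\<And>t S. \<lbrakk>t > 0; S \<ge> 0; \<And>l. c l \<le> 2 powr (\<alpha> * \<bar>l - dyadic_index t\<bar>) * S\<rbrakk>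
        \<Longrightarrow> t powr (-\<theta>) * \<kappa> t \<le> A * S"
    let ?X = "\<integral>\<^sup>+j. ennreal (c j powr \<rho>) \<partial>count_space UNIV"
    let ?Y = "\<integral>\<^sup>+t\<in>{0<..}. ennreal (t powr (-\<theta> * \<rho> - 1) * \<kappa> t powr \<rho>) \<partial>lborel"
    have X: "?X < top"
      using *(3) False by (auto simp: seq_norm_def ennreal_powr_def \<rho>_def less_top split: if_splits)
    define \<Sigma> where "\<Sigma> j = (\<integral>\<^sup>+l. ennreal (q ^ nat \<bar>l - j\<bar> * c l powr \<rho>) \<partial>count_space UNIV)" for j
    have "\<Sigma> j \<le> ?X" for j
      unfolding \<Sigma>_def using q
      by (intro nn_integral_mono ennreal_leI mult_left_le_one_le) (auto intro: power_le_one)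
    then have \<Sigma>_fin: "\<Sigma> j < top" for j using X by (rule le_less_trans)
    define S where "S j = enn2real (\<Sigma> j) powr (1 / \<rho>)" for j
    have c_le: "c l \<le> 2 powr (\<alpha> * \<bar>l - j\<bar>) * S j" for l j
    proof -
      have "ennreal (q ^ nat \<bar>l - j\<bar> * c l powr \<rho>) \<le> \<Sigma> j"
        unfolding \<Sigma>_def by (rule nn_integral_ge_point) simp
      then have "q ^ nat \<bar>l - j\<bar> * c l powr \<rho> \<le> enn2real (\<Sigma> j)"
        using enn2real_mono[OF _ \<Sigma>_fin] q by fastforce
      then have "(q ^ nat \<bar>l - j\<bar> * c l powr \<rho>) powr (1 / \<rho>) \<le> S j"
        unfolding S_def using q \<rho> by (intro powr_mono2) auto
      moreover have "q ^ nat \<bar>l - j\<bar> = (2 powr (- (\<alpha> * \<bar>l - j\<bar>))) powr \<rho>"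
        using q by (simp add: powr_realpow[symmetric] q_def powr_powr mult_ac)
      ultimately have "2 powr (- (\<alpha> * \<bar>l - j\<bar>)) * c l \<le> S j"
        using \<rho> *(1)[of l] by (simp add: powr_mult powr_powr)
      then have "2 powr (\<alpha> * \<bar>l - j\<bar>) * (2 powr (- (\<alpha> * \<bar>l - j\<bar>)) * c l) \<le> 2 powr (\<alpha> * \<bar>l - j\<bar>) * S j"
        by (intro mult_left_mono) auto
      then show ?thesis by (simp add: mult.assoc[symmetric] powr_add[symmetric])
    qed
    have "?Y \<le> (\<integral>\<^sup>+t\<in>{0<..}. (ennreal (A powr \<rho>) * \<Sigma> (dyadic_index t)) * ennreal (1 / t) \<partial>lborel)"
    proof (intro nn_integral_mono)
      fix t :: real
      show "ennreal (t powr (-\<theta> * \<rho> - 1) * \<kappa> t powr \<rho>) * indicator {0<..} t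
        \<le> (ennreal (A powr \<rho>) * \<Sigma> (dyadic_index t)) * ennreal (1 / t) * indicator {0<..} t"
      proof (cases "t > 0")
        case True
        let ?j = "dyadic_index t"
        have "t powr (-\<theta>) * \<kappa> t \<le> A * S ?j"
          by (rule *(4)[OF True]) (use c_le in \<open>auto simp: S_def\<close>)
        then have "(t powr (-\<theta>) * \<kappa> t) powr \<rho> \<le> (A * S ?j) powr \<rho>"
          using *(2)[OF True] \<rho> by (intro powr_mono2) auto
        also have "\<dots> = A powr \<rho> * enn2real (\<Sigma> ?j)"
          using A \<rho> by (simp add: S_def powr_mult powr_powr)
        finally have "(t powr (-\<theta>) * \<kappa> t) powr \<rho> * (1 / t) \<le> A powr \<rho> * enn2real (\<Sigma> ?j) * (1 / t)"
          using True by (intro mult_right_mono) auto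
        then have "ennreal (t powr (-\<theta> * \<rho> - 1) * \<kappa> t powr \<rho>) \<le> ennreal (A powr \<rho> * enn2real (\<Sigma> ?j) * (1 / t))"
          unfolding weighted_integrand[OF True *(2)[OF True]] by (rule ennreal_leI)
        also have "\<dots> = ennreal (A powr \<rho>) * ennreal (enn2real (\<Sigma> ?j)) * ennreal (1 / t)"
          using True by (subst ennreal_mult, simp, simp, subst ennreal_mult, simp_all)
        also have "ennreal (enn2real (\<Sigma> ?j)) = \<Sigma> ?j" using \<Sigma>_fin by simp
        finally show ?thesis using True by simp
      qed simp
    qed
    also have "\<dots> = ennreal (ln 2 / 2) * (ennreal (A powr \<rho>) * (\<integral>\<^sup>+j. \<Sigma> j \<partial>count_space UNIV))"
      by (subst nn_integral_dyadic) (simp add: nn_integral_cmult)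
    also have "(\<integral>\<^sup>+j. \<Sigma> j \<partial>count_space UNIV)
        = (\<integral>\<^sup>+l. \<integral>\<^sup>+j. ennreal (q ^ nat \<bar>l - j\<bar> * c l powr \<rho>) \<partial>count_space UNIV \<partial>count_space UNIV)"
      unfolding \<Sigma>_def by (intro nn_integral_count_space_nn_integral) auto
    also have "\<dots> \<le> (\<integral>\<^sup>+l. ennreal (2 / (1 - q)) * ennreal (c l powr \<rho>) \<partial>count_space UNIV)"
    proof (rule nn_integral_mono)
      fix l
      have "(\<integral>\<^sup>+j. ennreal (q ^ nat \<bar>l - j\<bar> * c l powr \<rho>) \<partial>count_space UNIV)
          = (\<integral>\<^sup>+j. ennreal (q ^ nat \<bar>j - l\<bar>) * ennreal (c l powr \<rho>) \<partial>count_space UNIV)"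
        using q by (intro nn_integral_cong) (simp add: ennreal_mult' abs_minus_commute)
      also have "\<dots> = (\<integral>\<^sup>+j. ennreal (q ^ nat \<bar>j - l\<bar>) \<partial>count_space UNIV) * ennreal (c l powr \<rho>)"
        by (intro nn_integral_multc) simp
      also have "\<dots> \<le> ennreal (2 / (1 - q)) * ennreal (c l powr \<rho>)"
        using q by (intro mult_right_mono nn_integral_geometric_int_le) auto
      finally show "(\<integral>\<^sup>+j. ennreal (q ^ nat \<bar>l - j\<bar> * c l powr \<rho>) \<partial>count_space UNIV)
          \<le> ennreal (2 / (1 - q)) * ennreal (c l powr \<rho>)" .
    qed
    also have "\<dots> = ennreal (2 / (1 - q)) * ?X" by (intro nn_integral_cmult) simp
    finally have "?Y \<le> ennreal (ln 2 / 2) * (ennreal (A powr \<rho>) * (ennreal (2 / (1 - q)) * ?X))"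
      by (simp add: mult_left_mono)
    also have "\<dots> = ennreal B * ?X"
    proof -
      have "ennreal B = ennreal (ln 2 / 2) * ennreal (A powr \<rho>) * ennreal (2 / (1 - q))"
        unfolding B_def using q by (subst ennreal_mult, simp, simp, subst ennreal_mult, simp_all)
      then show ?thesis by (simp only: mult.assoc)
    qed
    finally have "ennreal_powr ?Y (1 / \<rho>) \<le> ennreal_powr (ennreal B * ?X) (1 / \<rho>)"
      using \<rho> by (intro ennreal_powr_mono) auto
    then show "weighted_norm \<theta> r \<kappa> \<le> ennreal (B powr (1 / \<rho>)) * seq_norm r c"
      using False by (simp add: seq_norm_def weighted_norm_def ennreal_powr_mult[OF B] \<rho>_def)
  qed (use B in simp)
qed

text \<open>The weight \<open>t\<^bsup>-\<theta>r-1\<^esup>\<close> is not integrable at \<open>0\<close>, so a finite norm forces \<open>\<kappa>\<close> to take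
  arbitrarily small values.\<close>

lemma weighted_norm_finite_imp_small:
  assumes r: "1 \<le> r" and \<theta>: "\<theta> > 0" and fin: "weighted_norm \<theta> r \<kappa> < top" and d: "d > 0"
  shows "\<exists>t>0. \<kappa> t < d"
proof (rule ccontr)
  assume "\<not> (\<exists>t>0. \<kappa> t < d)"
  then have \<kappa>: "\<And>t. t > 0 \<Longrightarrow> d \<le> \<kappa> t" by force
  show False
  proof (cases "r = top")
    case True
    define N where "N = enn2real (weighted_norm \<theta> r \<kappa>)"
    have N: "N \<ge> 0" "weighted_norm \<theta> r \<kappa> = ennreal N" using fin by (simp_all add: N_def)
    define t where "t = ((N + 1) / d) powr (- 1 / \<theta>)"
    have t: "t > 0" using N d by (simp add: t_def)
    have "ennreal (t powr (-\<theta>) * \<kappa> t) \<le> weighted_norm \<theta> r \<kappa>"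
      using True t by (auto simp: weighted_norm_def intro: SUP_upper)
    then have "t powr (-\<theta>) * \<kappa> t \<le> N" using N by simp
    moreover have "t powr (-\<theta>) * d \<le> t powr (-\<theta>) * \<kappa> t" using \<kappa>[OF t] by (intro mult_left_mono) auto
    moreover have "t powr (-\<theta>) = (N + 1) / d" using \<theta> N d by (simp add: t_def powr_powr)
    ultimately show False using d by simp
  next
    case False
    define \<rho> where "\<rho> = enn2real r"
    have \<rho>: "\<rho> \<ge> 1" using r False enn2real_mono[of 1 r] by (simp add: \<rho>_def less_top)
    let ?Y = "\<integral>\<^sup>+t\<in>{0<..}. ennreal (t powr (-\<theta> * \<rho> - 1) * \<kappa> t powr \<rho>) \<partial>lborel"
    have "ennreal (ln 2 / 2) * (\<integral>\<^sup>+j. ennreal (d powr \<rho>) * indicator {..<0::int} j \<partial>count_space UNIV)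
        = (\<integral>\<^sup>+t\<in>{0<..}. (ennreal (d powr \<rho>) * indicator {..<0} (dyadic_index t)) * ennreal (1 / t) \<partial>lborel)"
      by (rule nn_integral_dyadic[symmetric])
    also have "\<dots> \<le> ?Y"
    proof (rule nn_integral_mono)
      fix t :: real
      show "(ennreal (d powr \<rho>) * indicator {..<0} (dyadic_index t)) * ennreal (1 / t) * indicator {0<..} t
        \<le> ennreal (t powr (-\<theta> * \<rho> - 1) * \<kappa> t powr \<rho>) * indicator {0<..} t"
      proof (cases "t > 0 \<and> dyadic_index t < 0")
        case True
        then have "t < 1" by (auto simp: dyadic_index_def)
        then have "1 \<le> t powr (-\<theta>)" using True \<theta> by (simp add: powr_minus powr_le1 one_le_inverse)
        then have "d \<le> t powr (-\<theta>) * \<kappa> t"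
          using \<kappa>[of t] True d mult_mono[of 1 "t powr (-\<theta>)" d "\<kappa> t"] by simp
        then have "d powr \<rho> * (1 / t) \<le> (t powr (-\<theta>) * \<kappa> t) powr \<rho> * (1 / t)"
          using d \<rho> True by (intro mult_right_mono powr_mono2) auto
        then show ?thesis using True weighted_integrand[of t "\<kappa> t" \<theta> \<rho>] \<kappa>[of t] d
          by (simp add: ennreal_leI flip: ennreal_mult')
      qed auto
    qed
    finally have "ennreal (ln 2 / 2) * (ennreal (d powr \<rho>) * emeasure (count_space UNIV) {..<0::int}) \<le> ?Y"
      by (simp add: nn_integral_cmult_indicator)
    moreover have "emeasure (count_space UNIV) {..<0::int} = top"
      by (simp add: infinite_Iio)
    ultimately have "?Y = top" using d by (simp add: ennreal_mult_top top_unique)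
    then show False using fin False by (simp add: weighted_norm_def ennreal_powr_def \<rho>_def)
  qed
qed

section \<open>The K-functional between \<open>L\<close> and the range of \<open>J\<close>\<close>

context compact_linear_map
begin

text \<open>The construction of \<open>quotient_space\<close>, for \<open>J\<close> in place of \<open>I\<^sub>k\<close>.\<close>

definition range_space :: "'l nspace" where
  "range_space = \<lparr>
     vcarrier = J ` vcarrier H,
     vzero = vzero L,
     vadd = vadd L,
     vscale = vscale L,
     vnorm = (\<lambda>F. INF g\<in>{g \<in> vcarrier H. J g = F}. vnorm H g)\<rparr>"

abbreviation K :: "'l \<Rightarrow> real \<Rightarrow> real" where
  "K F t \<equiv> K_functional F t L range_space"

lemma range_norm_bdd: "bdd_below ((\<lambda>g. vnorm H g) ` {g \<in> vcarrier H. J g = F})"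
  by (rule bdd_belowI2[of _ 0]) (simp add: H.norm_ge_0)

lemma range_norm_le: "f \<in> vcarrier H \<Longrightarrow> vnorm range_space (J f) \<le> vnorm H f"
  unfolding range_space_def by (simp, intro cINF_lower range_norm_bdd) simp

lemma range_norm_ge:
  assumes "f \<in> vcarrier H" "\<And>g. g \<in> vcarrier H \<Longrightarrow> J g = J f \<Longrightarrow> c \<le> vnorm H g"
  shows "c \<le> vnorm range_space (J f)"
  unfolding range_space_def by (simp, intro cINF_greatest) (use assms in auto)

lemma K_le:
  assumes F: "F \<in> vcarrier L" and f: "f \<in> vcarrier H" and t: "t \<ge> 0"
  shows "K F t \<le> vnorm L (vsub L F (J f)) + t * vnorm H f"
proof -
  have ge0: "0 \<le> vnorm L (vsub L F y) + t * vnorm range_space y" if y: "y \<in> vcarrier range_space" for y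
  proof -
    obtain g where g: "g \<in> vcarrier H" "y = J g" using y by (auto simp: range_space_def)
    have "0 \<le> vnorm range_space y" unfolding g(2) using g(1) by (rule range_norm_ge) (rule H.norm_ge_0)
    then show ?thesis using t F g by (simp add: L.norm_ge_0 L.mem J_mem)
  qed
  have "K F t \<le> vnorm L (vsub L F (J f)) + t * vnorm range_space (J f)"
    unfolding K_functional_def
    by (intro cINF_lower bdd_belowI2[of _ 0] ge0) (use f in \<open>auto simp: range_space_def\<close>)
  also have "\<dots> \<le> vnorm L (vsub L F (J f)) + t * vnorm H f"
    using range_norm_le[OF f] t by (simp add: mult_left_mono)
  finally show ?thesis .
qed

text \<open>Together with \<open>K_le\<close>: the infimum over the range and the infimum in the quotient norm merge into
  one infimum over \<open>H\<close>. Division by \<open>t\<close> takes the bound through the inner infimum.\<close>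

lemma K_ge:
  assumes F: "F \<in> vcarrier L" and t: "t > 0"
    and c: "\<And>f. f \<in> vcarrier H \<Longrightarrow> c \<le> vnorm L (vsub L F (J f)) + t * vnorm H f"
  shows "c \<le> K F t"
  unfolding K_functional_def
proof (rule cINF_greatest)
  show "vcarrier range_space \<noteq> {}" using H.zero_mem by (auto simp: range_space_def)
  fix y assume "y \<in> vcarrier range_space"
  then obtain f where f: "f \<in> vcarrier H" "y = J f" by (auto simp: range_space_def)
  have "(c - vnorm L (vsub L F y)) / t \<le> vnorm range_space y"
    unfolding f(2) using f(1)
  proof (rule range_norm_ge)
    fix g assume g: "g \<in> vcarrier H" "J g = J f"
    show "(c - vnorm L (vsub L F (J f))) / t \<le> vnorm H g"
      using c[OF g(1)] g(2) t by (simp add: field_simps)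
  qed
  then show "c \<le> vnorm L (vsub L F y) + t * vnorm range_space y"
    using t by (simp add: field_simps)
qed

lemma K_nonneg: "F \<in> vcarrier L \<Longrightarrow> t > 0 \<Longrightarrow> 0 \<le> K F t"
  by (rule K_ge) (simp_all add: L.norm_ge_0 H.norm_ge_0 L.mem J_mem)

lemma J_zero: "J (vzero H) = vzero L"
proof -
  obtain C where "vnorm L (J (vzero H)) \<le> C * vnorm H (vzero H)" using bounded H.zero_mem by metis
  then have n: "vnorm L (J (vzero H)) = 0"
    using L.norm_ge_0[OF J_mem[OF H.zero_mem]] by (simp add: H.norm_sqrt H.mem H.inner_expand)
  have "vnorm L (vsub L (J (vzero H)) (vzero L)) = vnorm L (J (vzero H))"
    using J_mem[OF H.zero_mem] by (intro L.norm_cong) (simp_all add: L.mem L.inner_expand)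
  then show ?thesis using n J_mem[OF H.zero_mem] by (intro L.eq_if_dist_0) (simp_all add: L.mem)
qed

lemma J_lincomb:
  assumes "\<And>i. i \<in> A \<Longrightarrow> u i \<in> vcarrier H"
  shows "J (H.lincomb A c u n) = L.lincomb A c (\<lambda>i. J (u i)) n"
proof (induction n)
  case (Suc n)
  have "H.lincomb A c u n \<in> vcarrier H" using assms by (rule H.lincomb_mem)
  then show ?case using Suc assms
    by (simp add: H.lincomb_def L.lincomb_def J_add J_scale J_zero H.mem)
qed (simp add: H.lincomb_def L.lincomb_def J_zero)

end

lemma mem_dyadic_block_iff:
  "i \<in> dyadic_block I \<mu> j \<longleftrightarrow> i \<in> I \<and> 2 powr j < \<mu> i \<and> \<mu> i \<le> 2 powr (j + 1)"
proof -
  have "2 powi j = (2 :: real) powr j" "2 powi (j + 1) = (2 :: real) powr (j + 1)"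
    using powr_real_of_int'[of "2::real" j] powr_real_of_int'[of "2::real" "j + 1"] by simp_all
  then show ?thesis by (simp add: dyadic_block_def)
qed

text \<open>With \<open>x = log\<^sub>2 (m / t\<^sup>2)\<close> the claim is that \<open>min (\<theta> x) (- (1 - \<theta>) x) \<le> - \<delta> \<bar>x\<bar>\<close> for
  \<open>\<delta> = \<theta> (1 - \<theta>)\<close>; the factor \<open>2\<^sup>\<delta>\<close> pays for rounding \<open>x\<close> to \<open>l - j\<close>.\<close>

lemma min_weight_le:
  fixes m t \<theta> \<delta> :: real and l :: int
  assumes \<theta>: "0 < \<theta>" "\<theta> < 1" and t: "t > 0"
    and l: "2 powr l < m" "m \<le> 2 powr (l + 1)"
  defines "\<delta> \<equiv> \<theta> * (1 - \<theta>)"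
  shows "min 1 (t\<^sup>2 / m) \<le> m powr (-\<theta>) * (t powr (2 * \<theta>) * 2 powr \<delta> * 2 powr (- \<delta> * \<bar>l - dyadic_index t\<bar>))"
proof -
  have m: "m > 0" using l(1) powr_gt_zero[of 2 "real_of_int l"] by linarith
  define j where "j = dyadic_index t"
  define x where "x = log 2 (m / t\<^sup>2)"
  have mt: "m / t\<^sup>2 > 0" using m t by simp
  have px: "2 powr x = m / t\<^sup>2" using mt by (simp add: x_def)
  have x: "x = log 2 m - log 2 (t\<^sup>2)" using m t by (simp add: x_def log_divide)
  have "l < log 2 m" "log 2 m \<le> l + 1"
    using l m by (simp_all add: less_log_iff log_le_iff)
  moreover have "j \<le> log 2 (t\<^sup>2)" "log 2 (t\<^sup>2) < j + 1"
    using dyadic_index_square[OF t] t by (simp_all add: le_log_iff log_less_iff j_def)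
  ultimately have lj: "\<bar>real_of_int (l - j)\<bar> \<le> \<bar>x\<bar> + 1" using x by auto
  have \<delta>: "\<delta> > 0" "\<delta> \<le> \<theta>" "\<delta> \<le> 1 - \<theta>"
    using \<theta> mult_left_mono[of "1 - \<theta>" 1 \<theta>] mult_right_mono[of \<theta> 1 "1 - \<theta>"] by (auto simp: \<delta>_def)
  have "min 1 (t\<^sup>2 / m) * 2 powr (\<theta> * x) \<le> 2 powr (- \<delta> * \<bar>x\<bar>)"
  proof (cases "x \<ge> 0")
    case True
    have "t\<^sup>2 / m = 2 powr (- x)" using px t m by (simp add: powr_minus)
    then have "min 1 (t\<^sup>2 / m) * 2 powr (\<theta> * x) \<le> 2 powr (- x) * 2 powr (\<theta> * x)"
      by (intro mult_right_mono) auto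
    also have "\<dots> = 2 powr (- (1 - \<theta>) * x)" by (simp add: algebra_simps flip: powr_add)
    also have "\<dots> \<le> 2 powr (- \<delta> * \<bar>x\<bar>)"
      using mult_right_mono[OF \<delta>(3) True] True by (intro powr_mono) (simp_all add: algebra_simps)
    finally show ?thesis .
  next
    case False
    have "min 1 (t\<^sup>2 / m) * 2 powr (\<theta> * x) \<le> 1 * 2 powr (\<theta> * x)" by (intro mult_right_mono) auto
    also have "\<dots> \<le> 1 * 2 powr (- \<delta> * \<bar>x\<bar>)"
      using mult_right_mono[OF \<delta>(2), of "- x"] False by (simp add: algebra_simps)
    finally show ?thesis by simp
  qed
  also have "\<dots> \<le> 2 powr (\<delta> + - \<delta> * \<bar>l - j\<bar>)"
    using mult_left_mono[OF lj, of \<delta>] \<delta>(1) by (intro powr_mono) (auto simp: algebra_simps)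
  finally have le: "min 1 (t\<^sup>2 / m) * 2 powr (\<theta> * x) \<le> 2 powr \<delta> * 2 powr (- \<delta> * \<bar>l - j\<bar>)"
    by (simp only: powr_add)
  have "t powr (2 * \<theta>) * 2 powr (\<theta> * x) = m powr \<theta>"
  proof -
    have "2 powr (\<theta> * x) = (m / t\<^sup>2) powr \<theta>" unfolding px[symmetric] by (simp add: powr_powr mult.commute)
    moreover have "t powr (2 * \<theta>) = (t\<^sup>2) powr \<theta>"
      using t by (simp add: powr_powr[symmetric])
    ultimately show ?thesis using m t by (simp flip: powr_mult)
  qed
  then have "1 = m powr (-\<theta>) * (t powr (2 * \<theta>) * 2 powr (\<theta> * x))"
    using m by (simp flip: powr_add)
  then have "min 1 (t\<^sup>2 / m) = m powr (-\<theta>) * t powr (2 * \<theta>) * (min 1 (t\<^sup>2 / m) * 2 powr (\<theta> * x))"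
    by (metis (no_types, lifting) mult.assoc mult.commute mult.left_neutral)
  also have "\<dots> \<le> m powr (-\<theta>) * t powr (2 * \<theta>) * (2 powr \<delta> * 2 powr (- \<delta> * \<bar>l - j\<bar>))"
    using le by (intro mult_left_mono) auto
  finally show ?thesis by (simp add: j_def mult.assoc)
qed

context singular_system
begin

definition coef :: "'l \<Rightarrow> nat \<Rightarrow> real" where
  "coef F i = vinner L F (J (e i))"

text \<open>Write \<open>b\<^sub>i\<close> and \<open>h\<^sub>i\<close> for the coefficients of \<open>F\<close> and of a competitor \<open>J f\<close>. Bessel's inequality
  in \<open>L\<close> and in \<open>H\<close> bounds the square of \<open>\<parallel>F - J f\<parallel> + t \<parallel>f\<parallel>\<close> from below by
  \<open>\<Sum> (b\<^sub>i - h\<^sub>i)\<^sup>2 + t\<^sup>2 h\<^sub>i\<^sup>2 / \<mu>\<^sub>i\<close>, where \<open>t\<^sup>2 / \<mu>\<^sub>i \<ge> 1/2\<close>; and \<open>(b - h)\<^sup>2 + h\<^sup>2 / 2\<close> is smallest for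
  \<open>h = 2 b / 3\<close>, with value \<open>b\<^sup>2 / 3\<close>.\<close>

lemma sum_coef_le_K:
  assumes F: "F \<in> vcarrier L" and A: "finite A" "A \<subseteq> I" and t: "t > 0"
    and \<mu>t: "\<And>i. i \<in> A \<Longrightarrow> \<mu> i \<le> 2 * t\<^sup>2"
  shows "(\<Sum>i\<in>A. (coef F i)\<^sup>2) \<le> 3 * (K F t)\<^sup>2"
proof -
  have "sqrt ((\<Sum>i\<in>A. (coef F i)\<^sup>2) / 3) \<le> K F t"
  proof (rule K_ge[OF F t])
    fix f assume f: "f \<in> vcarrier H"
    let ?a = "vnorm L (vsub L F (J f))" and ?b = "vnorm H f"
    have ab: "?a \<ge> 0" "?b \<ge> 0" using F f by (simp_all add: L.norm_ge_0 H.norm_ge_0 L.mem J_mem)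
    have 1: "(\<Sum>i\<in>A. (coef F i - coef (J f) i)\<^sup>2) \<le> ?a\<^sup>2"
    proof -
      have "(\<Sum>i\<in>A. (coef F i - coef (J f) i)\<^sup>2) = (\<Sum>i\<in>A. (vinner L (vsub L F (J f)) (J (e i)))\<^sup>2)"
        using F f A(2) by (intro sum.cong) (auto simp: coef_def L.inner_sub_left J_mem Je_mem)
      also have "\<dots> \<le> ?a\<^sup>2" using F f A by (intro L.Bessel[OF orth_L]) (auto simp: L.mem J_mem)
      finally show ?thesis .
    qed
    have 2: "(\<Sum>i\<in>A. (coef (J f) i)\<^sup>2 / \<mu> i) \<le> ?b\<^sup>2"
    proof -
      have "(\<Sum>i\<in>A. (coef (J f) i)\<^sup>2 / \<mu> i) = (\<Sum>i\<in>A. (vinner H f (vscale H (sqrt (\<mu> i)) (e i)))\<^sup>2)"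
      proof (intro sum.cong refl)
        fix i assume "i \<in> A"
        then have i: "i \<in> I" using A(2) by blast
        show "(coef (J f) i)\<^sup>2 / \<mu> i = (vinner H f (vscale H (sqrt (\<mu> i)) (e i)))\<^sup>2"
          using \<mu>_pos[OF i] f e_mem[OF i]
          by (simp add: H.inner_scale_right inner_e[OF f i] coef_def power_mult_distrib power_divide power2_eq_square[of "\<mu> i"])
      qed
      also have "\<dots> \<le> ?b\<^sup>2" using f A by (intro H.Bessel[OF orth_H])
      finally show ?thesis .
    qed
    have "(\<Sum>i\<in>A. (coef F i)\<^sup>2) / 3 = (\<Sum>i\<in>A. (coef F i)\<^sup>2 / 3)" by (rule sum_divide_distrib)
    also have "\<dots> \<le> (\<Sum>i\<in>A. (coef F i - coef (J f) i)\<^sup>2 + t\<^sup>2 * ((coef (J f) i)\<^sup>2 / \<mu> i))"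
    proof (rule sum_mono)
      fix i assume i: "i \<in> A"
      have pos: "\<mu> i > 0" using \<mu>_pos i A(2) by blast
      have quad: "x\<^sup>2 / 3 \<le> (x - y)\<^sup>2 + y\<^sup>2 / 2" for x y :: real
      proof -
        have "0 \<le> (2 * x - 3 * y)\<^sup>2" by simp
        then show ?thesis by (simp add: power2_eq_square algebra_simps)
      qed
      have "1 / 2 \<le> t\<^sup>2 / \<mu> i" using \<mu>t[OF i] pos by (simp add: field_simps)
      then have "1 / 2 * (coef (J f) i)\<^sup>2 \<le> t\<^sup>2 / \<mu> i * (coef (J f) i)\<^sup>2" by (intro mult_right_mono) auto
      then show "(coef F i)\<^sup>2 / 3 \<le> (coef F i - coef (J f) i)\<^sup>2 + t\<^sup>2 * ((coef (J f) i)\<^sup>2 / \<mu> i)"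
        using quad[of "coef F i" "coef (J f) i"] by simp
    qed
    also have "\<dots> \<le> ?a\<^sup>2 + t\<^sup>2 * ?b\<^sup>2"
      using 1 mult_left_mono[OF 2, of "t\<^sup>2"] by (simp add: sum.distrib sum_distrib_left)
    also have "\<dots> \<le> (?a + t * ?b)\<^sup>2" using ab t by (simp add: power2_sum power_mult_distrib)
    finally show "sqrt ((\<Sum>i\<in>A. (coef F i)\<^sup>2) / 3) \<le> ?a + t * ?b"
      using ab t by (intro real_le_lsqrt) (auto simp: sum_nonneg)
  qed
  then have "(\<Sum>i\<in>A. (coef F i)\<^sup>2) / 3 \<le> (K F t)\<^sup>2"
    by (rule sqrt_le_D)
  then show ?thesis by simp
qed

lemma finite_dyadic_block: "finite (dyadic_block I \<mu> j)"
  by (rule finite_subset[OF _ finite_large_eigenvalues[of "2 powr j"]]) (auto simp: mem_dyadic_block_iff)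

lemma block_coeff_le_K:
  assumes F: "F \<in> vcarrier L" and t: "t > 0" and \<theta>: "0 < \<theta>" "\<theta> < 1"
  shows "block_coeff I \<mu> \<theta> (coef F) (dyadic_index t) \<le> 3 * (t powr (-\<theta>) * K F t)"
proof -
  define j where "j = dyadic_index t"
  let ?B = "dyadic_block I \<mu> j"
  have t2: "2 powr j \<le> t\<^sup>2" "t\<^sup>2 < 2 powr (j + 1)" using dyadic_index_square[OF t] by (simp_all add: j_def)
  have "(\<Sum>i\<in>?B. (coef F i)\<^sup>2 * \<mu> i powr (-\<theta>)) \<le> (\<Sum>i\<in>?B. (coef F i)\<^sup>2 * (2 * t powr (-2 * \<theta>)))"
  proof (intro sum_mono mult_left_mono)
    fix i assume "i \<in> ?B"
    then have i: "2 powr j < \<mu> i" by (simp add: mem_dyadic_block_iff)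
    have "t\<^sup>2 / 2 \<le> \<mu> i" using t2(2) i by (simp add: powr_add)
    then have "\<mu> i powr (-\<theta>) \<le> (t\<^sup>2 / 2) powr (-\<theta>)"
      using t \<theta> by (intro powr_mono2') auto
    also have "\<dots> = 2 powr \<theta> * (t\<^sup>2) powr (-\<theta>)"
      using t by (simp add: powr_divide powr_minus field_simps)
    also have "(t\<^sup>2) powr (-\<theta>) = t powr (-2 * \<theta>)"
      using t powr_powr[of t 2 "-\<theta>"] by simp
    also have "2 powr \<theta> * t powr (-2 * \<theta>) \<le> 2 * t powr (-2 * \<theta>)"
      using \<theta> powr_mono[of \<theta> 1 2] by (intro mult_right_mono) auto
    finally show "\<mu> i powr (-\<theta>) \<le> 2 * t powr (-2 * \<theta>)" .
  qed simp
  also have "\<dots> = 2 * t powr (-2 * \<theta>) * (\<Sum>i\<in>?B. (coef F i)\<^sup>2)"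
    by (simp add: sum_distrib_left mult.commute)
  also have "\<dots> \<le> 2 * t powr (-2 * \<theta>) * (3 * (K F t)\<^sup>2)"
  proof (intro mult_left_mono sum_coef_le_K[OF F finite_dyadic_block _ t])
    fix i assume "i \<in> ?B"
    then have "\<mu> i \<le> 2 powr (j + 1)" by (simp add: mem_dyadic_block_iff)
    also have "\<dots> \<le> 2 * t\<^sup>2" using t2(1) by (simp add: powr_add)
    finally show "\<mu> i \<le> 2 * t\<^sup>2" .
  qed (auto simp: mem_dyadic_block_iff)
  also have "\<dots> \<le> 9 * (t powr (-2 * \<theta>) * (K F t)\<^sup>2)"
    using mult_nonneg_nonneg[of "t powr (-2 * \<theta>)" "(K F t)\<^sup>2"] by simp
  also have "t powr (-2 * \<theta>) = (t powr (-\<theta>))\<^sup>2"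
    by (simp add: power2_eq_square flip: powr_add)
  also have "9 * ((t powr (-\<theta>))\<^sup>2 * (K F t)\<^sup>2) = (3 * (t powr (-\<theta>) * K F t))\<^sup>2"
    by (simp add: power_mult_distrib)
  finally show ?thesis
    unfolding block_coeff_def j_def[symmetric]
    using K_nonneg[OF F t] by (intro real_le_lsqrt) (auto simp: sum_nonneg)
qed

text \<open>Sorting the indices into blocks, the \<open>l\<close>-th block contributes at most
  \<open>2\<^bsup>-\<delta>\<bar>l-j\<bar>\<^esup> c\<^sub>l\<^sup>2\<close> up to a common factor. The admitted growth \<open>c\<^sub>l\<^sup>2 \<le> 2\<^bsup>\<delta>\<bar>l-j\<bar>/2\<^esup> S\<^sup>2\<close> uses up half of
  the decay, and a geometric series with ratio \<open>2\<^bsup>-\<delta>/2\<^esup>\<close> remains.\<close>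

lemma sum_min_weight_le:
  fixes t S \<theta> \<delta> :: real
  assumes A: "finite A" "A \<subseteq> I" and \<theta>: "0 < \<theta>" "\<theta> < 1" and t: "t > 0" and S: "S \<ge> 0"
    and c: "\<And>l. block_coeff I \<mu> \<theta> b l \<le> 2 powr (\<theta> * (1 - \<theta>) / 4 * \<bar>l - dyadic_index t\<bar>) * S"
  defines "\<delta> \<equiv> \<theta> * (1 - \<theta>)"
  shows "(\<Sum>i\<in>A. (b i)\<^sup>2 * min 1 (t\<^sup>2 / \<mu> i))
    \<le> (2 powr \<delta> * (2 / (1 - 2 powr (- (\<delta> / 2))))) * (t powr \<theta> * S)\<^sup>2"
proof -
  define j where "j = dyadic_index t"
  define lev where "lev i = \<lceil>log 2 (\<mu> i)\<rceil> - 1" for i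
  have lev: "i \<in> dyadic_block I \<mu> (lev i)" if "i \<in> I" for i
  proof -
    have "real_of_int (lev i) < log 2 (\<mu> i)" "log 2 (\<mu> i) \<le> real_of_int (lev i) + 1"
      unfolding lev_def by linarith+
    then show ?thesis
      using that \<mu>_pos[OF that] by (simp add: mem_dyadic_block_iff less_log_iff log_le_iff)
  qed
  have \<delta>: "\<delta> > 0" using \<theta> by (simp add: \<delta>_def)
  define q where "q = 2 powr (- (\<delta> / 2))"
  have q: "0 < q" "q < 1" using \<delta> by (auto simp: q_def powr_less_one)
  define R where "R = t powr (2 * \<theta>) * 2 powr \<delta>"
  have R: "R \<ge> 0" by (simp add: R_def)
  have level: "(\<Sum>i\<in>{i \<in> A. lev i = l}. (b i)\<^sup>2 * min 1 (t\<^sup>2 / \<mu> i)) \<le> R * S\<^sup>2 * q ^ nat \<bar>l - j\<bar>" for l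
  proof -
    let ?c = "block_coeff I \<mu> \<theta> b l"
    have "(\<Sum>i\<in>{i \<in> A. lev i = l}. (b i)\<^sup>2 * min 1 (t\<^sup>2 / \<mu> i))
        \<le> (\<Sum>i\<in>dyadic_block I \<mu> l. (b i)\<^sup>2 * min 1 (t\<^sup>2 / \<mu> i))"
      using A lev \<mu>_pos finite_dyadic_block
      by (intro sum_mono2) (auto simp: mem_dyadic_block_iff less_imp_le)
    also have "\<dots> \<le> (\<Sum>i\<in>dyadic_block I \<mu> l. (b i)\<^sup>2 * (\<mu> i powr (-\<theta>) * (R * 2 powr (- \<delta> * \<bar>l - j\<bar>))))"
    proof (intro sum_mono mult_left_mono)
      fix i assume "i \<in> dyadic_block I \<mu> l"
      then show "min 1 (t\<^sup>2 / \<mu> i) \<le> \<mu> i powr (-\<theta>) * (R * 2 powr (- \<delta> * \<bar>l - j\<bar>))"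
        using min_weight_le[OF \<theta> t, of l "\<mu> i"] by (simp add: mem_dyadic_block_iff R_def \<delta>_def j_def)
    qed simp
    also have "\<dots> = ?c\<^sup>2 * (R * 2 powr (- \<delta> * \<bar>l - j\<bar>))"
      by (simp add: block_coeff_def sum_nonneg sum_distrib_right mult.assoc)
    also have "\<dots> \<le> (2 powr (\<delta> / 4 * \<bar>l - j\<bar>) * S)\<^sup>2 * (R * 2 powr (- \<delta> * \<bar>l - j\<bar>))"
      using c[of l] R by (intro mult_right_mono power_mono) (auto simp: \<delta>_def j_def block_coeff_def sum_nonneg)
    also have "\<dots> = R * S\<^sup>2 * ((2 powr (\<delta> / 4 * \<bar>l - j\<bar>))\<^sup>2 * 2 powr (- \<delta> * \<bar>l - j\<bar>))"
      by (simp add: power_mult_distrib mult_ac)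
    also have "(2 powr (\<delta> / 4 * \<bar>l - j\<bar>))\<^sup>2 * 2 powr (- \<delta> * \<bar>l - j\<bar>) = 2 powr (- (\<delta> / 2) * \<bar>l - j\<bar>)"
      by (simp add: power2_eq_square field_simps flip: powr_add)
    also have "\<dots> = q ^ nat \<bar>l - j\<bar>"
      using q by (simp add: powr_realpow[symmetric] q_def powr_powr)
    finally show ?thesis .
  qed
  have "(\<Sum>i\<in>A. (b i)\<^sup>2 * min 1 (t\<^sup>2 / \<mu> i))
      = (\<Sum>l\<in>lev ` A. \<Sum>i\<in>{i \<in> A. lev i = l}. (b i)\<^sup>2 * min 1 (t\<^sup>2 / \<mu> i))"
    using A(1) by (rule sum.image_gen)
  also have "\<dots> \<le> (\<Sum>l\<in>lev ` A. R * S\<^sup>2 * q ^ nat \<bar>l - j\<bar>)"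
    by (intro sum_mono level)
  also have "\<dots> = R * S\<^sup>2 * (\<Sum>l\<in>lev ` A. q ^ nat \<bar>l - j\<bar>)" by (simp add: sum_distrib_left)
  also have "\<dots> \<le> R * S\<^sup>2 * (2 / (1 - q))"
    using A(1) q R by (intro mult_left_mono sum_geometric_int_le) auto
  also have "\<dots> = (2 powr \<delta> * (2 / (1 - q))) * (t powr \<theta> * S)\<^sup>2"
  proof -
    have "t powr (2 * \<theta>) = (t powr \<theta>)\<^sup>2" by (simp add: power2_eq_square flip: powr_add)
    then show ?thesis by (simp add: R_def power_mult_distrib)
  qed
  finally show ?thesis by (simp add: q_def)
qed

lemma lincomb_orthonormal_dist:
  assumes F: "F \<in> vcarrier L" and A: "A \<subseteq> I"
  shows "(vnorm L (vsub L F (L.lincomb A (coef F) (\<lambda>i. J (e i)) n)))\<^sup>2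
    = (vnorm L F)\<^sup>2 - (\<Sum>i\<in>A \<inter> {..<n}. (coef F i)\<^sup>2)"
proof -
  have "orthonormal_system L A (\<lambda>i. J (e i))"
    using orth_L A unfolding orthonormal_system_def by (meson subsetD)
  from L.norm_sub_lincomb[OF this F, of "coef F" n] show ?thesis by (simp add: coef_def)
qed

abbreviation eigen_expansion :: "(nat \<Rightarrow> real) \<Rightarrow> 'l \<Rightarrow> bool" where
  "eigen_expansion b F \<equiv> L.converges (L.lincomb I b (\<lambda>i. J (e i))) F"

lemma eigen_expansion_coef:
  assumes F: "F \<in> vcarrier L" and ex: "eigen_expansion b F" and i: "i \<in> I"
  shows "b i = coef F i"
proof -
  have "(\<lambda>n. vinner L (L.lincomb I b (\<lambda>i. J (e i)) n) (J (e i))) \<longlonglongrightarrow> coef F i"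
    unfolding coef_def using Je_mem i ex F by (intro L.converges_inner L.lincomb_mem)
  moreover have "\<forall>\<^sub>F n in sequentially. vinner L (L.lincomb I b (\<lambda>i. J (e i)) n) (J (e i)) = b i"
    using eventually_gt_at_top[of i]
  proof eventually_elim
    case (elim n)
    have "vinner L (L.lincomb I b (\<lambda>i. J (e i)) n) (J (e i))
        = (\<Sum>k\<in>I \<inter> {..<n}. b k * vinner L (J (e k)) (J (e i)))"
      using Je_mem i by (intro L.inner_lincomb_left) auto
    also have "\<dots> = (\<Sum>k\<in>I \<inter> {..<n}. if k = i then b k else 0)"
      using i by (intro sum.cong) (auto simp: inner_Je)
    also have "\<dots> = b i" using i elim by simp
    finally show ?case .
  qed
  ultimately have "(\<lambda>n. b i) \<longlonglongrightarrow> coef F i" by (simp add: tendsto_cong)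
  then show ?thesis by (simp add: LIMSEQ_const_iff)
qed

text \<open>The competitor in the K-functional at \<open>t\<close> is the part of the expansion with \<open>\<mu>\<^sub>i > t\<^sup>2\<close>, for
  which both terms are controlled by \<open>\<Sum> b\<^sub>i\<^sup>2 min 1 (t\<^sup>2 / \<mu>\<^sub>i)\<close>.\<close>

lemma K_le_block_coeff:
  fixes t S \<theta> \<delta> :: real
  assumes F: "F \<in> vcarrier L" and ex: "eigen_expansion (coef F) F"
    and \<theta>: "0 < \<theta>" "\<theta> < 1" and t: "t > 0" and S: "S \<ge> 0"
    and c: "\<And>l. block_coeff I \<mu> \<theta> (coef F) l \<le> 2 powr (\<theta> * (1 - \<theta>) / 4 * \<bar>l - dyadic_index t\<bar>) * S"
  defines "\<delta> \<equiv> \<theta> * (1 - \<theta>)"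
  shows "t powr (-\<theta>) * K F t \<le> 2 * sqrt (2 powr \<delta> * (2 / (1 - 2 powr (- (\<delta> / 2))))) * S"
proof -
  define G where "G = 2 powr \<delta> * (2 / (1 - 2 powr (- (\<delta> / 2))))"
  have "\<delta> > 0" using \<theta> by (simp add: \<delta>_def)
  then have G: "G \<ge> 0" by (simp add: G_def powr_le_one_le less_imp_le powr_less_one)
  define B where "B = G * (t powr \<theta> * S)\<^sup>2"
  have sum_le: "(\<Sum>i\<in>A. (coef F i)\<^sup>2 * min 1 (t\<^sup>2 / \<mu> i)) \<le> B" if "finite A" "A \<subseteq> I" for A
    using sum_min_weight_le[OF that \<theta> t S c] by (simp add: B_def G_def \<delta>_def)
  define A where "A = {i \<in> I. \<mu> i > t\<^sup>2}"
  have A: "finite A" "A \<subseteq> I" using finite_large_eigenvalues[of "t\<^sup>2"] t by (auto simp: A_def)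
  obtain n where n: "A \<subseteq> {..<n}" using A(1) finite_nat_bounded by blast
  then have An: "A \<inter> {..<n} = A" by blast
  define y where "y = H.lincomb A (coef F) e n"
  have eA: "e i \<in> vcarrier H" if "i \<in> A" for i using that A(2) e_mem by blast
  have y: "y \<in> vcarrier H" unfolding y_def by (intro H.lincomb_mem eA)
  have Jy: "J y = L.lincomb A (coef F) (\<lambda>i. J (e i)) n" unfolding y_def by (intro J_lincomb eA)
  have tail: "(vnorm L (vsub L F (J y)))\<^sup>2 \<le> B"
  proof -
    have "(\<lambda>m. (vnorm L (vsub L (L.lincomb I (coef F) (\<lambda>i. J (e i)) m) F))\<^sup>2) \<longlonglongrightarrow> 0\<^sup>2"
      using ex unfolding L.converges_def by (rule tendsto_power)
    also have "(\<lambda>m. (vnorm L (vsub L (L.lincomb I (coef F) (\<lambda>i. J (e i)) m) F))\<^sup>2)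
        = (\<lambda>m. (vnorm L F)\<^sup>2 - (\<Sum>i\<in>I \<inter> {..<m}. (coef F i)\<^sup>2))"
      using L.norm_sub_commute[OF L.lincomb_mem F] Je_mem lincomb_orthonormal_dist[OF F subset_refl] by simp
    finally have lim: "(\<lambda>m. (vnorm L F)\<^sup>2 - (\<Sum>i\<in>I \<inter> {..<m}. (coef F i)\<^sup>2)) \<longlonglongrightarrow> 0" by simp
    have "(vnorm L F)\<^sup>2 - (\<Sum>i\<in>A. (coef F i)\<^sup>2) \<le> B + 0"
    proof (rule LIMSEQ_le_const)
      show "(\<lambda>m. B + ((vnorm L F)\<^sup>2 - (\<Sum>i\<in>I \<inter> {..<m}. (coef F i)\<^sup>2))) \<longlonglongrightarrow> B + 0"
        by (intro tendsto_add tendsto_const lim)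
      have "(vnorm L F)\<^sup>2 - (\<Sum>i\<in>A. (coef F i)\<^sup>2)
          \<le> B + ((vnorm L F)\<^sup>2 - (\<Sum>i\<in>I \<inter> {..<m}. (coef F i)\<^sup>2))" if "m \<ge> n" for m
      proof -
        have sub: "A \<subseteq> I \<inter> {..<m}"
        proof
          fix i assume i: "i \<in> A"
          have "i < n" using n i by auto
          then show "i \<in> I \<inter> {..<m}" using that i A(2) by auto
        qed
        have "(\<Sum>i\<in>I \<inter> {..<m}. (coef F i)\<^sup>2) - (\<Sum>i\<in>A. (coef F i)\<^sup>2)
            = (\<Sum>i\<in>I \<inter> {..<m} - A. (coef F i)\<^sup>2)"
          using sub by (subst sum_diff) auto
        also have "\<dots> = (\<Sum>i\<in>I \<inter> {..<m} - A. (coef F i)\<^sup>2 * min 1 (t\<^sup>2 / \<mu> i))"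
          using \<mu>_pos by (intro sum.cong) (auto simp: A_def min_def field_simps)
        also have "\<dots> \<le> B" by (rule sum_le) auto
        finally show ?thesis by simp
      qed
      then show "\<exists>N. \<forall>m\<ge>N. (vnorm L F)\<^sup>2 - (\<Sum>i\<in>A. (coef F i)\<^sup>2)
          \<le> B + ((vnorm L F)\<^sup>2 - (\<Sum>i\<in>I \<inter> {..<m}. (coef F i)\<^sup>2))" by blast
    qed
    then show ?thesis unfolding Jy using lincomb_orthonormal_dist[OF F A(2), of n] An by simp
  qed
  have head: "(t * vnorm H y)\<^sup>2 \<le> B"
  proof -
    have "vinner H y y = (\<Sum>i\<in>A. (coef F i)\<^sup>2 * (1 / \<mu> i))"
      unfolding y_def using A(2)
      by (subst H.inner_lincomb_lincomb[where d="\<lambda>i. 1 / \<mu> i"])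
        (auto simp: An eA inner_ee subsetD[OF A(2)])
    then have "(t * vnorm H y)\<^sup>2 = (\<Sum>i\<in>A. (coef F i)\<^sup>2 * (t\<^sup>2 / \<mu> i))"
      using y by (simp add: power_mult_distrib H.norm_sq sum_distrib_left mult_ac)
    also have "\<dots> = (\<Sum>i\<in>A. (coef F i)\<^sup>2 * min 1 (t\<^sup>2 / \<mu> i))"
      using \<mu>_pos by (intro sum.cong) (auto simp: A_def min_def field_simps)
    also have "\<dots> \<le> B" by (rule sum_le[OF A])
    finally show ?thesis .
  qed
  have "K F t \<le> vnorm L (vsub L F (J y)) + t * vnorm H y" using F y t by (intro K_le) auto
  also have "\<dots> \<le> sqrt B + sqrt B" using tail head by (intro add_mono real_le_rsqrt)
  also have "\<dots> = 2 * (sqrt G * (t powr \<theta> * S))" using S by (simp add: B_def real_sqrt_mult)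
  finally have "t powr (-\<theta>) * K F t \<le> t powr (-\<theta>) * (2 * (sqrt G * (t powr \<theta> * S)))"
    by (intro mult_left_mono) auto
  also have "\<dots> = 2 * sqrt G * S" using t by (simp add: powr_minus)
  finally show ?thesis by (simp add: G_def)
qed

text \<open>If \<open>F\<close> is close to \<open>J f\<close>, then its partial sums do at least as well as those of \<open>J f\<close>, whose
  remainders \<open>norm_J_orthogonal\<close> bounds by the eigenvalues that have been left out.\<close>

lemma eigen_expansion_of_closure:
  assumes F: "F \<in> vcarrier L"
    and close: "\<And>d. d > 0 \<Longrightarrow> \<exists>f\<in>vcarrier H. vnorm L (vsub L F (J f)) < d"
  shows "eigen_expansion (coef F) F"
  unfolding L.converges_def LIMSEQ_def
proof (intro allI impI)
  fix d :: real assume d: "d > 0"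
  obtain f where f: "f \<in> vcarrier H" and fd: "vnorm L (vsub L F (J f)) < d / 2"
    using close[of "d / 2"] d by auto
  define \<epsilon> where "\<epsilon> = (d / (2 * (vnorm H f + 1)))\<^sup>2"
  have nf: "vnorm H f \<ge> 0" using f by (rule H.norm_ge_0)
  have \<epsilon>: "\<epsilon> > 0" using d nf by (simp add: \<epsilon>_def)
  obtain N where N: "{i \<in> I. \<mu> i > \<epsilon>} \<subseteq> {..<N}"
    using finite_large_eigenvalues[OF \<epsilon>] finite_nat_bounded by blast
  have "vnorm L (vsub L (L.lincomb I (coef F) (\<lambda>i. J (e i)) n) F) < d" if n: "n \<ge> N" for n
  proof -
    let ?P = "\<lambda>G. L.lincomb I (coef G) (\<lambda>i. J (e i)) n"
    have P: "?P G \<in> vcarrier L" for G by (intro L.lincomb_mem Je_mem)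
    define s where "s = H.lincomb I (coef (J f)) e n"
    have s: "s \<in> vcarrier H" unfolding s_def by (intro H.lincomb_mem e_mem)
    have Js: "J s = ?P (J f)" unfolding s_def by (intro J_lincomb e_mem)
    define g where "g = vsub H f s"
    have g: "g \<in> vcarrier H" using f s by (simp add: g_def H.mem)
    have fs: "vinner H f s = (\<Sum>i\<in>I \<inter> {..<n}. (coef (J f) i)\<^sup>2 / \<mu> i)"
    proof -
      have "vinner H f s = (\<Sum>i\<in>I \<inter> {..<n}. coef (J f) i * vinner H f (e i))"
        unfolding s_def using e_mem f by (intro H.inner_lincomb_right)
      then show ?thesis using f by (simp add: inner_e coef_def power2_eq_square)
    qed
    have ss: "vinner H s s = (\<Sum>i\<in>I \<inter> {..<n}. (coef (J f) i)\<^sup>2 / \<mu> i)"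
      unfolding s_def
      by (subst H.inner_lincomb_lincomb[where d="\<lambda>i. 1 / \<mu> i"]) (auto simp: e_mem inner_ee)
    have "(vnorm H g)\<^sup>2 = vinner H f f - vinner H s s"
      using f s g fs ss H.inner_sym[OF f s] by (simp add: H.norm_sq) (simp add: g_def H.mem H.inner_expand)
    then have le: "(vnorm H g)\<^sup>2 \<le> (vnorm H f)\<^sup>2"
      using f s H.inner_ge_0[OF s] by (simp add: H.norm_sq)
    have "(vnorm L (J g))\<^sup>2 \<le> \<epsilon> * (vnorm H g)\<^sup>2"
    proof (rule norm_J_orthogonal[OF g])
      show "\<epsilon> \<ge> 0" using \<epsilon> by simp
      fix i assume i: "i \<in> I" "\<mu> i > \<epsilon>"
      then have "i < n" using N n by auto
      have "vinner H s (e i) = (\<Sum>k\<in>I \<inter> {..<n}. coef (J f) k * vinner H (e k) (e i))"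
        unfolding s_def using e_mem i by (intro H.inner_lincomb_left)
      also have "\<dots> = (\<Sum>k\<in>I \<inter> {..<n}. if k = i then coef (J f) k / \<mu> k else 0)"
        using i by (intro sum.cong) (auto simp: inner_ee)
      also have "\<dots> = coef (J f) i / \<mu> i" using i \<open>i < n\<close> by simp
      finally show "vinner H g (e i) = 0"
        using f s i e_mem by (simp add: g_def H.inner_sub_left inner_e[OF f] coef_def)
    qed
    also have "\<dots> \<le> \<epsilon> * (vnorm H f)\<^sup>2" using le \<epsilon> by (intro mult_left_mono) auto
    also have "\<dots> = (d / (2 * (vnorm H f + 1)) * vnorm H f)\<^sup>2"
      by (simp only: \<epsilon>_def power_mult_distrib)
    finally have sq: "(vnorm L (J g))\<^sup>2 \<le> (d / (2 * (vnorm H f + 1)) * vnorm H f)\<^sup>2" .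
    have "0 \<le> d / (2 * (vnorm H f + 1)) * vnorm H f" using nf d by simp
    with sq have "vnorm L (J g) \<le> d / (2 * (vnorm H f + 1)) * vnorm H f"
      by (rule power2_le_imp_le)
    also have "\<dots> = d / 2 * (vnorm H f / (vnorm H f + 1))" by simp
    also have "\<dots> \<le> d / 2 * 1" using nf d by (intro mult_left_mono) auto
    finally have Jg: "vnorm L (vsub L (J f) (?P (J f))) \<le> d / 2"
      using f s by (simp add: g_def J_sub Js)
    have "(vnorm L (vsub L F (?P F)))\<^sup>2 \<le> (vnorm L (vsub L F (?P (J f))))\<^sup>2"
    proof -
      have "0 \<le> (\<Sum>i\<in>I \<inter> {..<n}. (coef F i - coef (J f) i)\<^sup>2)" by (simp add: sum_nonneg)
      then show ?thesis
        unfolding lincomb_orthonormal_dist[OF F subset_refl] L.norm_sub_lincomb[OF orth_L F]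
        by (simp add: coef_def)
    qed
    then have "vnorm L (vsub L F (?P F)) \<le> vnorm L (vsub L F (?P (J f)))"
      by (rule power2_le_imp_le) (intro L.norm_ge_0 L.sub_mem F P)
    also have "\<dots> \<le> vnorm L (vsub L F (J f)) + vnorm L (vsub L (J f) (?P (J f)))"
      using F P J_mem[OF f] by (intro L.norm_triangle)
    also have "\<dots> < d" using fd Jg by simp
    finally show ?thesis using L.norm_sub_commute[OF F P] by simp
  qed
  moreover have "\<bar>vnorm L (vsub L (L.lincomb I (coef F) (\<lambda>i. J (e i)) n) F)\<bar>
      = vnorm L (vsub L (L.lincomb I (coef F) (\<lambda>i. J (e i)) n) F)" for n
    by (intro abs_of_nonneg L.norm_ge_0 L.sub_mem L.lincomb_mem Je_mem F)
  ultimately show "\<exists>N. \<forall>n\<ge>N. dist (vnorm L (vsub L (L.lincomb I (coef F) (\<lambda>i. J (e i)) n) F)) 0 < d"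
    by auto
qed

text \<open>A finite norm makes the K-functional, and with it the distance of \<open>F\<close> to the range of \<open>J\<close>,
  arbitrarily small.\<close>

lemma eigen_expansion_of_interp:
  assumes F: "F \<in> vcarrier L" and \<theta>: "0 < \<theta>" and r: "1 \<le> r"
    and fin: "interp_norm L range_space \<theta> r F < top"
  shows "eigen_expansion (coef F) F"
proof (rule eigen_expansion_of_closure[OF F])
  fix d :: real assume d: "d > 0"
  obtain t where t: "t > 0" "K F t < d"
    using weighted_norm_finite_imp_small[OF r \<theta> _ d] fin unfolding interp_norm_eq by blast
  have "\<exists>f\<in>vcarrier H. vnorm L (vsub L F (J f)) + t * vnorm H f < d"
  proof (rule ccontr)
    assume "\<not> ?thesis"
    then have "d \<le> K F t" by (intro K_ge[OF F t(1)]) (simp add: not_less)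
    then show False using t(2) by simp
  qed
  then obtain f where f: "f \<in> vcarrier H" "vnorm L (vsub L F (J f)) + t * vnorm H f < d" by blast
  then show "\<exists>f\<in>vcarrier H. vnorm L (vsub L F (J f)) < d"
  proof (intro bexI[of _ f])
    have "0 \<le> t * vnorm H f" using t(1) H.norm_ge_0[OF f(1)] by simp
    then show "vnorm L (vsub L F (J f)) < d" using f(2) by linarith
  qed (rule f(1))
qed

text \<open>The bound \<open>block_coeff_le_K\<close> is integrated by \<open>seq_norm_le_weighted_norm\<close> and
  \<open>K_le_block_coeff\<close> by \<open>weighted_norm_le_seq_norm\<close>; the constants depend on \<open>\<theta>\<close> and \<open>r\<close> only.\<close>

theorem power_norm_equiv_interp_norm:
  assumes \<theta>: "0 < \<theta>" "\<theta> < 1" and r: "1 \<le> r"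
  obtains C D where "C > 0" "D > 0"
    "\<And>F. F \<in> vcarrier L \<Longrightarrow>
      power_seq_norm I \<mu> \<theta> r (coef F) \<le> ennreal C * interp_norm L range_space \<theta> r F"
    "\<And>F. \<lbrakk>F \<in> vcarrier L; eigen_expansion (coef F) F; power_seq_norm I \<mu> \<theta> r (coef F) < top\<rbrakk> \<Longrightarrow>
      interp_norm L range_space \<theta> r F \<le> ennreal D * power_seq_norm I \<mu> \<theta> r (coef F)"
proof -
  define \<delta> where "\<delta> = \<theta> * (1 - \<theta>)"
  define G where "G = 2 * sqrt (2 powr \<delta> * (2 / (1 - 2 powr (- (\<delta> / 2)))))"
  have \<delta>: "\<delta> > 0" using \<theta> by (simp add: \<delta>_def)
  then have G: "G > 0" by (simp add: G_def powr_less_one)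
  have c0: "0 \<le> block_coeff I \<mu> \<theta> b j" for b j by (simp add: block_coeff_def sum_nonneg)
  have pos: "(3::real) > 0" "\<delta> / 4 > 0" using \<delta> by auto
  show thesis
  proof (rule seq_norm_le_weighted_norm[OF r pos(1), of \<theta>],
      rule weighted_norm_le_seq_norm[OF r G pos(2), of \<theta>])
    fix C D :: real
    assume C: "C > 0" "\<And>c \<kappa>. \<lbrakk>\<And>j. 0 \<le> c j; \<And>t. t > 0 \<Longrightarrow> 0 \<le> \<kappa> t;
          \<And>t. t > 0 \<Longrightarrow> c (dyadic_index t) \<le> 3 * (t powr (-\<theta>) * \<kappa> t)\<rbrakk>
        \<Longrightarrow> seq_norm r c \<le> ennreal C * weighted_norm \<theta> r \<kappa>"
    assume D: "D > 0" "\<And>c \<kappa>. \<lbrakk>\<And>j. 0 \<le> c j; \<And>t. t > 0 \<Longrightarrow> 0 \<le> \<kappa> t; seq_norm r c < top;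
          \<And>t S. \<lbrakk>t > 0; S \<ge> 0; \<And>l. c l \<le> 2 powr (\<delta> / 4 * \<bar>l - dyadic_index t\<bar>) * S\<rbrakk>
            \<Longrightarrow> t powr (-\<theta>) * \<kappa> t \<le> G * S\<rbrakk>
        \<Longrightarrow> weighted_norm \<theta> r \<kappa> \<le> ennreal D * seq_norm r c"
    show thesis
    proof (rule that[OF C(1) D(1)])
      fix F assume F: "F \<in> vcarrier L"
      show "power_seq_norm I \<mu> \<theta> r (coef F) \<le> ennreal C * interp_norm L range_space \<theta> r F"
        unfolding power_seq_norm_eq interp_norm_eq
        by (rule C(2)) (use c0 K_nonneg[OF F] block_coeff_le_K[OF F _ \<theta>] in auto)
      assume ex: "eigen_expansion (coef F) F" and fin: "power_seq_norm I \<mu> \<theta> r (coef F) < top"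
      show "interp_norm L range_space \<theta> r F \<le> ennreal D * power_seq_norm I \<mu> \<theta> r (coef F)"
        unfolding power_seq_norm_eq interp_norm_eq
      proof (rule D(2))
        fix t S :: real
        assume "t > 0" "S \<ge> 0"
          "\<And>l. block_coeff I \<mu> \<theta> (coef F) l \<le> 2 powr (\<delta> / 4 * \<bar>l - dyadic_index t\<bar>) * S"
        then show "t powr (-\<theta>) * K F t \<le> G * S"
          unfolding G_def \<delta>_def by (intro K_le_block_coeff[OF F ex \<theta>])
      qed (use c0 K_nonneg[OF F] fin in \<open>auto simp: power_seq_norm_eq\<close>)
    qed
  qed
qed

end

section \<open>Power spaces as interpolation spaces\<close>

lemma power_seq_norm_cong:
  assumes "\<And>i. i \<in> I \<Longrightarrow> b i = b' i"
  shows "power_seq_norm I \<mu> \<theta> r b = power_seq_norm I \<mu> \<theta> r b'"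
proof -
  have "block_coeff I \<mu> \<theta> b j = block_coeff I \<mu> \<theta> b' j" for j
    unfolding block_coeff_def using assms
    by (intro arg_cong[where f=sqrt] sum.cong) (auto simp: mem_dyadic_block_iff)
  then have "block_coeff I \<mu> \<theta> b = block_coeff I \<mu> \<theta> b'" by blast
  then show ?thesis by (simp add: power_seq_norm_eq)
qed

theorem theorem3p1:
  fixes M :: "'a measure"
    and H :: "('a \<Rightarrow> real) hspace"
    and k :: "'a \<Rightarrow> 'a \<Rightarrow> real"
    and I :: "nat set"
    and \<mu> :: "nat \<Rightarrow> real"
    and e :: "nat \<Rightarrow> 'a \<Rightarrow> real"
    and \<theta> :: real
    and r :: ennreal
  assumes "0 < \<theta>" and "\<theta> < 1"
    and "1 \<le> r"
    and "rkhs (space M) H k"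
    and "(\<lambda>(x, y). k x y) \<in> borel_measurable (M \<Otimes>\<^sub>M M)"
    and "compactly_embedded M H"
    and "eigenvalue_enumeration (L2 M) (T_op M H) I \<mu>"
    and "\<forall>i\<in>I. e i \<in> vcarrier H"
    and "orthonormal_system (L2 M) I (\<lambda>i. ae_class M (e i))"
    and "\<forall>i\<in>I. T_op M H (ae_class M (e i)) = vscale (L2 M) (\<mu> i) (ae_class M (e i))"
    and "orthonormal_system H I (\<lambda>i. vscale H (sqrt (\<mu> i)) (e i))"
  shows "vcarrier (power_space M I \<mu> e \<theta> r)
           = vcarrier (interp_space (L2 M) (quotient_space M H) \<theta> r)
         \<and> equivalent_norms (vcarrier (power_space M I \<mu> e \<theta> r))
           (vnorm (power_space M I \<mu> e \<theta> r))
           (vnorm (interp_space (L2 M) (quotient_space M H) \<theta> r))"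
proof -
  interpret R: rkhs "space M" H k by fact
  interpret L: inner_space "L2 M" by (rule inner_space_L2)
  have T: "T_op M H = (\<lambda>w. ae_class M (adjoint_operator H (L2 M) (ae_class M) w))"
    by (simp add: T_op_def fun_eq_iff)
  interpret S: singular_system H "L2 M" "ae_class M" I \<mu> e
  proof
    show "compact_operator H (L2 M) (ae_class M)" using assms(6) by (simp add: compactly_embedded_def)
  qed (use assms(7-11) in \<open>simp_all add: T\<close>)
  have quot: "quotient_space M H = S.range_space"
    by (simp add: quotient_space_def S.range_space_def)
  have expansion: "expansion M I e b F \<longleftrightarrow> S.eigen_expansion b F" for b F
    by (simp add: expansion_def vsums_def L.converges_def L.lincomb_def)
  let ?P = "power_seq_norm I \<mu> \<theta> r" and ?N = "interp_norm (L2 M) S.range_space \<theta> r"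
  have unique: "?P b = ?P (S.coef F)" "S.eigen_expansion (S.coef F) F"
    if "F \<in> vcarrier (L2 M)" "expansion M I e b F" for b F
  proof -
    have b: "b i = S.coef F i" if "i \<in> I" for i
      using S.eigen_expansion_coef \<open>F \<in> _\<close> \<open>expansion M I e b F\<close> that by (simp add: expansion)
    then show "?P b = ?P (S.coef F)" by (rule power_seq_norm_cong)
    have "L.lincomb I b (\<lambda>i. ae_class M (e i)) = L.lincomb I (S.coef F) (\<lambda>i. ae_class M (e i))"
      unfolding L.lincomb_def using b by (intro arg_cong[where f="vpsum (L2 M)"]) (simp add: fun_eq_iff)
    then show "S.eigen_expansion (S.coef F) F" using that(2) by (simp add: expansion)
  qed
  obtain C D where C: "C > 0" and D: "D > 0"
    and PN: "\<And>F. F \<in> vcarrier (L2 M) \<Longrightarrow> ?P (S.coef F) \<le> ennreal C * ?N F"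
    and NP: "\<And>F. \<lbrakk>F \<in> vcarrier (L2 M); S.eigen_expansion (S.coef F) F; ?P (S.coef F) < top\<rbrakk>
      \<Longrightarrow> ?N F \<le> ennreal D * ?P (S.coef F)"
    by (rule S.power_norm_equiv_interp_norm[OF assms(1-3)]) (rule that)
  have power_carrier: "F \<in> vcarrier (power_space M I \<mu> e \<theta> r)
      \<longleftrightarrow> F \<in> vcarrier (L2 M) \<and> S.eigen_expansion (S.coef F) F \<and> ?P (S.coef F) < top" for F
  proof -
    have "(\<exists>b. ?P b < top \<and> expansion M I e b F) \<longleftrightarrow> S.eigen_expansion (S.coef F) F \<and> ?P (S.coef F) < top"
      if F: "F \<in> vcarrier (L2 M)"
    proof
      assume "\<exists>b. ?P b < top \<and> expansion M I e b F"
      then obtain b where b: "?P b < top" "expansion M I e b F" by blast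
      then show "S.eigen_expansion (S.coef F) F \<and> ?P (S.coef F) < top"
        using unique[OF F b(2)] by simp
    next
      assume "S.eigen_expansion (S.coef F) F \<and> ?P (S.coef F) < top"
      then show "\<exists>b. ?P b < top \<and> expansion M I e b F"
        by (intro exI[of _ "S.coef F"]) (simp add: expansion)
    qed
    then show ?thesis by (auto simp: power_space_def)
  qed
  have power_norm: "vnorm (power_space M I \<mu> e \<theta> r) F = enn2real (?P (S.coef F))"
    if "F \<in> vcarrier (power_space M I \<mu> e \<theta> r)" for F
  proof -
    have F: "F \<in> vcarrier (L2 M)" "S.eigen_expansion (S.coef F) F" "?P (S.coef F) < top"
      using that power_carrier by auto
    have "(THE s. \<exists>b. ?P b < top \<and> expansion M I e b F \<and> s = ?P b) = ?P (S.coef F)"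
    proof (rule the_equality)
      show "\<exists>b. ?P b < top \<and> expansion M I e b F \<and> ?P (S.coef F) = ?P b"
        using F by (intro exI[of _ "S.coef F"]) (simp add: expansion)
    qed (use unique(1)[OF F(1)] in blast)
    then show ?thesis by (simp add: power_space_def)
  qed
  have carriers: "vcarrier (power_space M I \<mu> e \<theta> r)
      = vcarrier (interp_space (L2 M) (quotient_space M H) \<theta> r)"
  proof (intro set_eqI iffI)
    fix F assume "F \<in> vcarrier (power_space M I \<mu> e \<theta> r)"
    then have F: "F \<in> vcarrier (L2 M)" "S.eigen_expansion (S.coef F) F" "?P (S.coef F) < top"
      by (simp_all add: power_carrier)
    have "ennreal D * ?P (S.coef F) < top" using F(3) by (simp add: ennreal_mult_less_top)
    then have "?N F < top" using NP[OF F] by (rule le_less_trans[rotated])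
    then show "F \<in> vcarrier (interp_space (L2 M) (quotient_space M H) \<theta> r)"
      using F(1) by (simp add: interp_space_def quot)
  next
    fix F assume "F \<in> vcarrier (interp_space (L2 M) (quotient_space M H) \<theta> r)"
    then have F: "F \<in> vcarrier (L2 M)" "?N F < top" by (simp_all add: interp_space_def quot)
    have "ennreal C * ?N F < top" using F(2) by (simp add: ennreal_mult_less_top)
    then have "?P (S.coef F) < top" using PN[OF F(1)] by (rule le_less_trans[rotated])
    then show "F \<in> vcarrier (power_space M I \<mu> e \<theta> r)"
      using F S.eigen_expansion_of_interp[OF F(1) assms(1,3) F(2)] by (simp add: power_carrier)
  qed
  have enn2real_le: "enn2real x \<le> c * enn2real y"
    if "x \<le> ennreal c * y" "y < top" "c > 0" for x y :: ennreal and c :: real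
  proof -
    have "enn2real x \<le> enn2real (ennreal c * y)"
      using that by (intro enn2real_mono) (auto simp: ennreal_mult_less_top)
    then show ?thesis using that(3) by (simp add: enn2real_mult)
  qed
  have norms: "1 / C * vnorm (power_space M I \<mu> e \<theta> r) F
        \<le> vnorm (interp_space (L2 M) (quotient_space M H) \<theta> r) F"
      "vnorm (interp_space (L2 M) (quotient_space M H) \<theta> r) F
        \<le> D * vnorm (power_space M I \<mu> e \<theta> r) F"
    if F: "F \<in> vcarrier (power_space M I \<mu> e \<theta> r)" for F
  proof -
    have P: "F \<in> vcarrier (L2 M)" "S.eigen_expansion (S.coef F) F" "?P (S.coef F) < top"
      using F by (simp_all add: power_carrier)
    have N: "?N F < top" using F unfolding carriers by (simp add: interp_space_def quot)
    have norm_N: "vnorm (interp_space (L2 M) (quotient_space M H) \<theta> r) F = enn2real (?N F)"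
      by (simp add: interp_space_def quot)
    show "1 / C * vnorm (power_space M I \<mu> e \<theta> r) F
        \<le> vnorm (interp_space (L2 M) (quotient_space M H) \<theta> r) F"
      using enn2real_le[OF PN[OF P(1)] N C] C by (simp add: power_norm[OF F] norm_N field_simps)
    show "vnorm (interp_space (L2 M) (quotient_space M H) \<theta> r) F
        \<le> D * vnorm (power_space M I \<mu> e \<theta> r) F"
      using enn2real_le[OF NP[OF P] P(3) D] by (simp add: power_norm[OF F] norm_N)
  qed
  have "1 / C > 0" using C by simp
  then have "equivalent_norms (vcarrier (power_space M I \<mu> e \<theta> r))
      (vnorm (power_space M I \<mu> e \<theta> r)) (vnorm (interp_space (L2 M) (quotient_space M H) \<theta> r))"
    unfolding equivalent_norms_def using D norms by blast
  with carriers show ?thesis by blast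
qed

end
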